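(* Let $\lambda_{\text{met}}$ and $\lambda^\varepsilon_{\text{cer}}:=\lambda_{\text{met}}+\varepsilon D_c$, $\varepsilon>0$, $D_c\ge0$, be the first Lamé parameters of a metal and a ceramic material, respectively, and suppose that these materials have the same shear modulus $\mu>0$. Then there exists an $\varepsilon_0>0$ such that for all $\varepsilon\in(0,\varepsilon_0)$ the two dimensional embedded cell algorithm converges (that is, $\lambda^{\varepsilon,\text{dummy}}:=\lim_{n\to\infty}\lambda^{\varepsilon,\text{dummy}}(n)$ exists) and $$\lambda^{\varepsilon,\text{dummy}}=\lambda_{\text{met}}+\varepsilon|\Omega_c|D_c+\mathcal{O}(\varepsilon^2).$$ Moreover, if $\lambda^{\varepsilon,\text{hom}}$ is the effective first Lamé parameter of the corresponding periodic composite, then $$\lambda^{\varepsilon,\text{hom}}-\lambda^{\varepsilon,\text{dummy}}=\mathcal{O}(\varepsilon^2)$$ and consequently $$F[\lambda^{\varepsilon,\text{hom}},\mu,l]-F[\lambda^{\varepsilon,\text{dummy}},\mu,l]=\mathcal{O}(\varepsilon^2)$$ for all $\varepsilon\in(0,\varepsilon_0)$.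
   Context: Let $\Omega=(0,1)^2$ and $\Gamma_1=\{x\in\partial\Omega:x_2\in\{0,1\}\}$. For $u\in H^1(\Omega)^2$ write $(u)_i$ for its components, $\nabla^su=(\nabla u+(\nabla u)^T)/2$, $\operatorname{tr}$ for the trace of a matrix, and $A:B=\operatorname{tr}(A^TB)$. For $l\in\mathbb{R}$ let $\mathcal{W}_l$ be the set of $u\in H^1(\Omega)^2$ with $\int_\Omega(u)_1dx=0$ and, in the trace sense, $(u)_2=l$ on $\{x_2=1\}$ and $(u)_2=0$ on $\{x_2=0\}$, with the $H^1$-norm. For material parameters $\lambda,\mu$ (first Lamé parameter and shear modulus) the solution of the tensile test is the unique $u\in\mathcal{W}_l$ with $\int_\Omega\lambda\operatorname{tr}(\nabla^su)\operatorname{tr}(\nabla^sv)+2\mu\nabla^su:\nabla^sv\,dx=0$ for all $v\in\mathcal{W}_0$, and the tensile force is $F[\lambda,\mu,l]=\int_\Omega\lambda\operatorname{tr}(\nabla^su)+2\mu\,\partial_2(u)_2\,dx$. $\mathcal{O}(\varepsilon^2)$ means bounded in absolute value by $C\varepsilon^2$ with $C$ independent of $\varepsilon\in(0,\varepsilon_0)$. Material: constants $\lambda_{\text{met}}>0$, $\mu>0$, $D_c\ge0$ independent of $\varepsilon$. $\Omega=\Omega_m\cup\Omega_c$ is a disjoint decomposition into metal and ceramic regions; $|\cdot|$ is area. Embedded cell geometry: with $\bar x=(0.5,0.5)^T$ and closed balls $B_r(\bar x)$, $\widetilde\Omega_c=B_{r_1}(\bar x)$, $\widetilde\Omega_m=B_{r_2}(\bar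 x)\setminus B_{r_1}(\bar x)$, $\widetilde\Omega_{\text{dummy}}=\Omega\setminus(\widetilde\Omega_m\cup\widetilde\Omega_c)$, where $0<r_1\le r_2\le0.1$ are chosen such that $|\Omega_c|/|\Omega_m|=|\widetilde\Omega_c|/|\widetilde\Omega_m|$. Two dimensional embedded cell algorithm (deformation length $l>0$): $\lambda^{\varepsilon,\text{dummy}}(0)=|\Omega_c|\lambda^\varepsilon_{\text{cer}}+|\Omega_m|\lambda_{\text{met}}$; for $n=1,2,\dots$ put $\lambda^{n-1}=\chi_{\widetilde\Omega_c}\lambda^\varepsilon_{\text{cer}}+\chi_{\widetilde\Omega_m}\lambda_{\text{met}}+\chi_{\widetilde\Omega_{\text{dummy}}}\lambda^{\varepsilon,\text{dummy}}(n-1)$, $F^n=F[\lambda^{n-1},\mu,l]$, and $\lambda^{\varepsilon,\text{dummy}}(n)=(F^n-2\mu l)\left(2l-\frac{F^n}{2\mu}\right)^{-1}$. Effective parameters: let $\chi^{\text{per}}_{\Omega_c}$ be the 1-periodic (in both variables) continuation of $\chi_{\Omega_c}$ to $\mathbb{R}^2$, $\lambda^{\varepsilon,\delta}(x)=\lambda_{\text{met}}+\varepsilon D_c\chi^{\text{per}}_{\Omega_c}(x/\delta)$ for $\delta>0$, and let $u^{\varepsilon,\delta}\in\mathcal{W}_l$ be the solution of the tensile test with parameters $\lambda^{\varepsilon,\delta},\mu$. The effective material parameters are constants $\lambda^{\varepsilon,\text{hom}},\mu^{\varepsilon,\text{hom}}\in\mathbb{R}$ such that, for some $u^{\varepsilon,\text{hom}}\in\mathcal{W}_l$,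 as $\delta\to0$, $u^{\varepsilon,\delta}\rightharpoonup u^{\varepsilon,\text{hom}}$ weakly in $H^1(\Omega)$ and $\lambda^{\varepsilon,\delta}\operatorname{tr}(\nabla^su^{\varepsilon,\delta})I+2\mu\nabla^su^{\varepsilon,\delta}\rightharpoonup\lambda^{\varepsilon,\text{hom}}\operatorname{tr}(\nabla^su^{\varepsilon,\text{hom}})I+2\mu^{\varepsilon,\text{hom}}\nabla^su^{\varepsilon,\text{hom}}$ weakly in $L^2(\Omega,\mathbb{R}^{2\times2})$, and $u^{\varepsilon,\text{hom}}$ solves the tensile test with parameters $\lambda^{\varepsilon,\text{hom}},\mu^{\varepsilon,\text{hom}}$. *)

theory Defs
  imports "HOL-Analysis.Analysis"
begin

section \<open>Smooth functions on the plane\<close>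

definition partial :: "2 \<Rightarrow> (real^2 \<Rightarrow> real) \<Rightarrow> real^2 \<Rightarrow> real" where
  "partial j f x = frechet_derivative f (at x) (axis j 1)"

definition grad :: "(real^2 \<Rightarrow> real) \<Rightarrow> real^2 \<Rightarrow> real^2" where
  "grad f x = (\<chi> j. partial j f x)"

primrec C_k :: "nat \<Rightarrow> (real^2 \<Rightarrow> real) \<Rightarrow> bool" where
  "C_k 0 f \<longleftrightarrow> continuous_on UNIV f"
| "C_k (Suc k) f \<longleftrightarrow> f differentiable_on UNIV \<and> (\<forall>j. C_k k (partial j f))"

definition smooth :: "(real^2 \<Rightarrow> real) \<Rightarrow> bool" where
  "smooth f \<longleftrightarrow> (\<forall>k. C_k k f)"

section \<open>Function spaces on the unit square\<close>

definition Omega :: "(real^2) set" where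
  "Omega = {x. 0 < x$1 \<and> x$1 < 1 \<and> 0 < x$2 \<and> x$2 < 1}"

definition test_functions :: "(real^2 \<Rightarrow> real) set" where
  "test_functions = {\<phi>. smooth \<phi> \<and> compact (closure {x. \<phi> x \<noteq> 0}) \<and> closure {x. \<phi> x \<noteq> 0} \<subseteq> Omega}"

text \<open>
  Elements of Lebesgue and Sobolev spaces are represented by functions on the whole plane, of which
  only the values almost everywhere on the square matter. On matrices, \<^term>\<open>norm\<close> is the
  Frobenius norm.
\<close>

definition L2 :: "(real^2 \<Rightarrow> 'b::euclidean_space) set" where
  "L2 = {f. f \<in> borel_measurable (lebesgue_on Omega) \<and>
            integrable (lebesgue_on Omega) (\<lambda>x. (norm (f x))\<^sup>2)}"

definition L2_norm :: "(real^2 \<Rightarrow> 'b::euclidean_space) \<Rightarrow> real" where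
  "L2_norm f = sqrt (LINT x|lebesgue_on Omega. (norm (f x))\<^sup>2)"

definition weak_gradient :: "(real^2 \<Rightarrow> real) \<Rightarrow> (real^2 \<Rightarrow> real^2) \<Rightarrow> bool" where
  "weak_gradient f g \<longleftrightarrow> f \<in> L2 \<and> g \<in> L2 \<and>
     (\<forall>\<phi>\<in>test_functions. \<forall>j.
        (LINT x|lebesgue_on Omega. f x * partial j \<phi> x) =
        - (LINT x|lebesgue_on Omega. g x $ j * \<phi> x))"

text \<open>The entry in row \<open>i\<close> and column \<open>j\<close> is the weak derivative of component \<open>i\<close> in direction \<open>j\<close>.\<close>

definition weak_jacobian :: "(real^2 \<Rightarrow> real^2) \<Rightarrow> (real^2 \<Rightarrow> real^2^2) \<Rightarrow> bool" where
  "weak_jacobian u G \<longleftrightarrow> (\<forall>i. weak_gradient (\<lambda>x. u x $ i) (\<lambda>x. G x $ i))"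

definition H1 :: "(real^2 \<Rightarrow> real^2) set" where
  "H1 = {u. \<exists>G. weak_jacobian u G}"

definition Jac :: "(real^2 \<Rightarrow> real^2) \<Rightarrow> real^2 \<Rightarrow> real^2^2" where
  "Jac u = (SOME G. weak_jacobian u G)"

definition H1_norm :: "(real^2 \<Rightarrow> real^2) \<Rightarrow> real" where
  "H1_norm u = sqrt ((L2_norm u)\<^sup>2 + (L2_norm (Jac u))\<^sup>2)"

text \<open>
  \<open>has_trace s f g\<close>: the trace of the scalar function \<open>f\<close> on the edge where the second coordinate
  is \<open>s\<close> (used for \<open>s = 0\<close> and \<open>s = 1\<close>) is \<open>g\<close>. The trace operator is the continuous extension
  of the restriction map from functions smooth up to the boundary, with the \<open>H\<^sup>1\<close>-norm on the square
  and the \<open>L\<^sup>2\<close>-norm on the edge.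
\<close>

definition has_trace :: "real \<Rightarrow> (real^2 \<Rightarrow> real) \<Rightarrow> (real \<Rightarrow> real) \<Rightarrow> bool" where
  "has_trace s f g \<longleftrightarrow> (\<exists>G \<phi>. weak_gradient f G \<and> (\<forall>k::nat. smooth (\<phi> k)) \<and>
     (\<lambda>k. L2_norm (\<lambda>x. \<phi> k x - f x)) \<longlonglongrightarrow> 0 \<and>
     (\<lambda>k. L2_norm (\<lambda>x. grad (\<phi> k) x - G x)) \<longlonglongrightarrow> 0 \<and>
     g \<in> borel_measurable (lebesgue_on {0..1}) \<and>
     integrable (lebesgue_on {0..1}) (\<lambda>t. (g t)\<^sup>2) \<and>
     (\<lambda>k. LINT t|lebesgue_on {0..1}. (\<phi> k (vector [t, s]) - g t)\<^sup>2) \<longlonglongrightarrow> 0)"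

section \<open>Tensile test\<close>

definition W :: "real \<Rightarrow> (real^2 \<Rightarrow> real^2) set" where
  "W l = {u \<in> H1. (LINT x|lebesgue_on Omega. u x $ 1) = 0 \<and>
            has_trace 1 (\<lambda>x. u x $ 2) (\<lambda>_. l) \<and> has_trace 0 (\<lambda>x. u x $ 2) (\<lambda>_. 0)}"

definition sym_grad :: "(real^2 \<Rightarrow> real^2) \<Rightarrow> real^2 \<Rightarrow> real^2^2" where
  "sym_grad u x = (1/2) *\<^sub>R (Jac u x + transpose (Jac u x))"

definition frob :: "real^2^2 \<Rightarrow> real^2^2 \<Rightarrow> real" where
  "frob A B = trace (transpose A ** B)"

definition tensile_solution ::
  "(real^2 \<Rightarrow> real) \<Rightarrow> (real^2 \<Rightarrow> real) \<Rightarrow> real \<Rightarrow> (real^2 \<Rightarrow> real^2) \<Rightarrow> bool" where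
  "tensile_solution lam mu l u \<longleftrightarrow> u \<in> W l \<and>
     (\<forall>v\<in>W 0. (LINT x|lebesgue_on Omega.
        lam x * trace (sym_grad u x) * trace (sym_grad v x)
        + 2 * mu x * frob (sym_grad u x) (sym_grad v x)) = 0)"

text \<open>
  Solutions are unique only almost everywhere, hence the description ranges over the value of
  the force rather than over the solution.
\<close>

definition tensile_force :: "(real^2 \<Rightarrow> real) \<Rightarrow> (real^2 \<Rightarrow> real) \<Rightarrow> real \<Rightarrow> real" where
  "tensile_force lam mu l = (THE F. \<exists>u. tensile_solution lam mu l u \<and>
     F = (LINT x|lebesgue_on Omega. lam x * trace (sym_grad u x) + 2 * mu x * Jac u x $ 2 $ 2))"

section \<open>Embedded cell algorithm\<close>

definition center :: "real^2" where
  "center = vector [1/2, 1/2]"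

definition cell_c :: "real \<Rightarrow> (real^2) set" where
  "cell_c r1 = cball center r1"

definition cell_m :: "real \<Rightarrow> real \<Rightarrow> (real^2) set" where
  "cell_m r1 r2 = cball center r2 - cball center r1"

definition cell_dummy :: "real \<Rightarrow> real \<Rightarrow> (real^2) set" where
  "cell_dummy r1 r2 = Omega - (cell_m r1 r2 \<union> cell_c r1)"

text \<open>
  The area ratios are compared in \<^typ>\<open>ennreal\<close>, where a positive number divided by zero
  is \<open>\<infinity>\<close>. So \<open>r1 = r2\<close> is admissible exactly if the metal region is a null set.
\<close>

definition admissible_radii :: "(real^2) set \<Rightarrow> (real^2) set \<Rightarrow> real \<Rightarrow> real \<Rightarrow> bool" where
  "admissible_radii Oc Om r1 r2 \<longleftrightarrow> 0 < r1 \<and> r1 \<le> r2 \<and> r2 \<le> 1/10 \<and>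
     emeasure lebesgue Oc / emeasure lebesgue Om =
     emeasure lebesgue (cell_c r1) / emeasure lebesgue (cell_m r1 r2)"

definition cell_lam :: "real \<Rightarrow> real \<Rightarrow> real \<Rightarrow> real \<Rightarrow> real \<Rightarrow> real^2 \<Rightarrow> real" where
  "cell_lam lam_cer lam_met r1 r2 d x =
     indicator (cell_c r1) x * lam_cer + indicator (cell_m r1 r2) x * lam_met
     + indicator (cell_dummy r1 r2) x * d"

definition cell_force :: "real \<Rightarrow> real \<Rightarrow> real \<Rightarrow> real \<Rightarrow> real \<Rightarrow> real \<Rightarrow> real \<Rightarrow> real" where
  "cell_force lam_cer lam_met mu l r1 r2 d =
     tensile_force (cell_lam lam_cer lam_met r1 r2 d) (\<lambda>_. mu) l"

primrec embedded_cell :: "real \<Rightarrow> real \<Rightarrow> real \<Rightarrow> real \<Rightarrow> (real^2) set \<Rightarrow> (real^2) set \<Rightarrow>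
    real \<Rightarrow> real \<Rightarrow> nat \<Rightarrow> real" where
  "embedded_cell lam_cer lam_met mu l Oc Om r1 r2 0 =
     measure lebesgue Oc * lam_cer + measure lebesgue Om * lam_met"
| "embedded_cell lam_cer lam_met mu l Oc Om r1 r2 (Suc n) =
     (let F = cell_force lam_cer lam_met mu l r1 r2
                (embedded_cell lam_cer lam_met mu l Oc Om r1 r2 n)
      in (F - 2 * mu * l) / (2 * l - F / (2 * mu)))"

section \<open>Effective parameters\<close>

text \<open>
  Points with an integer coordinate form a null set; there the periodic continuation of the
  indicator function is taken to be zero.
\<close>

definition periodic_indicator :: "(real^2) set \<Rightarrow> real^2 \<Rightarrow> real" where
  "periodic_indicator Oc x = indicator (Oc \<inter> Omega) (\<chi> i. frac (x $ i))"

definition composite_lam :: "real \<Rightarrow> real \<Rightarrow> real \<Rightarrow> (real^2) set \<Rightarrow> real \<Rightarrow> real^2 \<Rightarrow> real" where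
  "composite_lam lam_met Dc e Oc d x = lam_met + e * Dc * periodic_indicator Oc ((1/d) *\<^sub>R x)"

definition stress ::
  "(real^2 \<Rightarrow> real) \<Rightarrow> (real^2 \<Rightarrow> real) \<Rightarrow> (real^2 \<Rightarrow> real^2) \<Rightarrow> real^2 \<Rightarrow> real^2^2" where
  "stress lam mu u x = (lam x * trace (sym_grad u x)) *\<^sub>R mat 1 + (2 * mu x) *\<^sub>R sym_grad u x"

text \<open>
  Bounded linear functionals on a space \<open>V\<close> with seminorm \<open>N\<close>. Boundedness makes them insensitive
  to the choice of representatives.
\<close>

definition bounded_functional ::
  "(real^2 \<Rightarrow> 'b::euclidean_space) set \<Rightarrow> ((real^2 \<Rightarrow> 'b) \<Rightarrow> real) \<Rightarrow> ((real^2 \<Rightarrow> 'b) \<Rightarrow> real) \<Rightarrow> bool" where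
  "bounded_functional V N L \<longleftrightarrow>
     (\<forall>f\<in>V. \<forall>g\<in>V. \<forall>a b. L (\<lambda>x. a *\<^sub>R f x + b *\<^sub>R g x) = a * L f + b * L g) \<and>
     (\<exists>K. \<forall>f\<in>V. \<bar>L f\<bar> \<le> K * N f)"

definition weakly_tendsto ::
  "(real^2 \<Rightarrow> 'b::euclidean_space) set \<Rightarrow> ((real^2 \<Rightarrow> 'b) \<Rightarrow> real) \<Rightarrow>
   (real \<Rightarrow> real^2 \<Rightarrow> 'b) \<Rightarrow> (real^2 \<Rightarrow> 'b) \<Rightarrow> real filter \<Rightarrow> bool" where
  "weakly_tendsto V N f g \<F> \<longleftrightarrow> (\<forall>\<^sub>F d in \<F>. f d \<in> V) \<and> g \<in> V \<and>
     (\<forall>L. bounded_functional V N L \<longrightarrow> ((\<lambda>d. L (f d)) \<longlongrightarrow> L g) \<F>)"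

definition effective_parameters ::
  "real \<Rightarrow> real \<Rightarrow> real \<Rightarrow> real \<Rightarrow> real \<Rightarrow> (real^2) set \<Rightarrow> real \<Rightarrow> real \<Rightarrow> bool" where
  "effective_parameters lam_met Dc e mu l Oc lam_hom mu_hom \<longleftrightarrow>
     (\<exists>u u_hom.
        (\<forall>d>0. tensile_solution (composite_lam lam_met Dc e Oc d) (\<lambda>_. mu) l (u d)) \<and>
        weakly_tendsto H1 H1_norm u u_hom (at_right 0) \<and>
        weakly_tendsto L2 L2_norm
          (\<lambda>d. stress (composite_lam lam_met Dc e Oc d) (\<lambda>_. mu) (u d))
          (stress (\<lambda>_. lam_hom) (\<lambda>_. mu_hom) u_hom) (at_right 0) \<and>
        tensile_solution (\<lambda>_. lam_hom) (\<lambda>_. mu_hom) l u_hom)"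

end

theory Submission
  imports Defs
begin

text \<open>
  For a homogeneous material with first Lame parameter \<open>c\<close> the tensile test has an affine solution, with
  force \<open>4 \<mu> l (c + \<mu>) / (c + 2 \<mu>)\<close>. The update rule of the embedded cell algorithm is the inverse of this
  function: it assigns to a force the homogeneous material that produces it. Everything follows from two
  properties of the map \<open>\<Lambda>\<close> that assigns to a distribution \<open>\<lambda>\<close> of the parameter the homogeneous material
  with the same force. First, \<open>\<Lambda>\<close> is monotone, because \<open>l\<close> times the force is the minimal elastic energy
  (\<open>tensile_force_mono\<close>). Secondly, if \<open>L \<le> \<lambda> \<le> L + \<delta>\<close>, then \<open>\<Lambda>(\<lambda>)\<close> is the mean value of \<open>\<lambda>\<close> up to an
  error of order \<open>\<delta>\<^sup>2\<close>, uniformly in \<open>\<lambda>\<close> (\<open>lame_expansion\<close>). The reason is that the strain changes by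
  \<open>O(\<delta>)\<close> in \<open>L\<^sup>2\<close>, while the first order change of the force is an integral of \<open>\<lambda> - L\<close> against the strain.

  One step of the algorithm maps \<open>d\<close> to \<open>\<Lambda>\<close> of the cell with dummy parameter \<open>d\<close>. By monotonicity it maps
  the interval between the two material parameters into itself and its iterates form a monotone
  sequence, so they converge. Up to second order the step is the affine map with slope
  \<open>1 - |B\<^sub>r\<^sub>2|\<close> that fixes \<open>\<lambda>\<^sub>m\<^sub>e\<^sub>t + \<epsilon> |\<Omega>\<^sub>c| D\<^sub>c\<close>, which locates the limit (\<open>embedded_cell_converges\<close>).

  For the periodic composite, the mean normal stresses and the mean lateral strain pass to the weak limit
  and determine the effective parameters: the shear modulus is \<open>\<mu>\<close>, and the first Lame parameter is the
  limit of \<open>\<Lambda>\<close> of the composites. Along the periods \<open>1/N\<close> the mean value of the parameter is exactly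
  \<open>\<lambda>\<^sub>m\<^sub>e\<^sub>t + \<epsilon> |\<Omega>\<^sub>c| D\<^sub>c\<close>, so \<open>lame_expansion\<close> applies again (\<open>effective_parameters_estimate\<close>).

  The force is a definite description, so these arguments rest on the existence of solutions for
  bounded measurable \<open>\<lambda> \<ge> 0\<close> (\<open>tensile_solution_exists\<close>) and on the uniqueness of their force
  (\<open>tensile_force_eq\<close>). Existence is proved by minimising the energy over trigonometric fields with
  cosines in the first component and a sine in \<open>x\<^sub>2\<close> in the second. On these fields Korn's inequality
  decouples into inequalities for functions of one variable, one for each mode (\<open>korn_mode\<close>). They are
  dense in the space of test fields because Fourier series respect the boundary conditions (\<open>trig_fields_dense\<close>).
\<close>

section \<open>Smooth functions of two variables\<close>

lemma C_k_Suc_diff: "C_k (Suc k) f \<Longrightarrow> f differentiable (at x)"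
  by (simp add: differentiable_on_def)

lemma C_k_continuous: "C_k k f \<Longrightarrow> continuous_on UNIV f"
  by (cases k) (simp_all add: differentiable_imp_continuous_on[of f UNIV])

lemma C_k_mono: "C_k (Suc k) f \<Longrightarrow> C_k k f"
proof (induction k arbitrary: f)
  case 0 then show ?case using C_k_continuous[OF 0] by simp
next
  case (Suc k)
  then show ?case by (metis C_k.simps(2))
qed

lemma partial_eqI:
  assumes "(f has_derivative D) (at x)" shows "partial j f x = D (axis j 1)"
  using frechet_derivative_at[OF assms] by (simp add: partial_def)

lemma partial_add:
  assumes "f differentiable (at x)" "g differentiable (at x)"
  shows "partial j (\<lambda>x. f x + g x) x = partial j f x + partial j g x"
  using has_derivative_add[OF assms[unfolded frechet_derivative_works]]
  by (simp add: partial_eqI partial_def[of _ f] partial_def[of _ g])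

lemma partial_mult:
  assumes "f differentiable (at x)" "g differentiable (at x)"
  shows "partial j (\<lambda>x. f x * g x) x = f x * partial j g x + partial j f x * g x"
  using has_derivative_mult[OF assms[unfolded frechet_derivative_works]]
  by (simp add: partial_eqI partial_def[of _ f] partial_def[of _ g])

lemma partial_coord:
  assumes "(F has_real_derivative D) (at (x$i))"
  shows "partial j (\<lambda>x. F (x$i)) x = (if i = j then D else 0)"
    and "(\<lambda>x::real^2. F (x$i)) differentiable (at x)"
proof -
  have "((\<lambda>x::real^2. x$i) has_derivative (\<lambda>x. x$i)) (at x)"
    by (rule bounded_linear_imp_has_derivative) (rule bounded_linear_vec_nth)
  from has_derivative_compose[OF this assms[unfolded has_field_derivative_def]]
  have *: "((\<lambda>x. F (x$i)) has_derivative (\<lambda>h. D * h$i)) (at x)"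
    by (simp add: o_def)
  show "partial j (\<lambda>x. F (x$i)) x = (if i = j then D else 0)"
    using partial_eqI[OF *] by (auto simp: axis_def)
  show "(\<lambda>x::real^2. F (x$i)) differentiable (at x)"
    using * unfolding differentiable_def by blast
qed

lemma C_k_const: "C_k k (\<lambda>_. c)"
proof (induction k arbitrary: c)
  case (Suc k)
  have "partial j (\<lambda>_. c) = (\<lambda>_. 0)" for j
    by (rule ext) (simp add: partial_eqI[OF has_derivative_const])
  with Suc show ?case by simp
qed simp

lemma C_k_add: "C_k k f \<Longrightarrow> C_k k g \<Longrightarrow> C_k k (\<lambda>x. f x + g x)"
proof (induction k arbitrary: f g)
  case (Suc k)
  have "partial j (\<lambda>x. f x + g x) = (\<lambda>x. partial j f x + partial j g x)" for j
    by (rule ext, rule partial_add) (use Suc C_k_Suc_diff in blast)+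
  with Suc show ?case by (auto intro: differentiable_on_add)
qed (auto intro: continuous_on_add)

lemma C_k_mult: "C_k k f \<Longrightarrow> C_k k g \<Longrightarrow> C_k k (\<lambda>x. f x * g x)"
proof (induction k arbitrary: f g)
  case (Suc k)
  have "partial j (\<lambda>x. f x * g x) = (\<lambda>x. f x * partial j g x + partial j f x * g x)" for j
    by (rule ext, rule partial_mult) (use Suc C_k_Suc_diff in blast)+
  moreover have "C_k k (\<lambda>x. f x * partial j g x + partial j f x * g x)" for j
    using Suc.prems C_k_mono by (intro C_k_add Suc.IH) auto
  ultimately show ?case using Suc.prems by (auto intro: differentiable_on_mult)
qed (auto intro: continuous_on_mult)

lemma smooth_const: "smooth (\<lambda>_. c)"
  and smooth_add: "smooth f \<Longrightarrow> smooth g \<Longrightarrow> smooth (\<lambda>x. f x + g x)"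
  and smooth_mult: "smooth f \<Longrightarrow> smooth g \<Longrightarrow> smooth (\<lambda>x. f x * g x)"
  by (auto simp: smooth_def C_k_const C_k_add C_k_mult)

lemma smooth_cmult: "smooth f \<Longrightarrow> smooth (\<lambda>x. c * f x)"
  by (intro smooth_mult smooth_const)

lemma smooth_diff: "smooth f \<Longrightarrow> smooth g \<Longrightarrow> smooth (\<lambda>x. f x - g x)"
  using smooth_add[of f "\<lambda>x. (-1) * g x"] smooth_cmult[of g "-1"] by simp

lemma smooth_sum: "(\<And>i. i \<in> A \<Longrightarrow> smooth (f i)) \<Longrightarrow> smooth (\<lambda>x. \<Sum>i\<in>A. f i x)"
  by (induction A rule: infinite_finite_induct) (auto intro: smooth_const smooth_add)

lemma smooth_differentiable: "smooth f \<Longrightarrow> f differentiable (at x)"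
  using C_k_Suc_diff unfolding smooth_def by blast

lemma smooth_partial: "smooth f \<Longrightarrow> smooth (partial j f)"
  unfolding smooth_def by (metis C_k.simps(2))

lemma smooth_continuous: "smooth f \<Longrightarrow> continuous_on S f"
  unfolding smooth_def using C_k_continuous continuous_on_subset by blast

lemma partial_cmult: "f differentiable (at x) \<Longrightarrow> partial j (\<lambda>x. c * f x) x = c * partial j f x"
  using partial_mult[of "\<lambda>_. c" x f j] by (simp add: partial_eqI[OF has_derivative_const])

lemma partial_sum:
  "(\<And>i. i \<in> A \<Longrightarrow> smooth (f i)) \<Longrightarrow> partial j (\<lambda>x. \<Sum>i\<in>A. f i x) x = (\<Sum>i\<in>A. partial j (f i) x)"
proof (induction A rule: infinite_finite_induct)
  case (insert a A)
  then show ?case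
    by (simp add: partial_add smooth_differentiable smooth_sum)
qed (simp_all add: partial_eqI[OF has_derivative_const])

text \<open>Differentiation maps the family into itself, up to a factor \<open>0\<close> or \<open>1\<close>, so \<open>C_k\<close> follows for all
  members at once by induction on \<open>k\<close>.\<close>

lemma smooth_coordI:
  fixes D :: "nat \<Rightarrow> real \<Rightarrow> real"
  assumes "\<And>n t. (D n has_real_derivative D (Suc n) t) (at t)"
  shows "smooth (\<lambda>x. D n (x$i))"
proof -
  have "C_k k (\<lambda>x. D n (x$i))" for k n
  proof (induction k arbitrary: n)
    case 0
    have "(\<lambda>x::real^2. D n (x$i)) differentiable_on UNIV"
      using partial_coord(2)[OF assms] by (simp add: differentiable_on_def)
    then show ?case by (simp add: differentiable_imp_continuous_on)
  next
    case (Suc k)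
    have "partial j (\<lambda>x. D n (x$i)) = (\<lambda>x. (if i = j then 1 else 0) * D (Suc n) (x$i))" for j
      by (rule ext) (use partial_coord(1)[OF assms] in auto)
    moreover have "(\<lambda>x::real^2. D n (x$i)) differentiable_on UNIV"
      using partial_coord(2)[OF assms] by (simp add: differentiable_on_def)
    ultimately show ?case using Suc C_k_mult[OF C_k_const] by simp
  qed
  then show ?thesis by (simp add: smooth_def)
qed

lemma smooth_coord: "smooth (\<lambda>x. x$i)"
proof -
  define D where "D = (\<lambda>(n::nat) t::real. if n = 0 then t else if n = 1 then 1 else 0::real)"
  have "(D n has_real_derivative D (Suc n) t) (at t)" for n t
    unfolding D_def by (cases "n = 0"; cases "n = 1") (auto intro!: derivative_eq_intros)
  from smooth_coordI[of D, OF this, of 0] show ?thesis by (simp add: D_def)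
qed

lemma smooth_trig: "smooth (\<lambda>x. sin (c * x$i))" "smooth (\<lambda>x. cos (c * x$i))"
proof -
  define D where "D = (\<lambda>b (n::nat) t::real. c ^ n * sin (c * t + b + real n * pi/2))"
  have "(D b n has_real_derivative D b (Suc n) t) (at t)" for n t b
  proof -
    have "sin (c * t + b + real (Suc n) * pi/2) = cos (c*t + b + real n * pi/2)"
      by (simp add: algebra_simps add_divide_distrib sin_add cos_add)
    then show ?thesis unfolding D_def
      by (auto intro!: derivative_eq_intros)
  qed
  (* The phase b gives the sine for b = 0 and the cosine for b = pi/2. *)
  note * = smooth_coordI[of "D b" for b, OF this, of _ 0 i]
  from *[of 0] show "smooth (\<lambda>x. sin (c * x$i))" by (simp add: D_def)
  from *[of "pi/2"] show "smooth (\<lambda>x. cos (c * x$i))" by (simp add: D_def sin_add)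
qed

section \<open>Cutoff functions\<close>

text \<open>For \<open>m = 0\<close> this is the classical smooth function that is flat at the origin. Its derivatives are
  combinations of the functions with larger \<open>m\<close>, so smoothness has to be proved for all \<open>m\<close>
  together.\<close>

definition flat :: "nat \<Rightarrow> real \<Rightarrow> real" where
  "flat m t = (if t \<le> 0 then 0 else exp (- (1/t)) / t ^ m)"

lemma flat_tendsto_0: "(flat m \<longlongrightarrow> 0) (at 0)"
proof -
  have "((\<lambda>y. y ^ m / exp y) \<longlongrightarrow> (0::real)) at_top" by (rule tendsto_power_div_exp_0)
  then have "((\<lambda>t. inverse t ^ m / exp (inverse t)) \<longlongrightarrow> (0::real)) (at_right 0)"
    using filterlim_inverse_at_top_right by (rule filterlim_compose)
  then have "(flat m \<longlongrightarrow> 0) (at_right 0)"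
    by (rule Lim_transform_eventually)
       (auto simp: eventually_at flat_def exp_minus field_simps intro!: exI[of _ 1])
  moreover have "(flat m \<longlongrightarrow> 0) (at_left 0)"
    by (rule tendsto_eventually) (auto simp: eventually_at flat_def intro!: exI[of _ 1])
  ultimately show ?thesis by (simp add: filterlim_split_at)
qed

lemma flat_deriv: "(flat m has_real_derivative (- real m * flat (Suc m) t + flat (Suc (Suc m)) t)) (at t)"
proof -
  consider "t < 0" | "t = 0" | "t > 0" by linarith
  then show ?thesis
  proof cases
    case 1
    have "((\<lambda>_. 0) has_real_derivative 0) (at t)" by simp
    then have "(flat m has_real_derivative 0) (at t)"
      by (rule has_field_derivative_transform_within[of _ _ _ _ "-t"])
         (use 1 in \<open>auto simp: flat_def dist_real_def\<close>)
    then show ?thesis using 1 by (simp add: flat_def)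
  next
    case 2
    have "((\<lambda>h. flat (Suc m) h) \<longlongrightarrow> 0) (at 0)" by (rule flat_tendsto_0)
    then have "((\<lambda>h. (flat m (0 + h) - flat m 0) / h) \<longlongrightarrow> 0) (at 0)"
      by (rule Lim_transform_eventually) (auto simp: flat_def eventually_at intro!: exI[of _ 1])
    then show ?thesis using 2 by (simp add: DERIV_def flat_def)
  next
    case 3
    have "((\<lambda>t. exp (- (1/t)) / t ^ m) has_real_derivative
            (- real m * (exp (- (1/t)) / t ^ Suc m) + exp (- (1/t)) / t ^ Suc (Suc m))) (at t)"
      using 3 apply (auto intro!: derivative_eq_intros simp: field_simps power2_eq_square)
      apply (cases m) apply (auto simp: field_simps)
      done
    then have "(flat m has_real_derivative (- real m * (exp (- (1/t)) / t ^ Suc m) + exp (- (1/t)) / t ^ Suc (Suc m))) (at t)"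
      by (rule has_field_derivative_transform_within[of _ _ _ _ t])
         (use 3 in \<open>auto simp: flat_def dist_real_def\<close>)
    then show ?thesis using 3 by (simp add: flat_def)
  qed
qed

lemma flat_deriv_affine:
  "((\<lambda>t. flat m (c * t + d)) has_real_derivative
     c * (- real m * flat (Suc m) (c * t + d) + flat (Suc (Suc m)) (c * t + d))) (at t)"
proof -
  have "((\<lambda>t. c * t + d) has_real_derivative c) (at t)" by (auto intro!: derivative_eq_intros)
  from DERIV_chain2[OF flat_deriv this] show ?thesis by (simp add: mult.commute)
qed

lemma smooth_flat: "smooth (\<lambda>x. flat m (c * x$i + d))"
proof -
  have "C_k k (\<lambda>x. flat m (c * x$i + d))" for k m
  proof (induction k arbitrary: m)
    case 0
    have "(\<lambda>x::real^2. flat m (c * x$i + d)) differentiable_on UNIV"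
      using partial_coord(2)[OF flat_deriv_affine] by (simp add: differentiable_on_def)
    then show ?case by (simp add: differentiable_imp_continuous_on)
  next
    case (Suc k)
    have "partial j (\<lambda>x. flat m (c * x$i + d)) = (\<lambda>x. (if i = j then c else 0) *
        ((- real m) * flat (Suc m) (c * x$i + d) + flat (Suc (Suc m)) (c * x$i + d)))" for j
      by (rule ext) (use partial_coord(1)[OF flat_deriv_affine] in auto)
    moreover have "(\<lambda>x::real^2. flat m (c * x$i + d)) differentiable_on UNIV"
      using partial_coord(2)[OF flat_deriv_affine] by (simp add: differentiable_on_def)
    moreover have "C_k k (\<lambda>x. (if i = j then c else 0) *
        ((- real m) * flat (Suc m) (c * x$i + d) + flat (Suc (Suc m)) (c * x$i + d)))" for j
      by (intro C_k_mult C_k_add C_k_const Suc)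
    ultimately show ?case unfolding C_k.simps by (metis (no_types, lifting))
  qed
  then show ?thesis by (simp add: smooth_def)
qed

text \<open>A smooth function supported in \<open>[a, b]\<close> with values in \<open>[0, 1]\<close>. As \<open>n\<close> grows it converges to the
  indicator function of the open interval, which is how smooth functions detect boxes.\<close>

definition bump :: "real \<Rightarrow> real \<Rightarrow> real \<Rightarrow> real \<Rightarrow> real" where
  "bump n a b t = flat 0 (n * (t - a)) * flat 0 (n * (b - t))"

definition dbump :: "real \<Rightarrow> real \<Rightarrow> real \<Rightarrow> real \<Rightarrow> real" where
  "dbump n a b t = n * flat 2 (n * (t - a)) * flat 0 (n * (b - t))
                 - flat 0 (n * (t - a)) * (n * flat 2 (n * (b - t)))"

lemma bump_deriv: "(bump n a b has_real_derivative dbump n a b t) (at t)"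
proof -
  have 1: "((\<lambda>t. flat 0 (n * (t - a))) has_real_derivative n * flat 2 (n * (t - a))) (at t)"
    using flat_deriv_affine[of 0 n "-n*a" t] by (simp add: algebra_simps numeral_2_eq_2)
  have 2: "((\<lambda>t. flat 0 (n * (b - t))) has_real_derivative - n * flat 2 (n * (b - t))) (at t)"
    using flat_deriv_affine[of 0 "-n" "n*b" t] by (simp add: algebra_simps numeral_2_eq_2)
  show ?thesis unfolding bump_def[abs_def] dbump_def
    by (rule DERIV_cong[OF DERIV_mult[OF 1 2]]) (simp add: algebra_simps)
qed

lemma smooth_bump: "smooth (\<lambda>x. bump n a b (x$i))"
proof -
  have "smooth (\<lambda>x. flat 0 (n * x$i + (-n*a)) * flat 0 ((-n) * x$i + n*b))"
    by (intro smooth_mult smooth_flat)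
  then show ?thesis by (simp add: bump_def algebra_simps)
qed

lemma flat0_bounds: "0 \<le> flat 0 t" "flat 0 t \<le> 1"
  by (auto simp: flat_def)

lemma bump_bounds: "0 \<le> bump n a b t" "bump n a b t \<le> 1"
  unfolding bump_def by (simp_all add: flat0_bounds mult_le_one)

lemma bump_0: "n \<ge> 0 \<Longrightarrow> t \<notin> {a<..<b} \<Longrightarrow> bump n a b t = 0"
  by (auto simp: bump_def flat_def mult_nonneg_nonpos)

lemma flat0_tendsto:
  assumes "filterlim f at_top F" shows "((\<lambda>n. flat 0 (f n)) \<longlongrightarrow> 1) F"
proof -
  have "((\<lambda>n. exp (- (1 / f n))) \<longlongrightarrow> exp (-0)) F"
    using tendsto_divide_0[OF tendsto_const filterlim_at_top_imp_at_infinity[OF assms], of 1]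
    by (intro tendsto_exp tendsto_minus)
  then have "((\<lambda>n. exp (- (1 / f n))) \<longlongrightarrow> 1) F" by simp
  then show ?thesis
  proof (rule Lim_transform_eventually)
    have "eventually (\<lambda>n. f n > 0) F" using assms by (simp add: filterlim_at_top_dense)
    then show "eventually (\<lambda>n. exp (- (1 / f n)) = flat 0 (f n)) F"
      by eventually_elim (simp add: flat_def)
  qed
qed

lemma bump_tendsto:
  "(\<lambda>n. bump (real n) a b t) \<longlonglongrightarrow> indicator {a<..<b} t"
proof (cases "t \<in> {a<..<b}")
  case True
  have "filterlim (\<lambda>n. real n * (t - a)) at_top sequentially" "filterlim (\<lambda>n. real n * (b - t)) at_top sequentially"
    using True by (auto intro!: filterlim_tendsto_pos_mult_at_top filterlim_real_sequentially simp: mult.commute[of "real _"])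
  from tendsto_mult[OF this[THEN flat0_tendsto]]
  show ?thesis using True by (simp add: bump_def)
next
  case False then show ?thesis by (simp add: bump_0)
qed

text \<open>\<open>flat 2\<close> is the derivative of \<open>flat 0\<close>. The first bound is used close to the edge of the support,
  the second one far away from it.\<close>

lemma flat2_bounds: "\<bar>flat 2 s\<bar> * (s + 1) \<le> 4" "s > 0 \<Longrightarrow> \<bar>flat 2 s\<bar> * (s + 1) \<le> (s + 1) / s^2"
proof -
  show large: "\<bar>flat 2 s\<bar> * (s + 1) \<le> (s + 1) / s^2" if "s > 0"
    using that by (auto simp: flat_def divide_simps)
  show "\<bar>flat 2 s\<bar> * (s + 1) \<le> 4"
  proof -
    consider "s \<le> 0" | "s > 1" | "0 < s" "s \<le> 1" by linarith
    then show ?thesis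
    proof cases
      case 2
      have "(s + 1) / s^2 \<le> 4"
        using 2 by (simp add: divide_simps power2_eq_square) (smt (verit) mult_le_cancel_left1)
      then show ?thesis using 2 large by linarith
    next
      case 3
      have "1 + 1/s + (1/s)^2/2 \<le> exp (1/s)" using exp_lower_Taylor_quadratic[of "1/s"] 3 by simp
      then have "(1/s)^2 \<le> 2 * exp (1/s)" using 3 by (smt (verit) divide_pos_pos field_sum_of_halves)
      then have "exp (-(1/s)) * (1/s)^2 \<le> exp (-(1/s)) * (2 * exp (1/s))" by (intro mult_left_mono) auto
      also have "\<dots> = 2" by (simp add: exp_minus)
      finally have "flat 2 s \<le> 2" using 3 by (simp add: flat_def power_divide)
      moreover have "0 \<le> flat 2 s" by (simp add: flat_def)
      ultimately show ?thesis using 3 mult_mono[of "flat 2 s" 2 "s+1" 2] by simp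
    qed (simp add: flat_def)
  qed
qed

text \<open>The support keeps the distance \<open>1/n\<close> from both end points of the unit interval, so that products
  with smooth functions are test functions.\<close>

definition cutoff :: "nat \<Rightarrow> real \<Rightarrow> real" where "cutoff n = bump (real n) (1 / real n) (1 - 1 / real n)"
definition dcutoff :: "nat \<Rightarrow> real \<Rightarrow> real" where "dcutoff n = dbump (real n) (1 / real n) (1 - 1 / real n)"

lemma cutoff_alt: "n > 0 \<Longrightarrow> cutoff n t = flat 0 (real n * t - 1) * flat 0 (real n * (1 - t) - 1)"
  by (simp add: cutoff_def bump_def algebra_simps)

lemma dcutoff_alt: "n > 0 \<Longrightarrow> dcutoff n t = real n * flat 2 (real n * t - 1) * flat 0 (real n * (1 - t) - 1)
    - flat 0 (real n * t - 1) * (real n * flat 2 (real n * (1 - t) - 1))"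
  by (simp add: dcutoff_def dbump_def algebra_simps)

lemma cutoff_tendsto:
  assumes "0 < t" "t < 1" shows "(\<lambda>n. cutoff n t) \<longlonglongrightarrow> 1"
proof -
  have "filterlim (\<lambda>n. -1 + s * real n) at_top sequentially" if "s > 0" for s :: real
    by (intro filterlim_tendsto_add_at_top[OF tendsto_const]
        filterlim_tendsto_pos_mult_at_top[OF tendsto_const that] filterlim_real_sequentially)
  from tendsto_mult[OF this[THEN flat0_tendsto] this[THEN flat0_tendsto], of t "1-t"]
  have "(\<lambda>n. flat 0 (real n * t - 1) * flat 0 (real n * (1 - t) - 1)) \<longlonglongrightarrow> 1"
    using assms by (simp add: algebra_simps)
  then show ?thesis
    by (rule Lim_transform_eventually)
       (auto simp: cutoff_alt eventually_sequentially intro!: exI[of _ 1])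
qed

text \<open>The derivative of the cutoff is of order \<open>n\<close>, but it is concentrated at distances of order \<open>1/n\<close>
  from the end points. A factor that vanishes there compensates its growth.\<close>

lemma dcutoff_le:
  assumes "n > 0" "0 < t" "t < 1"
  shows "\<bar>dcutoff n t\<bar> * (t * (1 - t)) \<le>
     \<bar>flat 2 (real n * t - 1)\<bar> * (real n * t) + \<bar>flat 2 (real n * (1-t) - 1)\<bar> * (real n * (1-t))"
proof -
  have "\<bar>dcutoff n t\<bar> \<le> \<bar>real n * flat 2 (real n * t - 1) * flat 0 (real n * (1 - t) - 1)\<bar>
      + \<bar>flat 0 (real n * t - 1) * (real n * flat 2 (real n * (1 - t) - 1))\<bar>"
    using assms by (simp add: dcutoff_alt abs_triangle_ineq4)
  also have "\<dots> \<le> real n * \<bar>flat 2 (real n * t - 1)\<bar> + real n * \<bar>flat 2 (real n * (1 - t) - 1)\<bar>"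
    by (intro add_mono) (auto simp: abs_mult flat0_bounds mult_left_le mult_left_le_one_le)
  finally have "\<bar>dcutoff n t\<bar> * (t * (1-t)) \<le>
      (real n * \<bar>flat 2 (real n * t - 1)\<bar> + real n * \<bar>flat 2 (real n * (1 - t) - 1)\<bar>) * (t * (1-t))"
    using assms by (intro mult_right_mono) auto
  also have "\<dots> = (\<bar>flat 2 (real n * t - 1)\<bar> * (real n * t)) * (1-t)
      + (\<bar>flat 2 (real n * (1 - t) - 1)\<bar> * (real n * (1-t))) * t"
    by (simp add: algebra_simps)
  also have "\<dots> \<le> \<bar>flat 2 (real n * t - 1)\<bar> * (real n * t) + \<bar>flat 2 (real n * (1-t) - 1)\<bar> * (real n * (1-t))"
    using assms by (intro add_mono mult_right_le_one_le) auto
  finally show ?thesis .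
qed

lemma dcutoff_bound:
  assumes "0 < t" "t < 1" shows "\<bar>dcutoff n t\<bar> * (t * (1 - t)) \<le> 8"
proof (cases "n = 0")
  case True then show ?thesis by (simp add: dcutoff_def dbump_def)
next
  case False
  then show ?thesis using dcutoff_le[of n t] assms flat2_bounds(1)[of "real n * t - 1"]
      flat2_bounds(1)[of "real n * (1-t) - 1"] by simp
qed

lemma dcutoff_tendsto:
  assumes "0 < t" "t < 1" shows "(\<lambda>n. dcutoff n t * (t * (1 - t))) \<longlonglongrightarrow> 0"
proof -
  have *: "(\<lambda>n. \<bar>flat 2 (real n * s - 1)\<bar> * (real n * s)) \<longlonglongrightarrow> 0" if "s > 0" for s
  proof -
    have lim: "filterlim (\<lambda>n. -1 + s * real n) at_top sequentially"
      by (intro filterlim_tendsto_add_at_top[OF tendsto_const]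
          filterlim_tendsto_pos_mult_at_top[OF tendsto_const that] filterlim_real_sequentially)
    have "((\<lambda>y::real. (y + 1) / y^2) \<longlongrightarrow> 0) at_top" 
    proof -
      have "((\<lambda>y::real. inverse y + inverse y * inverse y) \<longlongrightarrow> 0 + 0 * 0) at_top"
        by (intro tendsto_intros tendsto_inverse_0_at_top filterlim_ident)
      then have "((\<lambda>y::real. inverse y + inverse y * inverse y) \<longlongrightarrow> 0) at_top" by simp
      then show ?thesis
        by (rule Lim_transform_eventually)
           (auto intro!: eventually_mono[OF eventually_gt_at_top[of 0]] simp: field_simps power2_eq_square)
    qed
    from filterlim_compose[OF this lim]
    have "(\<lambda>n. (-1 + s * real n + 1) / (-1 + s * real n)^2) \<longlonglongrightarrow> 0" .
    moreover have "\<forall>\<^sub>F n in sequentially. norm (\<bar>flat 2 (real n * s - 1)\<bar> * (real n * s))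
         \<le> (-1 + s * real n + 1) / (-1 + s * real n)^2"
    proof -
      have "eventually (\<lambda>n. -1 + s * real n > 0) sequentially" using lim unfolding filterlim_at_top_dense by blast
      then show ?thesis
      proof eventually_elim
        case (elim n)
        then show ?case using flat2_bounds(2)[of "real n * s - 1"] that by (simp add: algebra_simps abs_mult)
      qed
    qed
    ultimately show ?thesis by (rule Lim_null_comparison[rotated])
  qed
  have "(\<lambda>n. \<bar>flat 2 (real n * t - 1)\<bar> * (real n * t) + \<bar>flat 2 (real n * (1-t) - 1)\<bar> * (real n * (1-t))) \<longlonglongrightarrow> 0"
    using tendsto_add[OF *[of t] *[of "1-t"]] assms by simp
  then show ?thesis
  proof (rule Lim_null_comparison[rotated])
    show "\<forall>\<^sub>F n in sequentially. norm (dcutoff n t * (t * (1 - t)))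
       \<le> \<bar>flat 2 (real n * t - 1)\<bar> * (real n * t) + \<bar>flat 2 (real n * (1-t) - 1)\<bar> * (real n * (1-t))"
      using dcutoff_le[OF _ assms] assms
      by (auto simp: eventually_sequentially abs_mult intro!: exI[of _ 1])
  qed
qed

section \<open>Square integrable functions on the unit square\<close>

abbreviation LO :: "(real^2) measure" where "LO \<equiv> lebesgue_on Omega"

lemma Omega_box: "Omega = box 0 1"
  by (auto simp: Omega_def mem_box_cart forall_2)

lemma Omega_sets [measurable, simp]: "Omega \<in> sets lebesgue"
  by (simp add: Omega_box)

lemma Omega_subset_cbox: "Omega \<subseteq> cbox 0 1"
  by (simp add: Omega_box box_subset_cbox)

lemma measure_Omega: "measure lebesgue Omega = 1"
  by (simp add: Omega_box content_cbox_cart[of 0 1] measure_lborel_box_eq[where 'a="real^2"])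
     (simp add: Basis_vec_def axis_eq_axis inner_axis' cart_eq_inner_axis[symmetric] prod.neutral)

lemma space_LO [simp]: "space LO = Omega"
  by simp

interpretation LO: finite_measure LO
  by (rule finite_measureI) (simp add: emeasure_restrict_space Omega_box emeasure_lborel_box_eq)

lemma measure_LO [simp]: "measure LO Omega = 1"
  by (simp add: measure_restrict_space measure_Omega)

lemma LINT_const [simp]: "(LINT x|LO. (c::real)) = c"
  by (simp add: measure_LO)

lemma LO_measurable_continuous:
  fixes f :: "real^2 \<Rightarrow> 'b::euclidean_space"
  shows "continuous_on UNIV f \<Longrightarrow> f \<in> borel_measurable LO"
  by (rule measurable_restrict_space1) (simp add: borel_measurable_continuous_onI measurable_completion)

lemma AE_LO_I: "(\<And>x. x \<in> Omega \<Longrightarrow> P x) \<Longrightarrow> AE x in LO. P x"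
  by (rule AE_I2) simp

lemma bounded_integrable_LO:
  fixes f :: "real^2 \<Rightarrow> real"
  assumes "f \<in> borel_measurable LO" "\<And>x. x \<in> Omega \<Longrightarrow> \<bar>f x\<bar> \<le> B"
  shows "integrable LO f"
  by (rule LO.integrable_const_bound[where B=B]) (use assms in \<open>auto intro: AE_LO_I\<close>)

lemma continuous_bounded_Omega:
  fixes f :: "real^2 \<Rightarrow> real"
  assumes "continuous_on UNIV f" obtains B where "B > 0" "\<And>x. x \<in> cbox 0 1 \<Longrightarrow> \<bar>f x\<bar> \<le> B"
proof -
  have "compact (f ` cbox 0 1)"
    by (rule compact_continuous_image) (use assms continuous_on_subset in blast, simp)
  then have "bounded (f ` cbox 0 1)" by (rule compact_imp_bounded)
  then obtain B where "B > 0" "\<forall>y \<in> f ` cbox 0 1. norm y \<le> B" using bounded_pos by blast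
  then show ?thesis using that by auto
qed

lemma L2_iff: "(f :: real^2 \<Rightarrow> real) \<in> L2 \<longleftrightarrow> f \<in> borel_measurable LO \<and> integrable LO (\<lambda>x. (f x)\<^sup>2)"
  by (simp add: L2_def)

lemma L2_measurable: "f \<in> L2 \<Longrightarrow> f \<in> borel_measurable LO"
  by (simp add: L2_def)

lemma L2_square_integrable: "(f :: real^2 \<Rightarrow> real) \<in> L2 \<Longrightarrow> integrable LO (\<lambda>x. (f x)\<^sup>2)"
  by (simp add: L2_def)

lemma L2_mult_integrable:
  fixes f g :: "real^2 \<Rightarrow> real"
  assumes "f \<in> L2" "g \<in> L2" shows "integrable LO (\<lambda>x. f x * g x)"
proof (rule Bochner_Integration.integrable_bound)
  show "integrable LO (\<lambda>x. (f x)\<^sup>2 + (g x)\<^sup>2)"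
    using assms by (intro Bochner_Integration.integrable_add) (auto simp: L2_iff)
  show "(\<lambda>x. f x * g x) \<in> borel_measurable LO" using assms by (auto simp: L2_iff)
  have "\<bar>a * b\<bar> \<le> a\<^sup>2 + b\<^sup>2" for a b :: real
    proof -
    have "2 * (\<bar>a\<bar> * \<bar>b\<bar>) \<le> a\<^sup>2 + b\<^sup>2" using sum_squares_bound[of "\<bar>a\<bar>" "\<bar>b\<bar>"] by simp
    moreover have "0 \<le> \<bar>a\<bar> * \<bar>b\<bar>" by simp
    ultimately show ?thesis unfolding abs_mult by linarith
  qed
  then show "AE x in LO. norm (f x * g x) \<le> norm ((f x)\<^sup>2 + (g x)\<^sup>2)"
    by (auto intro!: AE_I2 simp del: abs_mult)
qed

lemma L2_bounded:
  fixes f :: "real^2 \<Rightarrow> real"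
  assumes "f \<in> borel_measurable LO" "\<And>x. x \<in> Omega \<Longrightarrow> \<bar>f x\<bar> \<le> B"
  shows "f \<in> L2"
proof -
  have "integrable LO (\<lambda>x. (f x)\<^sup>2)"
  proof (rule bounded_integrable_LO[where B="B\<^sup>2"])
    show "\<bar>(f x)\<^sup>2\<bar> \<le> B\<^sup>2" if "x \<in> Omega" for x
      using assms(2)[OF that] by (metis abs_ge_zero power2_abs power_mono abs_power2)
  qed (use assms in auto)
  then show ?thesis using assms by (simp add: L2_iff)
qed

lemma L2_continuous: "continuous_on UNIV (f :: real^2 \<Rightarrow> real) \<Longrightarrow> f \<in> L2"
  by (metis L2_bounded LO_measurable_continuous Omega_subset_cbox continuous_bounded_Omega subsetD)

lemma L2_smooth: "smooth f \<Longrightarrow> f \<in> L2"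
  by (rule L2_continuous) (rule smooth_continuous)

lemma L2_const: "(\<lambda>_. c::real) \<in> L2"
  by (rule L2_continuous) simp

lemma L2_bounded_mult:
  fixes f b :: "real^2 \<Rightarrow> real"
  assumes "b \<in> borel_measurable LO" "\<And>x. x \<in> Omega \<Longrightarrow> \<bar>b x\<bar> \<le> B" "f \<in> L2"
  shows "(\<lambda>x. b x * f x) \<in> L2"
proof -
  have "integrable LO (\<lambda>x. B\<^sup>2 * (f x)\<^sup>2)" using assms by (simp add: L2_iff)
  then have "integrable LO (\<lambda>x. (b x * f x)\<^sup>2)"
  proof (rule Bochner_Integration.integrable_bound)
    have "(b x * f x)\<^sup>2 \<le> B\<^sup>2 * (f x)\<^sup>2" if "x \<in> Omega" for x
      unfolding power_mult_distrib using assms(2)[OF that]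
      by (intro mult_right_mono) (auto intro: power2_le_iff_abs_le[THEN iffD2])
    then show "AE x in LO. norm ((b x * f x)\<^sup>2) \<le> norm (B\<^sup>2 * (f x)\<^sup>2)"
      by (intro AE_LO_I) simp
  qed (use assms in \<open>auto simp: L2_iff\<close>)
  then show ?thesis using assms by (auto simp: L2_iff)
qed

lemma L2_cmult: "(f :: real^2 \<Rightarrow> real) \<in> L2 \<Longrightarrow> (\<lambda>x. c * f x) \<in> L2"
  by (auto simp: L2_iff power_mult_distrib)

lemma L2_add:
  fixes f g :: "real^2 \<Rightarrow> real"
  assumes "f \<in> L2" "g \<in> L2" shows "(\<lambda>x. f x + g x) \<in> L2"
proof -
  have "integrable LO (\<lambda>x. (f x)\<^sup>2 + (g x)\<^sup>2 + 2 * (f x * g x))"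
    using assms L2_mult_integrable[OF assms]
    by (intro Bochner_Integration.integrable_add integrable_mult_right) (auto simp: L2_iff)
  then have "integrable LO (\<lambda>x. (f x + g x)\<^sup>2)" by (simp add: power2_sum algebra_simps)
  then show ?thesis using assms unfolding L2_iff by (auto intro: borel_measurable_add)
qed

lemma L2_uminus: "(f :: real^2 \<Rightarrow> real) \<in> L2 \<Longrightarrow> (\<lambda>x. - f x) \<in> L2"
  using L2_cmult[of f "-1"] by simp

lemma L2_diff: "(f :: real^2 \<Rightarrow> real) \<in> L2 \<Longrightarrow> g \<in> L2 \<Longrightarrow> (\<lambda>x. f x - g x) \<in> L2"
  using L2_add[of f "\<lambda>x. - g x"] L2_uminus[of g] by simp

lemma L2_sum:
  fixes f :: "_ \<Rightarrow> real^2 \<Rightarrow> real"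
  shows "(\<And>i. i \<in> A \<Longrightarrow> f i \<in> L2) \<Longrightarrow> (\<lambda>x. \<Sum>i\<in>A. f i x) \<in> L2"
  by (induction A rule: infinite_finite_induct) (auto intro: L2_const L2_add)

lemma L2_integrable: "(f :: real^2 \<Rightarrow> real) \<in> L2 \<Longrightarrow> integrable LO f"
  using L2_mult_integrable[OF _ L2_const[of 1]] by simp

lemmas L2_intros = L2_const L2_add L2_diff L2_uminus L2_cmult L2_sum L2_mult_integrable L2_integrable L2_smooth

lemma L2_norm_real: "L2_norm (f :: real^2 \<Rightarrow> real) = sqrt (LINT x|LO. (f x)\<^sup>2)"
  by (simp add: L2_norm_def)

lemma L2_norm_sq: "(L2_norm (f :: real^2 \<Rightarrow> real))\<^sup>2 = (LINT x|LO. (f x)\<^sup>2)"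
  by (simp add: L2_norm_real)

lemma L2_norm_nonneg [simp]: "0 \<le> L2_norm f"
  by (simp add: L2_norm_def)

lemma L2_norm_cong_AE:
  assumes "AE x in LO. f x = g x" "f \<in> borel_measurable LO" "g \<in> borel_measurable LO"
  shows "L2_norm f = L2_norm g"
  unfolding L2_norm_def by (rule arg_cong[of _ _ sqrt], rule integral_cong_AE) (use assms in auto)

lemma nonneg_quadratic_discriminant:
  fixes A B C :: real
  assumes "\<And>t. 0 \<le> A - 2 * t * B + t\<^sup>2 * C" "C \<ge> 0"
  shows "B\<^sup>2 \<le> A * C"
proof (cases "C = 0")
  case True
  have "B = 0"
  proof (rule ccontr)
    assume "B \<noteq> 0"
    then show False using assms(1)[of "(A + 1) / (2 * B)"] True by simp
  qed
  then show ?thesis using True by simp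
next
  case False
  have "0 \<le> A - 2 * (B/C) * B + (B/C)\<^sup>2 * C" by (rule assms)
  also have "\<dots> = A - B\<^sup>2 / C" using False by (simp add: field_simps power2_eq_square)
  finally show ?thesis using assms(2) False by (simp add: field_simps)
qed

lemma L2_Cauchy_Schwarz:
  fixes f g :: "real^2 \<Rightarrow> real"
  assumes "f \<in> L2" "g \<in> L2"
  shows "\<bar>LINT x|LO. f x * g x\<bar> \<le> L2_norm f * L2_norm g"
proof -
  have "0 \<le> (LINT x|LO. (f x)\<^sup>2) - 2 * t * (LINT x|LO. f x * g x) + t\<^sup>2 * (LINT x|LO. (g x)\<^sup>2)" for t
  proof -
    have "0 \<le> (LINT x|LO. (f x - t * g x)\<^sup>2)" by simp
    also have "(\<lambda>x. (f x - t * g x)\<^sup>2) = (\<lambda>x. (f x)\<^sup>2 - 2 * t * (f x * g x) + t\<^sup>2 * (g x)\<^sup>2)"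
      by (auto simp: power2_diff algebra_simps power_mult_distrib)
    also have "(LINT x|LO. (f x)\<^sup>2 - 2 * t * (f x * g x) + t\<^sup>2 * (g x)\<^sup>2) =
       (LINT x|LO. (f x)\<^sup>2) - 2 * t * (LINT x|LO. f x * g x) + t\<^sup>2 * (LINT x|LO. (g x)\<^sup>2)"
      using L2_mult_integrable[OF assms] L2_square_integrable assms by simp
    finally show ?thesis .
  qed
  then have "(LINT x|LO. f x * g x)\<^sup>2 \<le> (LINT x|LO. (f x)\<^sup>2) * (LINT x|LO. (g x)\<^sup>2)"
    by (rule nonneg_quadratic_discriminant) simp
  then have "(LINT x|LO. f x * g x)\<^sup>2 \<le> (L2_norm f * L2_norm g)\<^sup>2"
    by (simp add: power_mult_distrib L2_norm_sq)
  then show ?thesis by (rule abs_le_square_iff[THEN iffD2, THEN order_trans]) simp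
qed

lemma L2_norm_one: "L2_norm (\<lambda>_. 1::real) = 1"
  by (simp add: L2_norm_real)

lemma L2_abs: "(f::real^2 \<Rightarrow> real) \<in> L2 \<Longrightarrow> (\<lambda>x. \<bar>f x\<bar>) \<in> L2"
  by (auto simp: L2_iff)

lemma L2_norm_abs: "L2_norm (\<lambda>x. \<bar>f x\<bar>) = L2_norm (f::real^2 \<Rightarrow> real)"
  by (simp add: L2_norm_real)

lemma L1_le_L2: "(f::real^2 \<Rightarrow> real) \<in> L2 \<Longrightarrow> (LINT x|LO. \<bar>f x\<bar>) \<le> L2_norm f"
  using L2_Cauchy_Schwarz[OF L2_abs L2_const[of 1], of f] by (simp add: L2_norm_abs L2_norm_one)

lemma L2_norm_cmult: "L2_norm (\<lambda>x. c * f x) = \<bar>c\<bar> * L2_norm (f::real^2 \<Rightarrow> real)"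
  by (simp add: L2_norm_real power_mult_distrib real_sqrt_mult)

lemma L2_norm_minus_commute: "L2_norm (\<lambda>x. f x - g x) = L2_norm (\<lambda>x. g x - f x :: real)"
  by (simp add: L2_norm_real power2_commute)

lemma L2_norm_triangle:
  fixes f g :: "real^2 \<Rightarrow> real"
  assumes "f \<in> L2" "g \<in> L2"
  shows "L2_norm (\<lambda>x. f x + g x) \<le> L2_norm f + L2_norm g"
proof (rule power2_le_imp_le)
  have "(L2_norm (\<lambda>x. f x + g x))\<^sup>2 = (LINT x|LO. (f x)\<^sup>2 + (g x)\<^sup>2 + 2 * (f x * g x))"
    unfolding L2_norm_sq by (simp add: power2_sum algebra_simps)
  also have "\<dots> = (L2_norm f)\<^sup>2 + (L2_norm g)\<^sup>2 + 2 * (LINT x|LO. f x * g x)"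
    using assms L2_mult_integrable[OF assms] L2_square_integrable by (simp add: L2_norm_sq)
  also have "\<dots> \<le> (L2_norm f)\<^sup>2 + (L2_norm g)\<^sup>2 + 2 * (L2_norm f * L2_norm g)"
    using L2_Cauchy_Schwarz[OF assms] by simp
  finally show "(L2_norm (\<lambda>x. f x + g x))\<^sup>2 \<le> (L2_norm f + L2_norm g)\<^sup>2"
    by (simp add: power2_sum algebra_simps)
qed simp

subsection \<open>Convergence and completeness\<close>

definition L2_lim :: "(nat \<Rightarrow> real^2 \<Rightarrow> real) \<Rightarrow> (real^2 \<Rightarrow> real) \<Rightarrow> bool" where
  "L2_lim f g \<longleftrightarrow> (\<forall>n. f n \<in> L2) \<and> g \<in> L2 \<and> (\<lambda>n. L2_norm (\<lambda>x. f n x - g x)) \<longlonglongrightarrow> 0"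

lemma L2_lim_ip:
  assumes "L2_lim f g" "h \<in> L2"
  shows "(\<lambda>n. LINT x|LO. f n x * h x) \<longlonglongrightarrow> (LINT x|LO. g x * h x)"
proof -
  have "(\<lambda>n. L2_norm (\<lambda>x. f n x - g x) * L2_norm h) \<longlonglongrightarrow> 0"
    using assms(1) tendsto_mult_left_zero unfolding L2_lim_def by blast
  then have "(\<lambda>n. (LINT x|LO. f n x * h x) - (LINT x|LO. g x * h x)) \<longlonglongrightarrow> 0"
  proof (rule Lim_null_comparison[rotated], intro always_eventually allI)
    fix n
    have "(LINT x|LO. f n x * h x) - (LINT x|LO. g x * h x) = (LINT x|LO. (f n x - g x) * h x)"
      using assms by (simp add: L2_lim_def left_diff_distrib L2_mult_integrable)
    then show "norm ((LINT x|LO. f n x * h x) - (LINT x|LO. g x * h x)) \<le> L2_norm (\<lambda>x. f n x - g x) * L2_norm h"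
      using L2_Cauchy_Schwarz[OF L2_diff assms(2), of "f n" g] assms(1) by (simp add: L2_lim_def)
  qed
  then show ?thesis by (simp add: LIM_zero_iff)
qed

lemma L2_lim_add:
  assumes "L2_lim f g" "L2_lim f' g'"
  shows "L2_lim (\<lambda>n x. f n x + f' n x) (\<lambda>x. g x + g' x)"
proof -
  have "(\<lambda>n. L2_norm (\<lambda>x. f n x - g x) + L2_norm (\<lambda>x. f' n x - g' x)) \<longlonglongrightarrow> 0"
    using assms tendsto_add_zero unfolding L2_lim_def by blast
  then have "(\<lambda>n. L2_norm (\<lambda>x. f n x + f' n x - (g x + g' x))) \<longlonglongrightarrow> 0"
  proof (rule Lim_null_comparison[rotated], intro always_eventually allI)
    fix n
    show "norm (L2_norm (\<lambda>x. f n x + f' n x - (g x + g' x))) \<le> L2_norm (\<lambda>x. f n x - g x) + L2_norm (\<lambda>x. f' n x - g' x)"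
      using L2_norm_triangle[of "\<lambda>x. f n x - g x" "\<lambda>x. f' n x - g' x"] assms
      by (simp add: L2_lim_def L2_diff algebra_simps)
  qed
  then show ?thesis using assms by (simp add: L2_lim_def L2_add)
qed

lemma L2_lim_bounded_mult:
  assumes "L2_lim f g" "b \<in> borel_measurable LO" "\<And>x. x \<in> Omega \<Longrightarrow> \<bar>b x\<bar> \<le> B"
  shows "L2_lim (\<lambda>n x. b x * f n x) (\<lambda>x. b x * g x)"
proof -
  have "(\<lambda>n. \<bar>B\<bar> * L2_norm (\<lambda>x. f n x - g x)) \<longlonglongrightarrow> 0"
    using assms tendsto_mult_right_zero unfolding L2_lim_def by blast
  then have "(\<lambda>n. L2_norm (\<lambda>x. b x * f n x - b x * g x)) \<longlonglongrightarrow> 0"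
  proof (rule Lim_null_comparison[rotated], intro always_eventually allI)
    fix n
    have fg: "(\<lambda>x. f n x - g x) \<in> L2" using assms(1) by (simp add: L2_lim_def L2_diff)
    have "(LINT x|LO. (b x * (f n x - g x))\<^sup>2) \<le> (LINT x|LO. (B * (f n x - g x))\<^sup>2)"
    proof (rule integral_mono_AE)
      show "integrable LO (\<lambda>x. (b x * (f n x - g x))\<^sup>2)"
        by (rule L2_square_integrable) (rule L2_bounded_mult[OF assms(2,3) fg])
      show "integrable LO (\<lambda>x. (B * (f n x - g x))\<^sup>2)"
        by (rule L2_square_integrable) (rule L2_cmult[OF fg])
      show "AE x in LO. (b x * (f n x - g x))\<^sup>2 \<le> (B * (f n x - g x))\<^sup>2"
        using order_trans[OF assms(3) abs_ge_self[of B]]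
        by (intro AE_LO_I) (simp add: power_mult_distrib mult_right_mono abs_le_square_iff)
    qed
    then have "L2_norm (\<lambda>x. b x * (f n x - g x)) \<le> L2_norm (\<lambda>x. B * (f n x - g x))"
      by (simp add: L2_norm_real)
    then show "norm (L2_norm (\<lambda>x. b x * f n x - b x * g x)) \<le> \<bar>B\<bar> * L2_norm (\<lambda>x. f n x - g x)"
      unfolding L2_norm_cmult by (simp add: right_diff_distrib)
  qed
  then show ?thesis using assms L2_bounded_mult[OF assms(2,3)] by (simp add: L2_lim_def)
qed

lemma L2_lim_cmult: "L2_lim f g \<Longrightarrow> L2_lim (\<lambda>n x. c * f n x) (\<lambda>x. c * g x)"
  by (rule L2_lim_bounded_mult[where b = "\<lambda>_. c" and B = "\<bar>c\<bar>"]) auto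

lemma L2_lim_diff: "L2_lim f g \<Longrightarrow> L2_lim f' g' \<Longrightarrow> L2_lim (\<lambda>n x. f n x - f' n x) (\<lambda>x. g x - g' x)"
  using L2_lim_add[of f g "\<lambda>n x. (-1) * f' n x" "\<lambda>x. (-1) * g' x"] L2_lim_cmult[of f' g' "-1"] by simp

lemma L2_lim_const: "g \<in> L2 \<Longrightarrow> L2_lim (\<lambda>n. g) g"
  by (simp add: L2_lim_def L2_norm_real)

lemma L2_lim_norm:
  assumes "L2_lim f g" shows "(\<lambda>n. L2_norm (f n)) \<longlonglongrightarrow> L2_norm g"
proof -
  have *: "\<bar>L2_norm (f n) - L2_norm g\<bar> \<le> L2_norm (\<lambda>x. f n x - g x)" for n
  proof -
    have m: "f n \<in> L2" "g \<in> L2" "(\<lambda>x. f n x - g x) \<in> L2" "(\<lambda>x. g x - f n x) \<in> L2"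
      using assms by (auto simp: L2_lim_def L2_diff)
    show ?thesis using L2_norm_triangle[OF m(3,2)] L2_norm_triangle[OF m(4,1)]
        L2_norm_minus_commute[of g "f n"] by simp
  qed
  have "(\<lambda>n. L2_norm (f n) - L2_norm g) \<longlonglongrightarrow> 0"
    by (rule Lim_null_comparison[where g = "\<lambda>n. L2_norm (\<lambda>x. f n x - g x)"])
       (use * assms in \<open>auto simp: L2_lim_def\<close>)
  then show ?thesis by (simp add: LIM_zero_iff)
qed

lemma L2_lim_sq: "L2_lim f g \<Longrightarrow> (\<lambda>n. LINT x|LO. (f n x)\<^sup>2) \<longlonglongrightarrow> (LINT x|LO. (g x)\<^sup>2)"
  using tendsto_power[OF L2_lim_norm, of f g 2] by (simp add: L2_norm_sq)

text \<open>Polarisation reduces products to squares, for which the convergence of norms is known.\<close>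

lemma L2_lim_ip2:
  assumes "L2_lim f g" "L2_lim f' g'"
  shows "(\<lambda>n. LINT x|LO. f n x * f' n x) \<longlonglongrightarrow> (LINT x|LO. g x * g' x)"
proof -
  have pol: "(LINT x|LO. p x * q x) = 1/4 * ((LINT x|LO. (p x + q x)\<^sup>2) - (LINT x|LO. (p x - q x)\<^sup>2))"
    if "p \<in> L2" "q \<in> L2" for p q :: "real^2 \<Rightarrow> real"
  proof -
    have "(LINT x|LO. (p x + q x)\<^sup>2) - (LINT x|LO. (p x - q x)\<^sup>2) = (LINT x|LO. (p x + q x)\<^sup>2 - (p x - q x)\<^sup>2)"
      using that by (simp add: L2_square_integrable L2_add L2_diff)
    also have "\<dots> = (LINT x|LO. 4 * (p x * q x))"
      by (rule Bochner_Integration.integral_cong) (auto simp: power2_eq_square algebra_simps)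
    finally show ?thesis by simp
  qed
  have "(\<lambda>n. 1/4 * ((LINT x|LO. (f n x + f' n x)\<^sup>2) - (LINT x|LO. (f n x - f' n x)\<^sup>2)))
     \<longlonglongrightarrow> 1/4 * ((LINT x|LO. (g x + g' x)\<^sup>2) - (LINT x|LO. (g x - g' x)\<^sup>2))"
    by (intro tendsto_intros L2_lim_sq L2_lim_add L2_lim_diff assms)
  then show ?thesis using assms by (simp add: pol L2_lim_def)
qed

text \<open>Riesz--Fischer: along a subsequence with geometrically decaying increments the functions converge
  almost everywhere, because the increments are summable in \<open>L\<^sup>1\<close>. Fatou's lemma then turns the Cauchy
  estimate into an estimate of the distance to the pointwise limit.\<close>

lemma L2_complete:
  fixes f :: "nat \<Rightarrow> real^2 \<Rightarrow> real"
  assumes L2: "\<And>n. f n \<in> L2"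
    and Cauchy: "\<And>e. e > 0 \<Longrightarrow> \<exists>N. \<forall>m\<ge>N. \<forall>n\<ge>N. L2_norm (\<lambda>x. f m x - f n x) < e"
  obtains g where "L2_lim f g"
proof -
  have [measurable]: "f n \<in> borel_measurable LO" for n using L2 by (simp add: L2_iff)
  have "\<forall>k. \<exists>N. \<forall>m\<ge>N. \<forall>n\<ge>N. L2_norm (\<lambda>x. f m x - f n x) < (1/2)^k" using Cauchy by simp
  then obtain N where N: "\<And>k m n. m \<ge> N k \<Longrightarrow> n \<ge> N k \<Longrightarrow> L2_norm (\<lambda>x. f m x - f n x) < (1/2)^k"
    by metis
  (* An increasing sequence of indices that dominates N. *)
  define r where "r k = k + (\<Sum>i\<le>k. N i)" for k
  have rN: "r k \<ge> N k" for k
    unfolding r_def using member_le_sum[of k "{..k}" N] by simp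
  have r_Suc: "r k \<le> r (Suc k)" for k unfolding r_def by simp
  define d where "d k x = f (r (Suc k)) x - f (r k) x" for k x
  have dL2: "d k \<in> L2" for k unfolding d_def by (intro L2_intros L2)
  have [measurable]: "d k \<in> borel_measurable LO" for k using dL2 by (simp add: L2_iff)
  have d_int: "(LINT x|LO. \<bar>d k x\<bar>) \<le> (1/2)^k" for k
    using L1_le_L2[OF dL2[of k]] N[of k "r (Suc k)" "r k"] rN[of k] r_Suc[of k]
    unfolding d_def by simp
  have "(\<integral>\<^sup>+ x. (\<Sum>k. ennreal \<bar>d k x\<bar>) \<partial>LO) = (\<Sum>k. \<integral>\<^sup>+ x. ennreal \<bar>d k x\<bar> \<partial>LO)"
    by (rule nn_integral_suminf) measurable
  also have "\<dots> = (\<Sum>k. ennreal (LINT x|LO. \<bar>d k x\<bar>))"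
    using dL2 by (intro suminf_cong nn_integral_eq_integral) (auto intro: L2_integrable L2_abs)
  also have "\<dots> \<le> (\<Sum>k. ennreal ((1/2)^k))"
    by (intro suminf_le ennreal_leI d_int) auto
  also have "\<dots> = ennreal (\<Sum>k. (1/2)^k)"
    by (rule suminf_ennreal2) (auto intro: summable_geometric)
  also have "\<dots> < \<infinity>" by simp
  finally have "AE x in LO. (\<Sum>k. ennreal \<bar>d k x\<bar>) \<noteq> \<infinity>"
    by (intro nn_integral_PInf_AE) auto
  then have conv: "AE x in LO. convergent (\<lambda>k. f (r k) x)"
  proof eventually_elim
    case (elim x)
    then have "summable (\<lambda>k. \<bar>d k x\<bar>)" by (intro summable_suminf_not_top) (auto simp: top_ennreal.rep_eq)
    then have "summable (\<lambda>k. d k x)" by (rule summable_rabs_cancel)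
    then have "convergent (\<lambda>n. \<Sum>k<n. d k x)" by (simp add: summable_iff_convergent)
    moreover have "(\<Sum>k<n. d k x) = f (r n) x - f (r 0) x" for n
      unfolding d_def by (rule sum_lessThan_telescope)
    ultimately have "convergent (\<lambda>n. f (r n) x - f (r 0) x)" by simp
    from convergent_add[OF this convergent_const[of "f (r 0) x"]] show ?case by simp
  qed
  define g where "g x = lim (\<lambda>k. f (r k) x)" for x
  have [measurable]: "g \<in> borel_measurable LO" unfolding g_def by measurable
  have lim: "AE x in LO. (\<lambda>k. f (r k) x) \<longlonglongrightarrow> g x"
    using conv by eventually_elim (simp add: g_def convergent_LIMSEQ_iff)
  have est: "(\<integral>\<^sup>+ x. ennreal ((f n x - g x)\<^sup>2) \<partial>LO) \<le> ennreal (((1/2)^k)\<^sup>2)" if "n \<ge> N k" for n k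
  proof -
    have "(\<integral>\<^sup>+ x. ennreal ((f n x - g x)\<^sup>2) \<partial>LO) = (\<integral>\<^sup>+ x. liminf (\<lambda>j. ennreal ((f n x - f (r j) x)\<^sup>2)) \<partial>LO)"
    proof (rule nn_integral_cong_AE)
      show "AE x in LO. ennreal ((f n x - g x)\<^sup>2) = liminf (\<lambda>j. ennreal ((f n x - f (r j) x)\<^sup>2))"
        using lim
      proof eventually_elim
        case (elim x)
        have "(\<lambda>j. ennreal ((f n x - f (r j) x)\<^sup>2)) \<longlonglongrightarrow> ennreal ((f n x - g x)\<^sup>2)"
          by (intro tendsto_ennrealI tendsto_intros elim)
        then show ?case by (rule lim_imp_Liminf[symmetric, rotated]) simp
      qed
    qed
    also have "\<dots> \<le> liminf (\<lambda>j. \<integral>\<^sup>+ x. ennreal ((f n x - f (r j) x)\<^sup>2) \<partial>LO)"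
      by (rule nn_integral_liminf) measurable
    also have "\<dots> \<le> ennreal (((1/2)^k)\<^sup>2)"
    proof (rule order_trans[OF Liminf_le_Limsup Limsup_bounded], simp, rule eventually_sequentiallyI[of k])
      fix j assume "j \<ge> k"
      then have "r j \<ge> r k" using lift_Suc_mono_le[of r, OF r_Suc] by blast
      then have "r j \<ge> N k" using rN[of k] by simp
      have "(\<integral>\<^sup>+ x. ennreal ((f n x - f (r j) x)\<^sup>2) \<partial>LO) = ennreal (LINT x|LO. (f n x - f (r j) x)\<^sup>2)"
        by (rule nn_integral_eq_integral) (auto intro!: L2_square_integrable L2_diff L2)
      also have "\<dots> = ennreal ((L2_norm (\<lambda>x. f n x - f (r j) x))\<^sup>2)" by (simp add: L2_norm_sq)
      also have "\<dots> \<le> ennreal (((1/2)^k)\<^sup>2)"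
        using N[OF that \<open>r j \<ge> N k\<close>] by (intro ennreal_leI power_mono) auto
      finally show "(\<integral>\<^sup>+ x. ennreal ((f n x - f (r j) x)\<^sup>2) \<partial>LO) \<le> ennreal (((1/2)^k)\<^sup>2)" .
    qed
    finally show ?thesis .
  qed
  have diffL2: "(\<lambda>x. f n x - g x) \<in> L2" if "n \<ge> N 0" for n
  proof -
    have "integrable LO (\<lambda>x. (f n x - g x)\<^sup>2)"
      by (rule integrableI_bounded) (use est[OF that] in \<open>auto simp: less_top[symmetric] top_unique\<close>)
    then show ?thesis by (simp add: L2_iff)
  qed
  have gL2: "g \<in> L2" using L2_diff[OF L2[of "N 0"] diffL2[of "N 0"]] by simp
  have "(\<lambda>n. L2_norm (\<lambda>x. f n x - g x)) \<longlonglongrightarrow> 0"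
  proof (rule LIMSEQ_I)
    fix e :: real assume "e > 0"
    then obtain k where k: "(1/2)^k < e" using real_arch_pow_inv[of e "1/2"] by auto
    have "norm (L2_norm (\<lambda>x. f n x - g x) - 0) < e" if "n \<ge> N k" for n
    proof -
      have "ennreal (LINT x|LO. (f n x - g x)\<^sup>2) = (\<integral>\<^sup>+ x. ennreal ((f n x - g x)\<^sup>2) \<partial>LO)"
        by (rule nn_integral_eq_integral[symmetric]) (auto intro!: L2_square_integrable L2_diff L2 gL2)
      with est[OF that] have "(LINT x|LO. (f n x - g x)\<^sup>2) \<le> ((1/2)^k)\<^sup>2"
        by (metis ennreal_le_iff zero_le_power2)
      then have "L2_norm (\<lambda>x. f n x - g x) \<le> (1/2)^k"
        by (simp add: L2_norm_real real_le_lsqrt)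
      with k show ?thesis by simp
    qed
    then show "\<exists>no. \<forall>n\<ge>no. norm (L2_norm (\<lambda>x. f n x - g x) - 0) < e" by blast
  qed
  then have "L2_lim f g" using L2 gL2 by (simp add: L2_lim_def)
  then show ?thesis by (rule that)
qed

section \<open>Integration on the square in coordinates\<close>

abbreviation pt :: "real \<Rightarrow> real \<Rightarrow> real^2" where "pt s t \<equiv> vector [s, t]"

lemma pt_eq: "pt s t = s *\<^sub>R axis 1 1 + t *\<^sub>R axis 2 1"
  by (simp add: vec_eq_iff forall_2 axis_def)

lemma continuous_pt: "continuous_on S f \<Longrightarrow> continuous_on S g \<Longrightarrow> continuous_on S (\<lambda>x. pt (f x) (g x))"
  unfolding pt_eq by (intro continuous_intros)

lemma continuous_on_slice:
  fixes p :: "real^2 \<Rightarrow> real"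
  assumes "continuous_on UNIV p" "continuous_on S f" "continuous_on S g"
  shows "continuous_on S (\<lambda>x. p (pt (f x) (g x)))"
  by (rule continuous_on_compose2[OF assms(1) continuous_pt]) (use assms in auto)

lemma Basis_real2: "(Basis :: (real^2) set) = {axis 1 1, axis 2 1}"
  by (auto simp: Basis_vec_def) (metis exhaust_2)

text \<open>This identification gives access to the theory of iterated integrals on the product of two
  lines.\<close>

lemma lborel_pt: "(lborel :: (real^2) measure) = distr lborel borel (\<lambda>(s, t). pt s t)"
proof (rule lborel_eqI)
  have meas: "(\<lambda>(s, t). pt s t) \<in> borel_measurable (lborel :: (real \<times> real) measure)"
    unfolding measurable_lborel2
    by (rule borel_measurable_continuous_onI) (auto simp: case_prod_beta intro!: continuous_pt continuous_intros)
  fix l u :: "real^2" assume le: "\<And>b. b \<in> Basis \<Longrightarrow> l \<bullet> b \<le> u \<bullet> b"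
  have le': "l$i \<le> u$i" for i using le[of "axis i 1"] by (auto simp: Basis_vec_def inner_axis)
  have "emeasure (distr lborel borel (\<lambda>(s, t). pt s t)) (box l u) =
        emeasure lborel ((\<lambda>(s, t). pt s t) -` box l u)"
    by (subst emeasure_distr[OF meas]) auto
  also have "(\<lambda>(s, t). pt s t) -` box l u = box (l$1, l$2) (u$1, u$2)"
    by (auto simp: mem_box_cart forall_2 mem_box Basis_prod_def)
  also have "emeasure lborel (box (l$1, l$2) (u$1, u$2)) = ennreal ((u$1 - l$1) * (u$2 - l$2))"
    using le' by (subst emeasure_lborel_box) (auto simp: Basis_prod_def prod.union_disjoint)
  also have "(u$1 - l$1) * (u$2 - l$2) = (\<Prod>b\<in>Basis. (u - l) \<bullet> b)"
    by (simp add: Basis_real2 axis_eq_axis inner_axis)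
  finally show "emeasure (distr lborel borel (\<lambda>(s, t). pt s t)) (box l u) = ennreal (\<Prod>b\<in>Basis. (u - l) \<bullet> b)" .
qed simp

lemma LINT_Omega_iterated:
  fixes p :: "real^2 \<Rightarrow> real"
  assumes p: "continuous_on UNIV p"
  shows "(LINT x|LO. p x) = integral {0..1} (\<lambda>s. integral {0..1} (\<lambda>t. p (pt s t)))"
proof -
  have [measurable]: "p \<in> borel_measurable borel" using p by (rule borel_measurable_continuous_onI)
  have [measurable]: "Omega \<in> sets borel" by (simp add: Omega_box)
  have meas: "(\<lambda>(s, t). pt s t) \<in> borel_measurable (lborel :: (real \<times> real) measure)"
    unfolding measurable_lborel2
    by (rule borel_measurable_continuous_onI) (auto simp: case_prod_beta intro!: continuous_pt continuous_intros)
  have cont: "continuous_on S (\<lambda>(s, t). p (pt s t))" for S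
    unfolding case_prod_beta by (intro continuous_on_slice p continuous_intros)
  have "(LINT x|LO. p x) = (LINT x|lebesgue. indicator Omega x * p x)"
    by (subst integral_restrict_space) auto
  also have "\<dots> = (LINT x|lborel. indicator Omega x * p x)"
    by (rule integral_completion) measurable
  also have "\<dots> = (LINT z|lborel. indicator Omega (case z of (s, t) \<Rightarrow> pt s t) * p (case z of (s, t) \<Rightarrow> pt s t))"
    by (subst lborel_pt, subst integral_distr[OF meas]) auto
  also have "\<dots> = (LINT z:box (0,0) (1,1)|lborel. (\<lambda>(s, t). p (pt s t)) z)"
    unfolding set_lebesgue_integral_def
    by (rule Bochner_Integration.integral_cong)
       (auto simp: Omega_def mem_box Basis_prod_def indicator_def)
  also have "\<dots> = integral (box (0,0) (1,1)) (\<lambda>(s, t). p (pt s t))"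
  proof (rule set_borel_integral_eq_integral(2))
    have "set_integrable lborel (cbox (0,0) (1,1)) (\<lambda>(s, t). p (pt s t))"
      by (rule borel_integrable_compact[unfolded set_integrable_def[symmetric]]) (auto intro: cont)
    then show "set_integrable lborel (box (0,0) (1,1)) (\<lambda>(s, t). p (pt s t))"
      by (rule set_integrable_subset) (auto simp: box_subset_cbox)
  qed
  also have "\<dots> = integral (cbox (0,0) (1,1)) (\<lambda>(s, t). p (pt s t))"
    by (rule integral_open_interval)
  also have "\<dots> = integral {0..1} (\<lambda>s. integral {0..1} (\<lambda>t. p (pt s t)))"
    using integral_prod_continuous[of "0::real" "0::real" 1 1 "\<lambda>(s, t). p (pt s t)", OF cont] by simp
  finally show ?thesis .
qed

lemma LINT_Omega_iterated_swap:
  fixes p :: "real^2 \<Rightarrow> real"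
  assumes p: "continuous_on UNIV p"
  shows "(LINT x|LO. p x) = integral {0..1} (\<lambda>t. integral {0..1} (\<lambda>s. p (pt s t)))"
proof -
  have cont: "continuous_on S (\<lambda>(s, t). p (pt s t))" for S
    unfolding case_prod_beta by (intro continuous_on_slice p continuous_intros)
  show ?thesis unfolding LINT_Omega_iterated[OF p]
    using integral_swap_continuous[of "0::real" "0::real" 1 1 "\<lambda>s t. p (pt s t)", OF cont] by simp
qed

lemma smooth_slice_deriv:
  assumes "smooth p"
  shows "((\<lambda>s. p (pt s t)) has_real_derivative partial 1 p (pt s t)) (at s)"
    and "((\<lambda>t. p (pt s t)) has_real_derivative partial 2 p (pt s t)) (at t)"
proof -
  have p: "(p has_derivative frechet_derivative p (at x)) (at x)" for x
    using smooth_differentiable[OF assms] frechet_derivative_works by blast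
  then have lin: "linear (frechet_derivative p (at x))" for x
    using has_derivative_linear by blast
  have 1: "((\<lambda>s. pt s t) has_derivative (\<lambda>h. h *\<^sub>R axis 1 1)) (at s)"
    unfolding pt_eq by (auto intro!: derivative_eq_intros)
  have 2: "((\<lambda>t. pt s t) has_derivative (\<lambda>h. h *\<^sub>R axis 2 1)) (at t)"
    unfolding pt_eq by (auto intro!: derivative_eq_intros)
  show "((\<lambda>s. p (pt s t)) has_real_derivative partial 1 p (pt s t)) (at s)"
    using has_derivative_compose[OF 1 p]
    by (simp add: has_field_derivative_def partial_def linear_scale[OF lin] mult_commute_abs)
  show "((\<lambda>t. p (pt s t)) has_real_derivative partial 2 p (pt s t)) (at t)"
    using has_derivative_compose[OF 2 p]
    by (simp add: has_field_derivative_def partial_def linear_scale[OF lin] mult_commute_abs)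
qed

lemma LINT_partial_1:
  assumes "smooth p"
  shows "(LINT x|LO. partial 1 p x) = integral {0..1} (\<lambda>t. p (pt 1 t) - p (pt 0 t))"
proof -
  have "integral {0..1} (\<lambda>s. partial 1 p (pt s t)) = p (pt 1 t) - p (pt 0 t)" for t
    by (rule integral_unique, rule fundamental_theorem_of_calculus)
       (auto intro!: has_field_derivative_at_within smooth_slice_deriv(1)[OF assms]
         simp flip: has_real_derivative_iff_has_vector_derivative)
  then show ?thesis
    by (simp add: LINT_Omega_iterated_swap smooth_continuous smooth_partial assms)
qed

lemma LINT_partial_2:
  assumes "smooth p"
  shows "(LINT x|LO. partial 2 p x) = integral {0..1} (\<lambda>s. p (pt s 1) - p (pt s 0))"
proof -
  have "integral {0..1} (\<lambda>t. partial 2 p (pt s t)) = p (pt s 1) - p (pt s 0)" for s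
    by (rule integral_unique, rule fundamental_theorem_of_calculus)
       (auto intro!: has_field_derivative_at_within smooth_slice_deriv(2)[OF assms]
         simp flip: has_real_derivative_iff_has_vector_derivative)
  then show ?thesis
    by (simp add: LINT_Omega_iterated smooth_continuous smooth_partial assms)
qed

section \<open>Test functions and weak gradients\<close>

definition cut2 :: "nat \<Rightarrow> real^2 \<Rightarrow> real" where
  "cut2 n x = cutoff n (x$1) * cutoff n (x$2)"

lemma smooth_cut2: "smooth (cut2 n)"
  unfolding cut2_def[abs_def] cutoff_def by (intro smooth_mult smooth_bump)

lemma cut2_bounds: "0 \<le> cut2 n x" "cut2 n x \<le> 1"
  by (simp_all add: cut2_def cutoff_def bump_bounds mult_le_one)

lemma cutoff_bounds: "0 \<le> cutoff n t" "cutoff n t \<le> 1"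
  by (simp_all add: cutoff_def bump_bounds)

lemma cut2_tendsto: "x \<in> Omega \<Longrightarrow> (\<lambda>n. cut2 n x) \<longlonglongrightarrow> 1"
  using tendsto_mult[OF cutoff_tendsto[of "x$1"] cutoff_tendsto[of "x$2"]]
  by (simp add: cut2_def Omega_def)

lemma test_function_cut2:
  assumes "smooth p" shows "(\<lambda>x. cut2 n x * p x) \<in> test_functions"
proof -
  define K :: "(real^2) set" where "K = cbox (\<chi> i. 1 / real n) (\<chi> i. 1 - 1 / real n)"
  have sub: "{x. cut2 n x * p x \<noteq> 0} \<subseteq> K \<and> (n = 0 \<longrightarrow> {x. cut2 n x * p x \<noteq> 0} = {})"
  proof (cases "n = 0")
    case True then show ?thesis by (auto simp: cut2_def cutoff_def bump_def flat_def)
  next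
    case False
    have 0: "cutoff n t = 0" if "\<not> (1 / real n \<le> t \<and> t \<le> 1 - 1 / real n)" for t
      unfolding cutoff_def by (rule bump_0) (use that in auto)
    have "x \<in> K" if "cut2 n x * p x \<noteq> 0" for x
    proof -
      have "cutoff n (x$1) \<noteq> 0" "cutoff n (x$2) \<noteq> 0" using that by (auto simp: cut2_def)
      with 0[of "x$1"] 0[of "x$2"] show ?thesis unfolding K_def mem_box_cart forall_2 by auto
    qed
    then show ?thesis using False by blast
  qed
  then have cl: "closure {x. cut2 n x * p x \<noteq> 0} \<subseteq> K"
    by (intro closure_minimal) (auto simp: K_def)
  have "K \<subseteq> Omega" if "n > 0"
  proof
    fix x assume "x \<in> K"
    then have "1 / real n \<le> x$i \<and> x$i \<le> 1 - 1 / real n" for i by (simp add: K_def mem_box_cart)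
    moreover have "0 < 1 / real n" using that by simp
    ultimately have "0 < x$i \<and> x$i < 1" for i by (smt (verit))
    then show "x \<in> Omega" by (simp add: Omega_def)
  qed
  then have "closure {x. cut2 n x * p x \<noteq> 0} \<subseteq> Omega" using cl sub by (cases "n = 0") auto
  moreover have "bounded {x. cut2 n x * p x \<noteq> 0}"
    by (rule bounded_subset[of K]) (use sub in \<open>auto simp: K_def\<close>)
  then have "compact (closure {x. cut2 n x * p x \<noteq> 0})" by simp
  ultimately show ?thesis using smooth_mult[OF smooth_cut2 assms] by (simp add: test_functions_def)
qed

lemma test_function_smooth: "\<phi> \<in> test_functions \<Longrightarrow> smooth \<phi>"
  by (simp add: test_functions_def)

lemma test_function_0: "\<phi> \<in> test_functions \<Longrightarrow> x \<notin> Omega \<Longrightarrow> \<phi> x = 0"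
proof (rule ccontr)
  assume a: "\<phi> \<in> test_functions" "x \<notin> Omega" "\<phi> x \<noteq> 0"
  from a(3) have "x \<in> closure {x. \<phi> x \<noteq> 0}" using closure_subset[of "{x. \<phi> x \<noteq> 0}"] by blast
  then show False using a(1,2) by (auto simp: test_functions_def)
qed

lemma LO_dominated:
  fixes f :: "real^2 \<Rightarrow> real"
  assumes f: "integrable LO f" and p: "\<And>n. p n \<in> borel_measurable LO" "q \<in> borel_measurable LO"
    and bd: "\<And>n x. x \<in> Omega \<Longrightarrow> \<bar>p n x\<bar> \<le> B" and lim: "\<And>x. x \<in> Omega \<Longrightarrow> (\<lambda>n. p n x) \<longlonglongrightarrow> q x"
  shows "(\<lambda>n. LINT x|LO. f x * p n x) \<longlonglongrightarrow> (LINT x|LO. f x * q x)"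
proof (rule integral_dominated_convergence[where w = "\<lambda>x. \<bar>f x\<bar> * B"])
  show "AE x in LO. norm (f x * p n x) \<le> \<bar>f x\<bar> * B" for n
    using bd by (intro AE_LO_I) (auto simp: abs_mult intro!: mult_left_mono)
  show "AE x in LO. (\<lambda>n. f x * p n x) \<longlonglongrightarrow> f x * q x"
    using lim by (intro AE_LO_I tendsto_intros) auto
qed (use f p in \<open>auto intro!: borel_measurable_times\<close>)

lemma smooth_measurable: "smooth p \<Longrightarrow> p \<in> borel_measurable LO"
  by (intro LO_measurable_continuous smooth_continuous)

lemma smooth_bounded:
  assumes "smooth p" obtains B where "B > 0" "\<And>x. x \<in> Omega \<Longrightarrow> \<bar>p x\<bar> \<le> B"
  using continuous_bounded_Omega[OF smooth_continuous[OF assms]] Omega_subset_cbox by (metis subsetD)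

text \<open>The cutoffs converge boundedly to \<open>1\<close>.\<close>

lemma ortho_test_imp_ortho_smooth:
  assumes f: "f \<in> L2" and ortho: "\<And>\<phi>. \<phi> \<in> test_functions \<Longrightarrow> (LINT x|LO. f x * \<phi> x) = 0" and p: "smooth p"
  shows "(LINT x|LO. f x * p x) = 0"
proof -
  obtain B where B: "B > 0" "\<And>x. x \<in> Omega \<Longrightarrow> \<bar>p x\<bar> \<le> B" using smooth_bounded[OF p] by blast
  have "(\<lambda>n. LINT x|LO. f x * (cut2 n x * p x)) \<longlonglongrightarrow> (LINT x|LO. f x * p x)"
  proof (rule LO_dominated[OF L2_integrable[OF f], where B = B])
    show "\<bar>cut2 n x * p x\<bar> \<le> B" if "x \<in> Omega" for n x
      using mult_mono[OF cut2_bounds(2)[of n x] B(2)[OF that]] cut2_bounds(1)[of n x] by (simp add: abs_mult)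
    show "(\<lambda>n. cut2 n x * p x) \<longlonglongrightarrow> p x" if "x \<in> Omega" for x
      using tendsto_mult[OF cut2_tendsto[OF that] tendsto_const[of "p x"]] by simp
  qed (auto intro!: smooth_measurable smooth_mult smooth_cut2 p)
  then show ?thesis using ortho[OF test_function_cut2[OF p]] by (simp add: LIMSEQ_const_iff)
qed

text \<open>Smooth functions converge boundedly to indicator functions of boxes. Boxes generate the Borel sets,
  and Lebesgue sets differ from Borel sets by null sets, so \<open>f\<close> has integral zero over every
  measurable set.\<close>

lemma fundamental_lemma_smooth:
  assumes f: "f \<in> L2" and ortho: "\<And>p. smooth p \<Longrightarrow> (LINT x|LO. f x * p x) = 0"
  shows "AE x in LO. f x = 0"
proof -
  have int: "integrable LO f" using f by (rule L2_integrable)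
  define F where "F x = indicator Omega x * f x" for x
  have F: "integrable lebesgue F"
    using int by (simp add: integrable_restrict_space F_def[abs_def])
  have box: "(LINT x:box a b|lebesgue. F x) = 0" for a b
  proof -
    have "(\<lambda>n. LINT x|LO. f x * (bump (real n) (a$1) (b$1) (x$1) * bump (real n) (a$2) (b$2) (x$2)))
        \<longlonglongrightarrow> (LINT x|LO. f x * indicator (box a b) x)"
    proof (rule LO_dominated[OF int, where B = 1])
      show "(\<lambda>x. bump (real n) (a$1) (b$1) (x$1) * bump (real n) (a$2) (b$2) (x$2)) \<in> borel_measurable LO" for n
        by (intro smooth_measurable smooth_mult smooth_bump)
      show "indicat_real (box a b) \<in> borel_measurable LO"
        by (intro measurable_restrict_space1 borel_measurable_indicator) simp
      show "\<bar>bump (real n) (a$1) (b$1) (x$1) * bump (real n) (a$2) (b$2) (x$2)\<bar> \<le> 1" for n x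
        by (simp add: bump_bounds abs_mult mult_le_one)
      show "(\<lambda>n. bump (real n) (a$1) (b$1) (x$1) * bump (real n) (a$2) (b$2) (x$2)) \<longlonglongrightarrow> indicat_real (box a b) x" for x
        using tendsto_mult[OF bump_tendsto[of "a$1" "b$1" "x$1"] bump_tendsto[of "a$2" "b$2" "x$2"]]
        by (auto simp: indicator_def mem_box_cart forall_2 split: if_splits)
    qed
    moreover have "(LINT x|LO. f x * (bump (real n) (a$1) (b$1) (x$1) * bump (real n) (a$2) (b$2) (x$2))) = 0" for n
      by (intro ortho smooth_mult smooth_bump)
    ultimately have "(LINT x|LO. f x * indicator (box a b) x) = 0" by (simp add: LIMSEQ_const_iff)
    then show ?thesis
      by (simp add: integral_restrict_space set_lebesgue_integral_def F_def mult.assoc mult.left_commute mult.commute)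
  qed
  have total: "(LINT x|lebesgue. F x) = 0"
    using ortho[OF smooth_const[of 1]] by (simp add: integral_restrict_space F_def)
  have si: "set_integrable lebesgue A F" if "A \<in> sets lebesgue" for A
    unfolding set_integrable_def by (rule integrable_mult_indicator[OF that F])
  have borel: "(LINT x:A|lebesgue. F x) = 0" if "A \<in> sets borel" for A
  proof -
    have A: "A \<in> sigma_sets UNIV (range (\<lambda>(a, b). box a b))"
      using that by (simp add: borel_eq_box sets_measure_of)
    have G: "Int_stable (range (\<lambda>(a, b). box a b :: (real^2) set))"
      "range (\<lambda>(a, b). box a b :: (real^2) set) \<subseteq> Pow UNIV"
      by (auto simp: Int_stable_def box_Int_box)
    from G(1) G(2) A show ?thesis
    proof (induction rule: sigma_sets_induct_disjoint)
      case (basic A) then show ?case using box by auto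
    next
      case empty then show ?case by (simp add: set_lebesgue_integral_def)
    next
      case (compl A)
      then have A: "A \<in> sets lebesgue" by (auto simp: borel_eq_box)
      have "(LINT x:A \<union> (UNIV - A)|lebesgue. F x) = (LINT x:A|lebesgue. F x) + (LINT x:UNIV - A|lebesgue. F x)"
        by (rule set_integral_Un) (use A in \<open>auto intro!: si\<close>)
      then show ?case using compl total by (simp add: set_lebesgue_integral_def)
    next
      case (union A)
      have "A i \<in> sets borel" for i
        using union.hyps(2) by (auto simp: borel_eq_box sets_measure_of)
      then have A: "A i \<in> sets lebesgue" for i by simp
      have "(LINT x:(\<Union>i. A i)|lebesgue. F x) = (\<Sum>i. LINT x:A i|lebesgue. F x)"
        by (rule lebesgue_integral_countable_add)
           (use A union.hyps in \<open>auto simp: disjoint_family_on_def intro!: si\<close>)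
      then show ?case using union by simp
    qed
  qed
  have "AE x in lebesgue. F x = 0"
  proof (rule density_unique_real[OF F])
    show "integrable lebesgue (\<lambda>x::real^2. 0::real)" by simp
    fix A :: "(real^2) set" assume "A \<in> sets lebesgue"
    then obtain S N N' where A: "A = S \<union> N" "N \<subseteq> N'" "N' \<in> null_sets lborel" "S \<in> sets lborel"
      by (rule sets_completionE)
    then have "N' \<in> null_sets lebesgue" by (simp add: null_sets_completionI)
    then have "AE x in lebesgue. x \<notin> N'" by (rule AE_not_in)
    then have "AE x in lebesgue. indicator A x *\<^sub>R F x = indicator S x *\<^sub>R F x"
      by eventually_elim (use A in \<open>auto simp: indicator_def\<close>)
    then have "(LINT x:A|lebesgue. F x) = (LINT x:S|lebesgue. F x)"
      unfolding set_lebesgue_integral_def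
      using \<open>A \<in> sets lebesgue\<close> A(4) F
      by (intro integral_cong_AE) (auto intro!: borel_measurable_times borel_measurable_indicator)
    then show "(LINT x:A|lebesgue. F x) = (LINT x:A|lebesgue. 0)"
      using borel A(4) by (simp add: set_lebesgue_integral_def)
  qed
  then show ?thesis
    by (subst AE_restrict_space_iff) (auto simp: F_def elim: eventually_mono)
qed

lemma fundamental_lemma:
  assumes "f \<in> L2" "\<And>\<phi>. \<phi> \<in> test_functions \<Longrightarrow> (LINT x|LO. f x * \<phi> x) = 0"
  shows "AE x in LO. f x = 0"
  using fundamental_lemma_smooth ortho_test_imp_ortho_smooth assms by blast

lemma norm_vec2_sq: "(norm (v :: 'b::real_normed_vector^2))\<^sup>2 = (norm (v$1))\<^sup>2 + (norm (v$2))\<^sup>2"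
  by (simp add: norm_vec_def L2_set_def sum_2)

lemma measurable_vec2:
  fixes g :: "'a \<Rightarrow> 'b::euclidean_space^2"
  shows "g \<in> borel_measurable M \<longleftrightarrow> (\<forall>i. (\<lambda>x. g x $ i) \<in> borel_measurable M)"
proof
  assume "g \<in> borel_measurable M"
  moreover have "(\<lambda>v::'b^2. v $ i) \<in> borel_measurable borel" for i
    by (intro borel_measurable_continuous_onI continuous_intros)
  ultimately show "\<forall>i. (\<lambda>x. g x $ i) \<in> borel_measurable M"
    using measurable_compose by blast
next
  assume *: "\<forall>i. (\<lambda>x. g x $ i) \<in> borel_measurable M"
  show "g \<in> borel_measurable M"
    by (subst borel_measurable_euclidean_space)
       (use * in \<open>auto simp: Basis_vec_def inner_axis intro!: borel_measurable_inner\<close>)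
qed

lemma L2_vec2:
  fixes g :: "real^2 \<Rightarrow> 'b::euclidean_space^2"
  shows "g \<in> L2 \<longleftrightarrow> (\<forall>i. (\<lambda>x. g x $ i) \<in> L2)"
proof
  assume g: "g \<in> L2"
  then have m: "(\<lambda>x. g x $ i) \<in> borel_measurable LO" for i by (simp add: L2_def measurable_vec2)
  show "\<forall>i. (\<lambda>x. g x $ i) \<in> L2"
  proof
    fix i
    have "integrable LO (\<lambda>x. (norm (g x))\<^sup>2)" using g by (simp add: L2_def)
    then have "integrable LO (\<lambda>x. (norm (g x $ i))\<^sup>2)"
      by (rule Bochner_Integration.integrable_bound)
         (use m in \<open>auto intro!: AE_I2 power_mono Finite_Cartesian_Product.norm_nth_le\<close>)
    with m show "(\<lambda>x. g x $ i) \<in> L2" by (simp add: L2_def)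
  qed
next
  assume "\<forall>i. (\<lambda>x. g x $ i) \<in> L2"
  then show "g \<in> L2" by (auto simp: L2_def measurable_vec2 norm_vec2_sq)
qed

lemma L2_norm_vec2:
  fixes g :: "real^2 \<Rightarrow> 'b::euclidean_space^2"
  assumes "g \<in> L2"
  shows "(L2_norm g)\<^sup>2 = (L2_norm (\<lambda>x. g x $ 1))\<^sup>2 + (L2_norm (\<lambda>x. g x $ 2))\<^sup>2"
proof -
  have "(\<lambda>x. g x $ i) \<in> L2" for i using assms L2_vec2 by blast
  then have "integrable LO (\<lambda>x. (norm (g x $ i))\<^sup>2)" for i by (simp add: L2_def)
  then show ?thesis by (simp add: L2_norm_def norm_vec2_sq)
qed

lemma L2_norm_component_le:
  fixes g :: "real^2 \<Rightarrow> 'b::euclidean_space^2"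
  assumes "g \<in> L2" shows "L2_norm (\<lambda>x. g x $ i) \<le> L2_norm g"
  by (rule power2_le_imp_le) (use L2_norm_vec2[OF assms] exhaust_2[of i] in auto)

lemma weak_gradientD:
  assumes "weak_gradient f g"
  shows "f \<in> L2" "(\<lambda>x. g x $ j) \<in> L2"
    "\<phi> \<in> test_functions \<Longrightarrow> (LINT x|LO. f x * partial j \<phi> x) = - (LINT x|LO. g x $ j * \<phi> x)"
  using assms L2_vec2[of g] by (auto simp: weak_gradient_def)

lemma weak_gradientI:
  assumes "f \<in> L2" "\<And>j. (\<lambda>x. g x $ j) \<in> L2"
    "\<And>\<phi> j. \<phi> \<in> test_functions \<Longrightarrow> (LINT x|LO. f x * partial j \<phi> x) = - (LINT x|LO. g x $ j * \<phi> x)"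
  shows "weak_gradient f g"
  using assms L2_vec2[of g] by (auto simp: weak_gradient_def)

lemma test_function_L2: "\<phi> \<in> test_functions \<Longrightarrow> \<phi> \<in> L2" "\<phi> \<in> test_functions \<Longrightarrow> partial j \<phi> \<in> L2"
  by (auto intro: L2_smooth smooth_partial test_function_smooth)

lemma weak_gradient_lincomb:
  assumes "weak_gradient f g" "weak_gradient f' g'"
  shows "weak_gradient (\<lambda>x. a * f x + b * f' x) (\<lambda>x. a *\<^sub>R g x + b *\<^sub>R g' x)"
proof (rule weak_gradientI)
  note D = weak_gradientD[OF assms(1)] and D' = weak_gradientD[OF assms(2)]
  show "(\<lambda>x. a * f x + b * f' x) \<in> L2" using D D' by (intro L2_add L2_cmult)
  show "(\<lambda>x. (a *\<^sub>R g x + b *\<^sub>R g' x) $ j) \<in> L2" for j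
    using D D' by (simp add: L2_add L2_cmult)
  fix \<phi> j assume \<phi>: "\<phi> \<in> test_functions"
  note i = L2_mult_integrable[OF D(1) test_function_L2(2)[OF \<phi>]] L2_mult_integrable[OF D'(1) test_function_L2(2)[OF \<phi>]]
    L2_mult_integrable[OF D(2) test_function_L2(1)[OF \<phi>]] L2_mult_integrable[OF D'(2) test_function_L2(1)[OF \<phi>]]
  show "(LINT x|LO. (a * f x + b * f' x) * partial j \<phi> x) = - (LINT x|LO. (a *\<^sub>R g x + b *\<^sub>R g' x) $ j * \<phi> x)"
    using D(3)[OF \<phi>, of j] D'(3)[OF \<phi>, of j] i
    by (simp add: distrib_right mult.assoc)
qed

lemma grad_nth: "grad f x $ j = partial j f x"
  by (simp add: grad_def)

lemma integral_partial_mult: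
  assumes "smooth p" "smooth q"
  shows "(LINT x|LO. partial j (\<lambda>x. p x * q x) x) = (LINT x|LO. p x * partial j q x) + (LINT x|LO. partial j p x * q x)"
proof -
  have "(\<lambda>x. partial j (\<lambda>x. p x * q x) x) = (\<lambda>x. p x * partial j q x + partial j p x * q x)"
    by (rule ext, rule partial_mult) (use assms smooth_differentiable in auto)
  then show ?thesis
    by (simp add: L2_mult_integrable L2_smooth smooth_partial assms)
qed

lemma weak_gradient_smooth:
  assumes "smooth f" shows "weak_gradient f (grad f)"
proof (rule weak_gradientI)
  fix \<phi> j assume \<phi>: "\<phi> \<in> test_functions"
  have s: "smooth (\<lambda>x. f x * \<phi> x)" by (intro smooth_mult assms test_function_smooth \<phi>)
  have 0: "\<phi> (pt s t) = 0" if "s \<notin> {0<..<1} \<or> t \<notin> {0<..<1}" for s t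
    by (rule test_function_0[OF \<phi>]) (use that in \<open>auto simp: Omega_def\<close>)
  have "j = (1::2) \<or> j = 2" by (rule exhaust_2)
  then have "(LINT x|LO. partial j (\<lambda>x. f x * \<phi> x) x) = 0"
    using LINT_partial_1[OF s] LINT_partial_2[OF s] by (auto simp: 0)
  then show "(LINT x|LO. f x * partial j \<phi> x) = - (LINT x|LO. grad f x $ j * \<phi> x)"
    using integral_partial_mult[OF assms test_function_smooth[OF \<phi>], of j] by (simp add: grad_nth)
qed (auto simp: grad_nth intro!: L2_smooth smooth_partial assms)

text \<open>Both sides of the defining identity are continuous with respect to convergence in \<open>L\<^sup>2\<close>.\<close>

lemma weak_gradient_lim:
  assumes wg: "\<And>n. weak_gradient (f n) (g n)" and "L2_lim f F" and "\<And>j. L2_lim (\<lambda>n x. g n x $ j) (\<lambda>x. G x $ j)"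
  shows "weak_gradient F G"
proof (rule weak_gradientI)
  show "F \<in> L2" "(\<lambda>x. G x $ j) \<in> L2" for j using assms by (auto simp: L2_lim_def)
  fix \<phi> j assume \<phi>: "\<phi> \<in> test_functions"
  have "(\<lambda>n. - (LINT x|LO. g n x $ j * \<phi> x)) \<longlonglongrightarrow> - (LINT x|LO. G x $ j * \<phi> x)"
    by (intro tendsto_minus L2_lim_ip assms test_function_L2 \<phi>)
  moreover have "(\<lambda>n. LINT x|LO. f n x * partial j \<phi> x) \<longlonglongrightarrow> (LINT x|LO. F x * partial j \<phi> x)"
    by (intro L2_lim_ip assms test_function_L2 \<phi>)
  ultimately show "(LINT x|LO. F x * partial j \<phi> x) = - (LINT x|LO. G x $ j * \<phi> x)"
    using weak_gradientD(3)[OF wg \<phi>] LIMSEQ_unique by simp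
qed

lemma weak_gradient_unique:
  assumes "weak_gradient f g" "weak_gradient f g'"
  shows "AE x in LO. g x = g' x"
proof -
  have "AE x in LO. g x $ j - g' x $ j = 0" for j
  proof (rule fundamental_lemma)
    show "(\<lambda>x. g x $ j - g' x $ j) \<in> L2" using assms by (intro L2_intros weak_gradientD)
    fix \<phi> assume \<phi>: "\<phi> \<in> test_functions"
    show "(LINT x|LO. (g x $ j - g' x $ j) * \<phi> x) = 0"
      using weak_gradientD(3)[OF assms(1) \<phi>, of j] weak_gradientD(3)[OF assms(2) \<phi>, of j]
        L2_mult_integrable[OF weak_gradientD(2)[OF assms(1)] test_function_L2(1)[OF \<phi>], of j]
        L2_mult_integrable[OF weak_gradientD(2)[OF assms(2)] test_function_L2(1)[OF \<phi>], of j]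
      by (simp add: left_diff_distrib)
  qed
  from this[of 1] this[of 2] show ?thesis
    by eventually_elim (simp add: vec_eq_iff forall_2)
qed

lemma partial_cut2:
  "partial j (cut2 n) x = dcutoff n (x$j) * cutoff n (x$(if j = 1 then 2 else 1))"
proof -
  have d: "(\<lambda>x. cutoff n (x$i)) differentiable (at x)"
    "partial j (\<lambda>x. cutoff n (x$i)) x = (if i = j then dcutoff n (x$i) else 0)" for i
    unfolding cutoff_def dcutoff_def
    using partial_coord(1)[OF bump_deriv[of "real n" "1 / real n" "1 - 1 / real n"], where x=x and i=i and j=j] partial_coord(2)[OF bump_deriv[of "real n" "1 / real n" "1 - 1 / real n"], where x=x and i=i] by auto
  have "partial j (cut2 n) x = cutoff n (x$1) * partial j (\<lambda>x. cutoff n (x$2)) x + partial j (\<lambda>x. cutoff n (x$1)) x * cutoff n (x$2)"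
    unfolding cut2_def[abs_def] by (rule partial_mult) (rule d)+
  then show ?thesis using exhaust_2[of j] by (auto simp: d)
qed

text \<open>After multiplication with a cutoff, \<open>p\<close> is a test function. The derivative in direction \<open>j\<close> meets
  only the cutoff in that direction, so it is enough that \<open>p\<close> decays towards the two edges orthogonal
  to it.\<close>

lemma weak_gradient_by_parts:
  assumes wg: "weak_gradient f g" and p: "smooth p"
    and C: "\<And>x. x \<in> Omega \<Longrightarrow> \<bar>p x\<bar> \<le> C * (x$j * (1 - x$j))"
  shows "(LINT x|LO. g x $ j * p x) = - (LINT x|LO. f x * partial j p x)"
proof -
  note D = weak_gradientD[OF wg]
  obtain B where B: "B > 0" "\<And>x. x \<in> Omega \<Longrightarrow> \<bar>p x\<bar> \<le> B" using smooth_bounded[OF p] by blast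
  obtain B' where B': "B' > 0" "\<And>x. x \<in> Omega \<Longrightarrow> \<bar>partial j p x\<bar> \<le> B'" using smooth_bounded[OF smooth_partial[OF p]] by blast
  have c1: "\<bar>cut2 n x * y\<bar> \<le> \<bar>y\<bar>" for n x y
    using mult_mono[OF cut2_bounds(2)[of n x] order_refl[of "\<bar>y\<bar>"]] cut2_bounds(1)[of n x] by (simp add: abs_mult)
  have xj: "0 < x$j \<and> x$j < 1" if "x \<in> Omega" for x using that exhaust_2[of j] by (auto simp: Omega_def)
  have tp: "partial j (\<lambda>x. cut2 n x * p x) x = cut2 n x * partial j p x + partial j (cut2 n) x * p x" for n x
    by (rule partial_mult) (auto intro: smooth_differentiable smooth_cut2 p)
  have dle: "\<bar>partial j (cut2 n) x * p x\<bar> \<le> C * \<bar>dcutoff n (x$j) * (x$j * (1 - x$j))\<bar>" if "x \<in> Omega" for n x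
  proof -
    have "\<bar>partial j (cut2 n) x * p x\<bar> \<le> (\<bar>dcutoff n (x$j)\<bar> * 1) * (C * (x$j * (1 - x$j)))"
      unfolding abs_mult partial_cut2
      using C[OF that] cutoff_bounds[of n] by (intro mult_mono) auto
    also have "\<dots> = C * \<bar>dcutoff n (x$j) * (x$j * (1 - x$j))\<bar>"
      using xj[OF that] by (simp add: abs_mult)
    finally show ?thesis .
  qed
  have C0: "C \<ge> 0"
  proof -
    have "pt (1/2) (1/2) \<in> Omega" by (simp add: Omega_def)
    from C[OF this] have "0 \<le> C * (pt (1/2) (1/2) $ j * (1 - pt (1/2) (1/2) $ j))" by linarith
    then show ?thesis using exhaust_2[of j] by (auto simp: zero_le_mult_iff)
  qed
  have "(\<lambda>n. LINT x|LO. g x $ j * (cut2 n x * p x)) \<longlonglongrightarrow> (LINT x|LO. g x $ j * p x)"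
  proof (rule LO_dominated[OF L2_integrable[OF D(2)], where B = B])
    show "\<bar>cut2 n x * p x\<bar> \<le> B" if "x \<in> Omega" for n x using c1[of n x "p x"] B(2)[OF that] by linarith
    show "(\<lambda>n. cut2 n x * p x) \<longlonglongrightarrow> p x" if "x \<in> Omega" for x
      using tendsto_mult[OF cut2_tendsto[OF that] tendsto_const[of "p x"]] by simp
  qed (auto intro!: smooth_measurable smooth_mult smooth_cut2 p)
  moreover have "(\<lambda>n. LINT x|LO. f x * partial j (\<lambda>x. cut2 n x * p x) x) \<longlonglongrightarrow> (LINT x|LO. f x * partial j p x)"
  proof (rule LO_dominated[OF L2_integrable[OF D(1)], where B = "B' + C * 8"])
    fix x assume x: "x \<in> Omega"
    show "\<bar>partial j (\<lambda>x. cut2 n x * p x) x\<bar> \<le> B' + C * 8" for n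
    proof -
      have "\<bar>cut2 n x * partial j p x\<bar> \<le> B'" using c1[of n x "partial j p x"] B'(2)[OF x] by linarith
      moreover have "\<bar>partial j (cut2 n) x * p x\<bar> \<le> C * 8"
        using dle[OF x, of n] dcutoff_bound[of "x$j" n] xj[OF x] C0
        by (intro order_trans[OF dle[OF x, of n]] mult_left_mono) (auto simp: abs_mult)
      ultimately show ?thesis unfolding tp by linarith
    qed
    have "(\<lambda>n. C * \<bar>dcutoff n (x$j) * (x$j * (1 - x$j))\<bar>) \<longlonglongrightarrow> C * \<bar>0\<bar>"
      using xj[OF x] by (intro tendsto_mult_left tendsto_rabs dcutoff_tendsto) auto
    then have lim0: "(\<lambda>n. C * \<bar>dcutoff n (x$j) * (x$j * (1 - x$j))\<bar>) \<longlonglongrightarrow> 0" by simp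
    have "(\<lambda>n. partial j (cut2 n) x * p x) \<longlonglongrightarrow> 0"
    proof (rule Lim_null_comparison[OF always_eventually lim0], rule allI)
      show "norm (partial j (cut2 n) x * p x) \<le> C * \<bar>dcutoff n (x$j) * (x$j * (1 - x$j))\<bar>" for n
        using dle[OF x, of n] by (simp only: real_norm_def)
    qed
    from tendsto_add[OF tendsto_mult[OF cut2_tendsto[OF x] tendsto_const[of "partial j p x"]] this]
    show "(\<lambda>n. partial j (\<lambda>x. cut2 n x * p x) x) \<longlonglongrightarrow> partial j p x" by (simp add: tp)
  qed (auto intro!: smooth_measurable smooth_partial smooth_mult smooth_cut2 p)
  then have "(\<lambda>n. - (LINT x|LO. f x * partial j (\<lambda>x. cut2 n x * p x) x)) \<longlonglongrightarrow> - (LINT x|LO. f x * partial j p x)"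
    by (rule tendsto_minus)
  moreover have "(LINT x|LO. g x $ j * (cut2 n x * p x)) = - (LINT x|LO. f x * partial j (\<lambda>x. cut2 n x * p x) x)" for n
    using D(3)[OF test_function_cut2[OF p]] by simp
  ultimately show ?thesis using LIMSEQ_unique by simp
qed

section \<open>Traces\<close>

lemma Cauchy_Schwarz_interval:
  fixes f g :: "real \<Rightarrow> real"
  assumes [continuous_intros]: "continuous_on {0..1} f" "continuous_on {0..1} g"
  shows "(integral {0..1} (\<lambda>t. f t * g t))\<^sup>2 \<le> integral {0..1} (\<lambda>t. (f t)\<^sup>2) * integral {0..1} (\<lambda>t. (g t)\<^sup>2)"
proof (rule nonneg_quadratic_discriminant)
  fix s
  have "0 \<le> integral {0..1} (\<lambda>t. (f t - s * g t)\<^sup>2)"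
    by (intro integral_nonneg integrable_continuous_interval continuous_intros) auto
  also have "(\<lambda>t. (f t - s * g t)\<^sup>2) = (\<lambda>t. (f t)\<^sup>2 - 2 * s * (f t * g t) + s\<^sup>2 * (g t)\<^sup>2)"
    by (auto simp: power2_diff algebra_simps power_mult_distrib)
  also have "integral {0..1} \<dots> = integral {0..1} (\<lambda>t. (f t)\<^sup>2) - integral {0..1} (\<lambda>t. 2 * s * (f t * g t)) + integral {0..1} (\<lambda>t. s\<^sup>2 * (g t)\<^sup>2)"
    by (subst Henstock_Kurzweil_Integration.integral_add)
       (auto intro!: integrable_continuous_interval continuous_intros,
        subst Henstock_Kurzweil_Integration.integral_diff,
        auto intro!: integrable_continuous_interval continuous_intros)
  finally show "0 \<le> integral {0..1} (\<lambda>t. (f t)\<^sup>2) - 2 * s * integral {0..1} (\<lambda>t. f t * g t) + s\<^sup>2 * integral {0..1} (\<lambda>t. (g t)\<^sup>2)"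
    by (simp only: integral_mult_right)
qed (auto intro!: integral_nonneg integrable_continuous_interval continuous_intros)

lemma LINT_interval:
  "continuous_on {0..1} (f :: real \<Rightarrow> real) \<Longrightarrow> (LINT t|lebesgue_on {0..1}. f t) = integral {0..1} f"
  by (rule lebesgue_integral_eq_integral) (auto intro: continuous_imp_integrable_real)

lemma continuous_edge:
  assumes "smooth p" shows "continuous_on S (\<lambda>t. p (pt t s))"
  by (rule continuous_on_slice[OF smooth_continuous[OF assms]]) (auto intro: continuous_intros)

lemma L2_lim_grad:
  assumes s: "\<And>k. smooth (\<phi> k)" and "G \<in> L2"
  shows "(\<lambda>k. L2_norm (\<lambda>x. grad (\<phi> k) x - G x)) \<longlonglongrightarrow> 0 \<longleftrightarrow>
    (\<forall>j. L2_lim (\<lambda>k. partial j (\<phi> k)) (\<lambda>x. G x $ j))"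
proof -
  have G: "(\<lambda>x. G x $ j) \<in> L2" for j using assms(2) L2_vec2 by blast
  have L2p: "partial j (\<phi> k) \<in> L2" for j k by (intro L2_smooth smooth_partial s)
  have in_L2: "(\<lambda>x. grad (\<phi> k) x - G x) \<in> L2" for k
    by (simp add: L2_vec2 grad_nth L2_diff L2p G)
  have sq: "(L2_norm (\<lambda>x. grad (\<phi> k) x - G x))\<^sup>2 = (L2_norm (\<lambda>x. partial 1 (\<phi> k) x - G x $ 1))\<^sup>2
     + (L2_norm (\<lambda>x. partial 2 (\<phi> k) x - G x $ 2))\<^sup>2" for k
    using L2_norm_vec2[OF in_L2] by (simp add: grad_nth)
  show ?thesis
  proof
    assume lim: "(\<lambda>k. L2_norm (\<lambda>x. grad (\<phi> k) x - G x)) \<longlonglongrightarrow> 0"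
    have "(\<lambda>k. L2_norm (\<lambda>x. partial j (\<phi> k) x - G x $ j)) \<longlonglongrightarrow> 0" for j
      by (rule Lim_null_comparison[OF always_eventually lim])
         (use L2_norm_component_le[OF in_L2, of _ j] in \<open>auto simp: grad_nth\<close>)
    then show "\<forall>j. L2_lim (\<lambda>k. partial j (\<phi> k)) (\<lambda>x. G x $ j)"
      by (simp add: L2_lim_def L2p G)
  next
    assume "\<forall>j. L2_lim (\<lambda>k. partial j (\<phi> k)) (\<lambda>x. G x $ j)"
    then have "(\<lambda>k. L2_norm (\<lambda>x. partial j (\<phi> k) x - G x $ j)) \<longlonglongrightarrow> 0" for j
      by (simp add: L2_lim_def)
    then have "(\<lambda>k. sqrt ((L2_norm (\<lambda>x. partial 1 (\<phi> k) x - G x $ 1))\<^sup>2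
     + (L2_norm (\<lambda>x. partial 2 (\<phi> k) x - G x $ 2))\<^sup>2)) \<longlonglongrightarrow> sqrt (0\<^sup>2 + 0\<^sup>2)"
      by (intro tendsto_intros)
    then show "(\<lambda>k. L2_norm (\<lambda>x. grad (\<phi> k) x - G x)) \<longlonglongrightarrow> 0" by (simp flip: sq)
  qed
qed

text \<open>Convergence of the gradients is expressed in components, and the integral over the edge as the
  integral of a continuous function.\<close>

lemma has_trace_const_iff:
  "has_trace s f (\<lambda>_. c) \<longleftrightarrow> (\<exists>G \<phi>. weak_gradient f G \<and> (\<forall>k. smooth (\<phi> k)) \<and> L2_lim \<phi> f \<and>
     (\<forall>j. L2_lim (\<lambda>k. partial j (\<phi> k)) (\<lambda>x. G x $ j)) \<and>
     (\<lambda>k. integral {0..1} (\<lambda>t. (\<phi> k (pt t s) - c)\<^sup>2)) \<longlonglongrightarrow> 0)"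
proof -
  have e: "(\<lambda>k. LINT t|lebesgue_on {0..1}. (\<phi> k (pt t s) - c)\<^sup>2) = (\<lambda>k. integral {0..1} (\<lambda>t. (\<phi> k (pt t s) - c)\<^sup>2))"
    if "\<forall>k. smooth (\<phi> k)" for \<phi> :: "nat \<Rightarrow> _"
    by (intro ext LINT_interval continuous_intros continuous_edge[OF that[rule_format]])
  have "integrable (lebesgue_on {0..1::real}) (\<lambda>t. c\<^sup>2)"
    by (rule continuous_imp_integrable_real) auto
  moreover have "weak_gradient f G \<Longrightarrow> f \<in> L2 \<and> G \<in> L2" for G by (simp add: weak_gradient_def)
  ultimately show ?thesis unfolding has_trace_def L2_lim_def[of _ f]
    by (intro ex_cong1 conj_cong refl) (auto simp: e L2_smooth L2_lim_grad)
qed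

text \<open>For the smooth approximants this is the fundamental theorem of calculus. Their values are controlled
  on one edge only, and \<open>q\<close> vanishes on the other.\<close>

lemma has_trace_by_parts:
  assumes tr: "has_trace s f (\<lambda>_. c)" and wg: "weak_gradient f G" and q: "smooth q"
    and s: "s = 1 \<and> (\<forall>t. q (pt t 0) = 0) \<or> s = 0 \<and> (\<forall>t. q (pt t 1) = 0)"
  shows "(LINT x|LO. G x $ 2 * q x) + (LINT x|LO. f x * partial 2 q x) =
    (if s = 1 then c else - c) * integral {0..1} (\<lambda>t. q (pt t s))"
proof -
  from tr obtain G' \<phi> where G': "weak_gradient f G'" and \<phi>: "\<And>k. smooth (\<phi> k)" and lim: "L2_lim \<phi> f"
    and glim: "\<And>j. L2_lim (\<lambda>k. partial j (\<phi> k)) (\<lambda>x. G' x $ j)"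
    and elim: "(\<lambda>k. integral {0..1} (\<lambda>t. (\<phi> k (pt t s) - c)\<^sup>2)) \<longlonglongrightarrow> 0"
    unfolding has_trace_const_iff by blast
  have qL2: "q \<in> L2" "partial 2 q \<in> L2" by (intro L2_smooth q smooth_partial)+
  define \<sigma> where "\<sigma> = (if s = 1 then 1 else -1::real)"
  have G'G: "(LINT x|LO. G' x $ 2 * q x) = (LINT x|LO. G x $ 2 * q x)"
    by (rule integral_cong_AE)
       (use weak_gradient_unique[OF wg G'] weak_gradientD(2)[OF wg] weak_gradientD(2)[OF G'] qL2
         in \<open>auto intro!: borel_measurable_times dest: L2_measurable\<close>)
  have "(\<lambda>k. (LINT x|LO. partial 2 (\<phi> k) x * q x) + (LINT x|LO. \<phi> k x * partial 2 q x))
      \<longlonglongrightarrow> (LINT x|LO. G' x $ 2 * q x) + (LINT x|LO. f x * partial 2 q x)"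
    by (intro tendsto_add L2_lim_ip glim lim qL2)
  moreover have "(LINT x|LO. partial 2 (\<phi> k) x * q x) + (LINT x|LO. \<phi> k x * partial 2 q x)
     = \<sigma> * integral {0..1} (\<lambda>t. \<phi> k (pt t s) * q (pt t s))" for k
    using integral_partial_mult[OF \<phi> q, of 2 k] LINT_partial_2[OF smooth_mult[OF \<phi> q], of k] s
    by (auto simp: \<sigma>_def)
  moreover have "(\<lambda>k. \<sigma> * integral {0..1} (\<lambda>t. \<phi> k (pt t s) * q (pt t s))) \<longlonglongrightarrow> \<sigma> * (c * integral {0..1} (\<lambda>t. q (pt t s)))"
  proof (rule tendsto_mult_left)
    define Q where "Q = integral {0..1} (\<lambda>t. (q (pt t s))\<^sup>2)"
    have eq: "integral {0..1} (\<lambda>t. \<phi> k (pt t s) * q (pt t s)) - c * integral {0..1} (\<lambda>t. q (pt t s))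
       = integral {0..1} (\<lambda>t. (\<phi> k (pt t s) - c) * q (pt t s))" for k
      by (subst integral_mult_right[symmetric], subst Henstock_Kurzweil_Integration.integral_diff[symmetric])
         (auto intro!: integrable_continuous_interval continuous_intros continuous_edge[OF \<phi>] continuous_edge[OF q] simp: left_diff_distrib)
    have "(\<lambda>k. sqrt (integral {0..1} (\<lambda>t. (\<phi> k (pt t s) - c)\<^sup>2) * Q)) \<longlonglongrightarrow> sqrt (0 * Q)"
      by (intro tendsto_intros elim)
    then have z: "(\<lambda>k. sqrt (integral {0..1} (\<lambda>t. (\<phi> k (pt t s) - c)\<^sup>2) * Q)) \<longlonglongrightarrow> 0" by simp
    have "(\<lambda>k. integral {0..1} (\<lambda>t. \<phi> k (pt t s) * q (pt t s)) - c * integral {0..1} (\<lambda>t. q (pt t s))) \<longlonglongrightarrow> 0"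
    proof (rule Lim_null_comparison[OF always_eventually z], intro allI)
      fix k
      have "(integral {0..1} (\<lambda>t. (\<phi> k (pt t s) - c) * q (pt t s)))\<^sup>2 \<le> integral {0..1} (\<lambda>t. (\<phi> k (pt t s) - c)\<^sup>2) * Q"
        unfolding Q_def by (intro Cauchy_Schwarz_interval continuous_intros continuous_edge[OF \<phi>] continuous_edge[OF q])
      then show "norm (integral {0..1} (\<lambda>t. \<phi> k (pt t s) * q (pt t s)) - c * integral {0..1} (\<lambda>t. q (pt t s)))
           \<le> sqrt (integral {0..1} (\<lambda>t. (\<phi> k (pt t s) - c)\<^sup>2) * Q)"
        unfolding eq by (simp add: real_le_rsqrt)
    qed
    then show "(\<lambda>k. integral {0..1} (\<lambda>t. \<phi> k (pt t s) * q (pt t s))) \<longlonglongrightarrow> c * integral {0..1} (\<lambda>t. q (pt t s))"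
      by (simp add: LIM_zero_iff)
  qed
  ultimately have "(LINT x|LO. G' x $ 2 * q x) + (LINT x|LO. f x * partial 2 q x) = \<sigma> * (c * integral {0..1} (\<lambda>t. q (pt t s)))"
    using LIMSEQ_unique by simp
  then show ?thesis using G'G by (simp add: \<sigma>_def)
qed

text \<open>The two traces may be witnessed by different approximating sequences. Splitting \<open>p\<close> as
  \<open>x\<^sub>2 p + (1 - x\<^sub>2) p\<close> treats the edges one at a time.\<close>

lemma trace_by_parts:
  assumes tr: "has_trace 1 f (\<lambda>_. c)" "has_trace 0 f (\<lambda>_. 0)" and wg: "weak_gradient f G" and p: "smooth p"
  shows "(LINT x|LO. G x $ 2 * p x) + (LINT x|LO. f x * partial 2 p x) = c * integral {0..1} (\<lambda>t. p (pt t 1))"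
proof -
  define q1 where "q1 = (\<lambda>x. x$2 * p x)"
  define q0 where "q0 = (\<lambda>x. (1 - x$2) * p x)"
  have s: "smooth q1" "smooth q0"
    unfolding q1_def q0_def by (intro smooth_mult smooth_diff smooth_const smooth_coord p)+
  have p_eq: "p = (\<lambda>x. q1 x + q0 x)" by (auto simp: q1_def q0_def algebra_simps)
  have "partial 2 p x = partial 2 q1 x + partial 2 q0 x" for x
    by (subst p_eq, rule partial_add) (intro smooth_differentiable s)+
  moreover have "(LINT x|LO. G x $ 2 * q1 x) + (LINT x|LO. f x * partial 2 q1 x) = c * integral {0..1} (\<lambda>t. p (pt t 1))"
    using has_trace_by_parts[OF tr(1) wg s(1)] by (simp add: q1_def)
  moreover have "(LINT x|LO. G x $ 2 * q0 x) + (LINT x|LO. f x * partial 2 q0 x) = 0"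
    using has_trace_by_parts[OF tr(2) wg s(2)] by (simp add: q0_def)
  moreover have "(LINT x|LO. G x $ 2 * p x) = (LINT x|LO. G x $ 2 * q1 x) + (LINT x|LO. G x $ 2 * q0 x)"
    by (subst p_eq) (simp add: distrib_left L2_mult_integrable weak_gradientD(2)[OF wg] L2_smooth s)
  moreover have "(LINT x|LO. f x * (partial 2 q1 x + partial 2 q0 x)) = (LINT x|LO. f x * partial 2 q1 x) + (LINT x|LO. f x * partial 2 q0 x)"
    by (simp add: distrib_left L2_mult_integrable weak_gradientD(1)[OF wg] L2_smooth smooth_partial s)
  ultimately show ?thesis by simp
qed

lemma has_trace_smooth:
  assumes "smooth f" "\<And>t. f (pt t s) = c" shows "has_trace s f (\<lambda>_. c)"
  unfolding has_trace_const_iff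
  by (rule exI[of _ "grad f"], rule exI[of _ "\<lambda>_. f"])
     (auto simp: assms weak_gradient_smooth grad_nth intro!: L2_lim_const L2_smooth smooth_partial)

lemma has_trace_lincomb:
  assumes "has_trace s f (\<lambda>_. c)" "has_trace s f' (\<lambda>_. c')"
  shows "has_trace s (\<lambda>x. a * f x + b * f' x) (\<lambda>_. a * c + b * c')"
proof -
  obtain G \<phi> where 1: "weak_gradient f G" "\<And>k. smooth (\<phi> k)" "L2_lim \<phi> f"
    "\<And>j. L2_lim (\<lambda>k. partial j (\<phi> k)) (\<lambda>x. G x $ j)"
    "(\<lambda>k. integral {0..1} (\<lambda>t. (\<phi> k (pt t s) - c)\<^sup>2)) \<longlonglongrightarrow> 0"
    using assms(1) unfolding has_trace_const_iff by blast
  obtain G' \<phi>' where 2: "weak_gradient f' G'" "\<And>k. smooth (\<phi>' k)" "L2_lim \<phi>' f'"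
    "\<And>j. L2_lim (\<lambda>k. partial j (\<phi>' k)) (\<lambda>x. G' x $ j)"
    "(\<lambda>k. integral {0..1} (\<lambda>t. (\<phi>' k (pt t s) - c')\<^sup>2)) \<longlonglongrightarrow> 0"
    using assms(2) unfolding has_trace_const_iff by blast
  define \<psi> where "\<psi> k = (\<lambda>x. a * \<phi> k x + b * \<phi>' k x)" for k
  have s: "smooth (\<psi> k)" for k unfolding \<psi>_def by (intro smooth_add smooth_cmult 1 2)
  have part: "partial j (\<psi> k) x = a * partial j (\<phi> k) x + b * partial j (\<phi>' k) x" for j k x
    unfolding \<psi>_def
    by (subst partial_add) (auto simp: partial_cmult smooth_differentiable 1 2 smooth_cmult)
  have "(\<lambda>k. 2 * a\<^sup>2 * integral {0..1} (\<lambda>t. (\<phi> k (pt t s) - c)\<^sup>2) + 2 * b\<^sup>2 * integral {0..1} (\<lambda>t. (\<phi>' k (pt t s) - c')\<^sup>2)) \<longlonglongrightarrow> 2 * a\<^sup>2 * 0 + 2 * b\<^sup>2 * 0"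
    by (intro tendsto_intros 1 2)
  then have z: "(\<lambda>k. 2 * a\<^sup>2 * integral {0..1} (\<lambda>t. (\<phi> k (pt t s) - c)\<^sup>2) + 2 * b\<^sup>2 * integral {0..1} (\<lambda>t. (\<phi>' k (pt t s) - c')\<^sup>2)) \<longlonglongrightarrow> 0" by simp
  have "(\<lambda>k. integral {0..1} (\<lambda>t. (\<psi> k (pt t s) - (a * c + b * c'))\<^sup>2)) \<longlonglongrightarrow> 0"
  proof (rule Lim_null_comparison[OF always_eventually z], intro allI)
    fix k
    have sq: "(y + z)\<^sup>2 \<le> 2 * y\<^sup>2 + 2 * z\<^sup>2" for y z :: real
      using sum_squares_bound[of y z] by (simp add: power2_sum)
    have "(\<psi> k (pt t s) - (a * c + b * c'))\<^sup>2 \<le> 2 * a\<^sup>2 * (\<phi> k (pt t s) - c)\<^sup>2 + 2 * b\<^sup>2 * (\<phi>' k (pt t s) - c')\<^sup>2" for t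
      using sq[of "a * (\<phi> k (pt t s) - c)" "b * (\<phi>' k (pt t s) - c')"]
      unfolding power_mult_distrib by (simp add: \<psi>_def right_diff_distrib mult.assoc add_diff_add)
    then have "integral {0..1} (\<lambda>t. (\<psi> k (pt t s) - (a * c + b * c'))\<^sup>2) \<le>
       integral {0..1} (\<lambda>t. 2 * a\<^sup>2 * (\<phi> k (pt t s) - c)\<^sup>2 + 2 * b\<^sup>2 * (\<phi>' k (pt t s) - c')\<^sup>2)"
      by (intro integral_le integrable_continuous_interval continuous_intros continuous_edge[OF s] continuous_edge[OF 1(2)] continuous_edge[OF 2(2)])
    also have "\<dots> = 2 * a\<^sup>2 * integral {0..1} (\<lambda>t. (\<phi> k (pt t s) - c)\<^sup>2) + 2 * b\<^sup>2 * integral {0..1} (\<lambda>t. (\<phi>' k (pt t s) - c')\<^sup>2)"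
      by (subst Henstock_Kurzweil_Integration.integral_add)
         (auto intro!: integrable_continuous_interval continuous_intros continuous_edge[OF 1(2)] continuous_edge[OF 2(2)])
    finally show "norm (integral {0..1} (\<lambda>t. (\<psi> k (pt t s) - (a * c + b * c'))\<^sup>2)) \<le>
       2 * a\<^sup>2 * integral {0..1} (\<lambda>t. (\<phi> k (pt t s) - c)\<^sup>2) + 2 * b\<^sup>2 * integral {0..1} (\<lambda>t. (\<phi>' k (pt t s) - c')\<^sup>2)"
      by (subst real_norm_def, subst abs_of_nonneg)
         (auto intro!: integral_nonneg integrable_continuous_interval continuous_intros continuous_edge[OF s])
  qed
  moreover have "L2_lim \<psi> (\<lambda>x. a * f x + b * f' x)"
    unfolding \<psi>_def by (intro L2_lim_add L2_lim_cmult 1 2)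
  moreover have "L2_lim (\<lambda>k. partial j (\<psi> k)) (\<lambda>x. (a *\<^sub>R G x + b *\<^sub>R G' x) $ j)" for j
    unfolding part[abs_def] vector_add_component vector_scaleR_component real_scaleR_def
    by (intro L2_lim_add L2_lim_cmult 1 2)
  ultimately show ?thesis
    unfolding has_trace_const_iff using weak_gradient_lincomb[OF 1(1) 2(1), of a b] s by blast
qed

section \<open>Displacement fields\<close>

lemma weak_jacobian_lincomb:
  assumes "weak_jacobian u G" "weak_jacobian v H"
  shows "weak_jacobian (\<lambda>x. a *\<^sub>R u x + b *\<^sub>R v x) (\<lambda>x. a *\<^sub>R G x + b *\<^sub>R H x)"
  unfolding weak_jacobian_def
proof
  fix i
  show "weak_gradient (\<lambda>x. (a *\<^sub>R u x + b *\<^sub>R v x) $ i) (\<lambda>x. (a *\<^sub>R G x + b *\<^sub>R H x) $ i)"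
    using weak_gradient_lincomb[of "\<lambda>x. u x $ i" "\<lambda>x. G x $ i" "\<lambda>x. v x $ i" "\<lambda>x. H x $ i" a b] assms
    by (simp add: weak_jacobian_def)
qed

lemma weak_jacobian_Jac: "u \<in> H1 \<Longrightarrow> weak_jacobian u (Jac u)"
  unfolding H1_def Jac_def by (auto simp: some_eq_ex intro: someI)

lemma weak_jacobian_H1: "weak_jacobian u G \<Longrightarrow> u \<in> H1"
  by (auto simp: H1_def)

text \<open>The choice made in the definition of \<^const>\<open>Jac\<close> matters on a null set only.\<close>

lemma Jac_AE:
  assumes "weak_jacobian u G" shows "AE x in LO. Jac u x = G x"
proof -
  have "weak_jacobian u (Jac u)" using weak_jacobian_Jac weak_jacobian_H1[OF assms] by blast
  then have "AE x in LO. Jac u x $ i = G x $ i" for i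
    using assms weak_gradient_unique unfolding weak_jacobian_def by blast
  from this[of 1] this[of 2] show ?thesis
    by eventually_elim (simp add: vec_eq_iff forall_2)
qed

lemma weak_jacobian_L2:
  assumes "weak_jacobian u G" shows "(\<lambda>x. u x $ i) \<in> L2" "(\<lambda>x. G x $ i $ j) \<in> L2"
  using assms weak_gradientD(1,2) unfolding weak_jacobian_def by blast+

lemma Jac_L2: "u \<in> H1 \<Longrightarrow> (\<lambda>x. Jac u x $ i $ j) \<in> L2"
  using weak_jacobian_L2(2)[OF weak_jacobian_Jac] .

lemma Jac_lincomb:
  assumes "u \<in> H1" "v \<in> H1"
  shows "(\<lambda>x. a *\<^sub>R u x + b *\<^sub>R v x) \<in> H1"
    and "AE x in LO. Jac (\<lambda>x. a *\<^sub>R u x + b *\<^sub>R v x) x = a *\<^sub>R Jac u x + b *\<^sub>R Jac v x"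
proof -
  have *: "weak_jacobian (\<lambda>x. a *\<^sub>R u x + b *\<^sub>R v x) (\<lambda>x. a *\<^sub>R Jac u x + b *\<^sub>R Jac v x)"
    by (intro weak_jacobian_lincomb weak_jacobian_Jac assms)
  show "(\<lambda>x. a *\<^sub>R u x + b *\<^sub>R v x) \<in> H1" using * by (rule weak_jacobian_H1)
  show "AE x in LO. Jac (\<lambda>x. a *\<^sub>R u x + b *\<^sub>R v x) x = a *\<^sub>R Jac u x + b *\<^sub>R Jac v x"
    using * by (rule Jac_AE)
qed

lemma W_lincomb:
  assumes "u \<in> W l" "v \<in> W m" shows "(\<lambda>x. a *\<^sub>R u x + b *\<^sub>R v x) \<in> W (a * l + b * m)"
proof -
  have H: "u \<in> H1" "v \<in> H1" using assms by (auto simp: W_def)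
  have "(\<lambda>x. u x $ 1) \<in> L2" "(\<lambda>x. v x $ 1) \<in> L2"
    using weak_jacobian_L2(1)[OF weak_jacobian_Jac] H by blast+
  then have "(LINT x|LO. (a *\<^sub>R u x + b *\<^sub>R v x) $ 1) = a * (LINT x|LO. u x $ 1) + b * (LINT x|LO. v x $ 1)"
    by (simp add: L2_integrable)
  then show ?thesis
    using assms Jac_lincomb(1)[OF H, of a b] has_trace_lincomb[of 1 "\<lambda>x. u x $ 2" l "\<lambda>x. v x $ 2" m a b]
      has_trace_lincomb[of 0 "\<lambda>x. u x $ 2" 0 "\<lambda>x. v x $ 2" 0 a b]
    by (simp add: W_def)
qed

lemma W_diff: "u \<in> W l \<Longrightarrow> v \<in> W l \<Longrightarrow> (\<lambda>x. u x - v x) \<in> W 0"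
  using W_lincomb[of u l v l 1 "-1"] by simp

lemma Jac_diff:
  assumes "u \<in> H1" "v \<in> H1" shows "AE x in LO. Jac (\<lambda>x. u x - v x) x = Jac u x - Jac v x"
  using Jac_lincomb(2)[OF assms, of 1 "-1"] by simp

definition vfield :: "(real^2 \<Rightarrow> real) \<Rightarrow> (real^2 \<Rightarrow> real) \<Rightarrow> real^2 \<Rightarrow> real^2" where
  "vfield p q x = vector [p x, q x]"

definition vfield_jac :: "(real^2 \<Rightarrow> real) \<Rightarrow> (real^2 \<Rightarrow> real) \<Rightarrow> real^2 \<Rightarrow> real^2^2" where
  "vfield_jac p q x = vector [grad p x, grad q x]"

lemma weak_jacobian_vfield: "smooth p \<Longrightarrow> smooth q \<Longrightarrow> weak_jacobian (vfield p q) (vfield_jac p q)"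
  by (simp add: weak_jacobian_def vfield_def vfield_jac_def forall_2 weak_gradient_smooth)

lemma vfield_W:
  assumes "smooth p" "smooth q" "(LINT x|LO. p x) = 0" "\<And>t. q (pt t 1) = l" "\<And>t. q (pt t 0) = 0"
  shows "vfield p q \<in> W l"
  using weak_jacobian_H1[OF weak_jacobian_vfield[OF assms(1,2)]] assms
  by (simp add: W_def vfield_def has_trace_smooth)

section \<open>Fourier series on the square\<close>

text \<open>Cosines and sines are told apart by a truth value, so that differentiation negates it, up to a factor.\<close>

definition trig :: "bool \<Rightarrow> nat \<Rightarrow> real \<Rightarrow> real" where
  "trig b k t = (if b then cos (pi * real k * t) else sin (pi * real k * t))"

definition trig2 :: "bool \<Rightarrow> bool \<Rightarrow> nat \<Rightarrow> nat \<Rightarrow> real^2 \<Rightarrow> real" where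
  "trig2 a b j k x = trig a j (x$1) * trig b k (x$2)"

text \<open>The square of the norm in \<open>L\<^sup>2(0,1)\<close>; it is zero for the sine with \<open>k = 0\<close>.\<close>

definition trig_sq :: "bool \<Rightarrow> nat \<Rightarrow> real" where
  "trig_sq b k = (if k = 0 then if b then 1 else 0 else 1/2)"

lemma trig_sq_nonneg: "0 \<le> trig_sq b k" by (simp add: trig_sq_def)

definition trig_sgn :: "bool \<Rightarrow> real" where "trig_sgn b = (if b then -1 else 1)"

lemma trig_deriv: "(trig b k has_real_derivative trig_sgn b * (pi * real k) * trig (\<not> b) k t) (at t)"
  unfolding trig_def[abs_def] trig_sgn_def
  by (cases b) (auto intro!: derivative_eq_intros)

lemma continuous_trig: "continuous_on S (trig b k)"
  unfolding trig_def[abs_def] by (cases b) (auto intro!: continuous_intros)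

lemma smooth_trig1: "smooth (\<lambda>x. trig b k (x$i))"
  unfolding trig_def using smooth_trig[of "pi * real k" i] by (cases b) auto

lemma smooth_trig2: "smooth (trig2 a b j k)"
  unfolding trig2_def[abs_def] by (intro smooth_mult smooth_trig1)

lemma partial_trig2:
  "partial 1 (trig2 a b j k) x = trig_sgn a * (pi * real j) * trig2 (\<not> a) b j k x"
  "partial 2 (trig2 a b j k) x = trig_sgn b * (pi * real k) * trig2 a (\<not> b) j k x"
  unfolding trig2_def[abs_def]
  by (subst partial_mult; simp add: partial_coord[OF trig_deriv])+

lemma sin_pi_nat: "sin (pi * real k) = 0"
  using sin_npi2[of k] .

lemma cos_integral:
  assumes "m \<noteq> 0" shows "integral {0..1} (\<lambda>t. cos (pi * real_of_int m * t)) = 0"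
proof -
  have "sin (pi * real_of_int m) = 0"
    by (metis mult.commute sin_zero_iff_int2)
  moreover have "((\<lambda>t. cos (pi * real_of_int m * t)) has_integral
      (sin (pi * real_of_int m * 1) / (pi * real_of_int m) - sin (pi * real_of_int m * 0) / (pi * real_of_int m))) {0..1}"
    using assms
    by (intro fundamental_theorem_of_calculus)
       (auto intro!: derivative_eq_intros simp flip: has_real_derivative_iff_has_vector_derivative)
  ultimately show ?thesis by (simp add: integral_unique)
qed

lemma trig_orthogonal:
  "integral {0..1} (\<lambda>t. trig b j t * trig b k t) = (if j = k then trig_sq b k else 0)"
proof -
  define c where "c m = integral {0..1} (\<lambda>t. cos (pi * real_of_int m * t))" for m
  have c: "c m = (if m = 0 then 1 else 0)" for m using cos_integral[of m] by (simp add: c_def)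
  define s where "s = (if b then 1 else -1 :: real)"
  have "trig b j t * trig b k t = 1/2 * (cos (pi * real_of_int (int j - int k) * t) + s * cos (pi * real_of_int (int j + int k) * t))" for t
    unfolding trig_def s_def
    by (cases b) (simp_all add: cos_times_cos sin_times_sin algebra_simps diff_divide_distrib add_divide_distrib)
  then have "integral {0..1} (\<lambda>t. trig b j t * trig b k t) =
     1/2 * integral {0..1} (\<lambda>t. cos (pi * real_of_int (int j - int k) * t) + s * cos (pi * real_of_int (int j + int k) * t))"
    by (simp only: integral_mult_right)
  also have "integral {0..1} (\<lambda>t. cos (pi * real_of_int (int j - int k) * t) + s * cos (pi * real_of_int (int j + int k) * t))
     = c (int j - int k) + s * c (int j + int k)"
    unfolding c_def by (subst Henstock_Kurzweil_Integration.integral_add)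
      (auto intro!: integrable_continuous_interval continuous_intros simp: integral_mult_right simp del: of_int_diff of_int_add)
  finally show ?thesis unfolding c by (auto simp: s_def trig_sq_def)
qed

lemma LINT_product:
  fixes f g :: "real \<Rightarrow> real"
  assumes "continuous_on UNIV f" "continuous_on UNIV g"
  shows "(LINT x|LO. f (x$1) * g (x$2)) = integral {0..1} f * integral {0..1} g"
proof -
  have "continuous_on UNIV (\<lambda>x::real^2. f (x$1) * g (x$2))"
    by (intro continuous_on_mult continuous_on_compose2[OF assms(1)] continuous_on_compose2[OF assms(2)] continuous_intros) auto
  from LINT_Omega_iterated[OF this] show ?thesis
    by (simp add: integral_mult_right integral_mult_left)
qed

lemma trig2_orthogonal:
  "(LINT x|LO. trig2 a b j k x * trig2 a b j' k' x) = (if (j, k) = (j', k') then trig_sq a j' * trig_sq b k' else 0)"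
proof -
  have "(LINT x|LO. trig2 a b j k x * trig2 a b j' k' x) =
    (LINT x|LO. (trig a j (x$1) * trig a j' (x$1)) * (trig b k (x$2) * trig b k' (x$2)))"
    by (simp add: trig2_def mult_ac)
  also have "\<dots> = integral {0..1} (\<lambda>t. trig a j t * trig a j' t) * integral {0..1} (\<lambda>t. trig b k t * trig b k' t)"
    by (intro LINT_product continuous_intros continuous_trig)
  finally show ?thesis by (auto simp: trig_orthogonal)
qed

text \<open>By Bessel's inequality the partial sums form a Cauchy sequence. Their limit has the same coefficients
  as \<open>f\<close>, hence equals \<open>f\<close> by totality. The elements may have norm zero: by the convention
  \<open>x / 0 = 0\<close> their coefficient is then zero.\<close>

lemma orthogonal_expansion:
  fixes e :: "'i \<Rightarrow> real^2 \<Rightarrow> real"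
  assumes eL2: "\<And>i. e i \<in> L2"
    and ortho: "\<And>i i'. (LINT x|LO. e i x * e i' x) = (if i = i' then g i' else 0)"
    and A: "\<And>n. finite (A n)" "\<And>m n. m \<le> n \<Longrightarrow> A m \<subseteq> A n" "(\<Union>n. A n) = UNIV"
    and total: "\<And>h. h \<in> L2 \<Longrightarrow> (\<And>i. (LINT x|LO. h x * e i x) = 0) \<Longrightarrow> AE x in LO. h x = 0"
    and f: "f \<in> L2"
  shows "L2_lim (\<lambda>n x. \<Sum>i\<in>A n. (LINT y|LO. f y * e i y) / g i * e i x) f"
proof -
  define c where "c i = (LINT y|LO. f y * e i y) / g i" for i
  define S where "S n x = (\<Sum>i\<in>A n. c i * e i x)" for n x
  define T where "T n = (\<Sum>i\<in>A n. (c i)\<^sup>2 * g i)" for n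
  have g: "g i = (L2_norm (e i))\<^sup>2" for i
    unfolding L2_norm_sq unfolding power2_eq_square using ortho[of i i] by simp
  then have g0: "g i \<ge> 0" for i by simp
  have cg: "(LINT y|LO. f y * e i y) = c i * g i" for i
  proof (cases "g i = 0")
    case True
    then have "L2_norm (e i) = 0" by (simp add: g)
    then show ?thesis using True L2_Cauchy_Schwarz[OF f eL2[of i]] by simp
  qed (simp add: c_def)
  have ip_sum: "(LINT x|LO. h x * (\<Sum>i\<in>B. d i * e i x)) = (\<Sum>i\<in>B. d i * (LINT x|LO. h x * e i x))"
    if "h \<in> L2" for h d and B :: "'i set"
    by (simp add: sum_distrib_left mult.left_commute[of "h _"] L2_mult_integrable that eL2)
  have SumL2: "(\<lambda>x. \<Sum>i\<in>B. d i * e i x) \<in> L2" for d and B :: "'i set"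
    by (intro L2_intros eL2)
  have ip_e: "(LINT x|LO. (\<Sum>i\<in>B. d i * e i x) * e i' x) = (if i' \<in> B then d i' * g i' else 0)" if "finite B" for B d i'
  proof -
    have "(LINT x|LO. (\<Sum>i\<in>B. d i * e i x) * e i' x) = (LINT x|LO. e i' x * (\<Sum>i\<in>B. d i * e i x))"
      by (simp add: mult.commute)
    also have "\<dots> = (\<Sum>i\<in>B. d i * (if i' = i then g i else 0))"
      by (simp add: ip_sum eL2 ortho)
    finally show ?thesis using that by (simp add: sum.delta' if_distrib cong: if_cong)
  qed
  have sumsq: "(LINT x|LO. (\<Sum>i\<in>B. d i * e i x)\<^sup>2) = (\<Sum>i\<in>B. (d i)\<^sup>2 * g i)" if "finite B" for B d
    unfolding power2_eq_square ip_sum[OF SumL2] ip_e[OF that] by (simp add: mult.assoc)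
  have Bessel: "T n \<le> (LINT x|LO. (f x)\<^sup>2)" for n
  proof -
    have SL: "S n \<in> L2" unfolding S_def by (rule SumL2)
    have "0 \<le> (LINT x|LO. (f x - S n x)\<^sup>2)" by simp
    also have "\<dots> = (LINT x|LO. (f x)\<^sup>2 - 2 * (f x * S n x) + (S n x)\<^sup>2)"
      by (simp add: power2_diff algebra_simps)
    also have "\<dots> = (LINT x|LO. (f x)\<^sup>2) - 2 * (LINT x|LO. f x * S n x) + (LINT x|LO. (S n x)\<^sup>2)"
      using L2_mult_integrable[OF f SL] by (simp add: L2_square_integrable f SL)
    also have "(LINT x|LO. (S n x)\<^sup>2) = T n" unfolding S_def T_def by (rule sumsq[OF A(1)])
    also have "(LINT x|LO. f x * S n x) = T n"
      unfolding S_def T_def by (simp add: ip_sum[OF f] cg power2_eq_square mult.assoc)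
    finally show ?thesis by simp
  qed
  have inc: "incseq T"
    unfolding incseq_def T_def by (auto intro!: sum_mono2 mult_nonneg_nonneg A g0)
  then obtain L where "T \<longlonglongrightarrow> L" using incseq_convergent[of T] Bessel by blast
  then have "convergent T" by (rule convergentI)
  then have Tc: "Cauchy T" by (rule convergent_Cauchy)
  have dist: "(L2_norm (\<lambda>x. S m x - S n x))\<^sup>2 = T m - T n" if "n \<le> m" for m n
  proof -
    have eq: "S m x - S n x = (\<Sum>i\<in>A m - A n. c i * e i x)" for x
      unfolding S_def using A(2)[OF that] A(1) by (simp add: sum_diff)
    show ?thesis unfolding L2_norm_sq eq T_def sumsq[OF finite_Diff[OF A(1)]]
      using A(2)[OF that] A(1) by (simp add: sum_diff)
  qed
  obtain h where h: "L2_lim S h"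
  proof (rule L2_complete[of S])
    show "S n \<in> L2" for n unfolding S_def by (rule SumL2)
    fix r :: real assume "r > 0"
    then obtain N where N: "\<And>m n. m \<ge> N \<Longrightarrow> n \<ge> N \<Longrightarrow> \<bar>T m - T n\<bar> < r\<^sup>2"
      using Tc unfolding Cauchy_def dist_real_def by (meson zero_less_power)
    have "L2_norm (\<lambda>x. S m x - S n x) < r" if "m \<ge> N" "n \<ge> N" "n \<le> m" for m n
      by (rule power2_less_imp_less) (use dist[OF that(3)] N[OF that(1,2)] \<open>r > 0\<close> in auto)
    then have "L2_norm (\<lambda>x. S m x - S n x) < r" if "m \<ge> N" "n \<ge> N" for m n
      using that L2_norm_minus_commute[of "S m" "S n"] by (metis nat_le_linear)
    then show "\<exists>N. \<forall>m\<ge>N. \<forall>n\<ge>N. L2_norm (\<lambda>x. S m x - S n x) < r" by blast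
  qed
  have hL2: "h \<in> L2" using h by (simp add: L2_lim_def)
  have "AE x in LO. f x - h x = 0"
  proof (rule total)
    show "(\<lambda>x. f x - h x) \<in> L2" using f hL2 by (rule L2_diff)
    fix i
    obtain N where N: "i \<in> A N" using A(3) by auto
    have "(\<lambda>n. LINT x|LO. S n x * e i x) \<longlonglongrightarrow> (LINT x|LO. h x * e i x)"
      by (rule L2_lim_ip[OF h eL2])
    moreover have "\<forall>\<^sub>F n in sequentially. (LINT x|LO. S n x * e i x) = c i * g i"
      using A(2)[of N] N by (auto simp: eventually_sequentially S_def ip_e[OF A(1)] intro!: exI[of _ N])
    ultimately have "(\<lambda>n. c i * g i) \<longlonglongrightarrow> (LINT x|LO. h x * e i x)"
      by (rule Lim_transform_eventually)
    then have "(LINT x|LO. h x * e i x) = c i * g i" by (simp add: LIMSEQ_const_iff)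
    then show "(LINT x|LO. (f x - h x) * e i x) = 0"
      using cg[of i] by (simp add: left_diff_distrib L2_mult_integrable f hL2 eL2)
  qed
  then have AE: "AE x in LO. f x = h x" by eventually_elim simp
  have "L2_norm (\<lambda>x. S n x - f x) = L2_norm (\<lambda>x. S n x - h x)" for n
  proof (rule L2_norm_cong_AE)
    show "AE x in LO. S n x - f x = S n x - h x" using AE by eventually_elim simp
    show "(\<lambda>x. S n x - f x) \<in> borel_measurable LO" "(\<lambda>x. S n x - h x) \<in> borel_measurable LO"
      using h f by (auto simp: L2_lim_def intro!: L2_measurable L2_diff)
  qed
  then have "L2_lim S f" using h f by (simp add: L2_lim_def)
  then show ?thesis by (simp add: S_def[abs_def] c_def)
qed

subsection \<open>Totality\<close>

text \<open>The span of the products of cosines. By the addition theorem it is an algebra, which makes the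
  Stone--Weierstrass theorem applicable.\<close>

inductive cospoly :: "(real^2 \<Rightarrow> real) \<Rightarrow> bool" where
  base: "cospoly (\<lambda>x. c * trig2 True True j k x)"
| add: "cospoly f \<Longrightarrow> cospoly g \<Longrightarrow> cospoly (\<lambda>x. f x + g x)"

lemma cospoly_smooth: "cospoly f \<Longrightarrow> smooth f"
  by (induction rule: cospoly.induct) (auto intro: smooth_add smooth_cmult smooth_trig2)

lemma trig_cos_mult:
  "trig True j t * trig True k t = 1/2 * trig True (j + k) t + 1/2 * trig True (if j \<le> k then k - j else j - k) t"
proof -
  have "cos (pi * real j * t - pi * real k * t) = trig True (if j \<le> k then k - j else j - k) t"
    using cos_minus[of "pi * real j * t - pi * real k * t"]
    by (auto simp: trig_def of_nat_diff algebra_simps)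
  then show ?thesis by (simp add: trig_def cos_times_cos algebra_simps add_divide_distrib)
qed

lemma cospoly_mult: "cospoly f \<Longrightarrow> cospoly g \<Longrightarrow> cospoly (\<lambda>x. f x * g x)"
proof (induction arbitrary: g rule: cospoly.induct)
  case (base c j k)
  from base.prems show ?case
  proof (induction rule: cospoly.induct)
    case (base d j' k')
    define m where "m = (if j \<le> j' then j' - j else j - j')"
    define n where "n = (if k \<le> k' then k' - k else k - k')"
    have eq: "c * trig2 True True j k x * (d * trig2 True True j' k' x) =
        (c*d/4 * trig2 True True (j+j') (k+k') x + c*d/4 * trig2 True True (j+j') n x)
      + (c*d/4 * trig2 True True m (k+k') x + c*d/4 * trig2 True True m n x)" for x
    proof -
      have "c * trig2 True True j k x * (d * trig2 True True j' k' x) =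
        c * d * (trig True j (x$1) * trig True j' (x$1)) * (trig True k (x$2) * trig True k' (x$2))"
        by (simp add: trig2_def)
      also have "\<dots> = c * d * (1/2 * trig True (j+j') (x$1) + 1/2 * trig True m (x$1)) * (1/2 * trig True (k+k') (x$2) + 1/2 * trig True n (x$2))"
        by (simp only: trig_cos_mult m_def n_def)
      finally show ?thesis by (simp add: trig2_def algebra_simps)
    qed
    show ?case unfolding eq by (intro cospoly.intros)
  next
    case (add f g)
    then show ?case unfolding distrib_left by (intro cospoly.add)
  qed
next
  case (add f f')
  then show ?case unfolding distrib_right by (intro cospoly.add)
qed

lemma cospoly_const: "cospoly (\<lambda>_. c)"
  using cospoly.base[of c 0 0] by (simp add: trig2_def trig_def)

text \<open>Cosine polynomials approximate smooth functions uniformly on the closed square, so \<open>f\<close> is orthogonal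
  to every smooth function.\<close>

lemma cos_total:
  assumes f: "f \<in> L2" and ortho: "\<And>j k. (LINT x|LO. f x * trig2 True True j k x) = 0"
  shows "AE x in LO. f x = 0"
proof (rule fundamental_lemma_smooth[OF f])
  fix p assume p: "smooth p"
  have R: "function_ring_on (Collect cospoly) (cbox 0 (1::real^2))"
  proof
    show "\<exists>f\<in>Collect cospoly. f x \<noteq> f y" if "x \<in> cbox 0 1" "y \<in> cbox 0 1" "x \<noteq> y" for x y :: "real^2"
    proof (rule ccontr)
      assume "\<not> ?thesis"
      then have eq: "g x = g y" if "cospoly g" for g using that by auto
      have c: "cos (pi * x$i) = cos (pi * y$i)" for i
        using exhaust_2[of i] eq[OF cospoly.base[of 1 1 0]] eq[OF cospoly.base[of 1 0 1]]
        by (auto simp: trig2_def trig_def)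
      have "0 \<le> x$i" "x$i \<le> 1" "0 \<le> y$i" "y$i \<le> 1" for i
        using that(1,2) unfolding mem_box_cart by (simp_all only: zero_index one_index)
      then have b: "0 \<le> pi * x$i" "pi * x$i \<le> pi" "0 \<le> pi * y$i" "pi * y$i \<le> pi" for i
        by (simp_all add: mult_left_le)
      have "pi * x$i = pi * y$i" for i
        using cos_inj_pi[OF b(1,2)[of i] b(3,4)[of i] c[of i]] .
      then have "x = y" by (simp add: vec_eq_iff)
      with that show False by simp
    qed
  qed (auto intro: cospoly.add cospoly_mult cospoly_const smooth_continuous cospoly_smooth)
  have 0: "(LINT x|LO. f x * g x) = 0" if "cospoly g" for g
    using that
  proof induction
    case (base c j k)
    then show ?case using ortho[of j k] by (simp add: mult.left_commute)
  next
    case (add g h)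
    then show ?case
      by (simp add: distrib_left L2_mult_integrable f L2_smooth cospoly_smooth)
  qed
  show "(LINT x|LO. f x * p x) = 0"
  proof (rule ccontr)
    define M where "M = (LINT x|LO. \<bar>f x\<bar>)"
    assume a: "(LINT x|LO. f x * p x) \<noteq> 0"
    have M: "M \<ge> 0" unfolding M_def by (rule Bochner_Integration.integral_nonneg) simp
    define e where "e = \<bar>LINT x|LO. f x * p x\<bar> / (M + 1)"
    have "e > 0" using a M by (simp add: e_def)
    from function_ring_on.Stone_Weierstrass_basic[OF R smooth_continuous[OF p] this]
    obtain g where "g \<in> Collect cospoly" and ge: "\<forall>x\<in>cbox 0 1. \<bar>p x - g x\<bar> < e" by blast
    then have g: "cospoly g" "\<And>x. x \<in> cbox 0 1 \<Longrightarrow> \<bar>p x - g x\<bar> < e" by simp_all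
    have pg: "(\<lambda>x. p x - g x) \<in> L2" by (intro L2_diff L2_smooth p cospoly_smooth g)
    have "\<bar>LINT x|LO. f x * p x\<bar> = \<bar>LINT x|LO. f x * (p x - g x)\<bar>"
      using 0[OF g(1)] by (simp add: right_diff_distrib L2_mult_integrable f L2_smooth p cospoly_smooth g(1))
    also have "\<dots> \<le> (LINT x|LO. \<bar>f x * (p x - g x)\<bar>)" by (rule integral_abs_bound)
    also have "\<dots> \<le> (LINT x|LO. \<bar>f x\<bar> * e)"
    proof (rule integral_mono_AE)
      show "integrable LO (\<lambda>x. \<bar>f x * (p x - g x)\<bar>)" using L2_mult_integrable[OF f pg] by simp
      show "integrable LO (\<lambda>x. \<bar>f x\<bar> * e)" using L2_integrable[OF L2_abs[OF f]] by simp
      show "AE x in LO. \<bar>f x * (p x - g x)\<bar> \<le> \<bar>f x\<bar> * e"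
        using less_imp_le[OF g(2)] Omega_subset_cbox
        by (intro AE_LO_I) (auto simp: abs_mult simp del: less_imp_le intro!: mult_left_mono)
    qed
    also have "\<dots> = M * e" by (simp add: M_def)
    finally have "e * (M + 1) \<le> M * e" using M by (simp add: e_def)
    with \<open>e > 0\<close> show False by (simp add: algebra_simps)
  qed
qed

lemma sin_pi_pos: "0 < t \<Longrightarrow> t < 1 \<Longrightarrow> 0 < sin (pi * t)"
  by (rule sin_gt_zero) auto

lemma trig_sin_mult:
  "sin (pi * t) * trig True k t = (if k = 0 then trig False 1 t else 1/2 * trig False (k + 1) t - 1/2 * trig False (k - 1) t)"
proof (cases k)
  case (Suc n)
  have "sin (pi * t - pi * real k * t) = - trig False n t"
    by (simp add: trig_def Suc algebra_simps flip: sin_minus)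
  moreover have "sin (pi * t) * cos (pi * real k * t) = (sin (pi * t + pi * real k * t) + sin (pi * t - pi * real k * t)) / 2"
    by (rule sin_times_cos)
  ultimately show ?thesis by (simp add: trig_def Suc algebra_simps add_divide_distrib)
qed (simp add: trig_def)

definition trig_total :: "bool \<Rightarrow> bool \<Rightarrow> bool" where
  "trig_total a b \<longleftrightarrow> (\<forall>f\<in>L2. (\<forall>j k. (LINT x|LO. f x * trig2 a b j k x) = 0) \<longrightarrow> (AE x in LO. f x = 0))"

lemma trig2_L2: "trig2 a b j k \<in> L2" by (rule L2_smooth[OF smooth_trig2])

lemma mult_sin_total:
  assumes f: "f \<in> L2" and i: "i = 1 \<or> i = 2" and g: "AE x in LO. f x * sin (pi * x$i) = 0"
  shows "AE x in LO. f x = 0"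
proof -
  have "AE x in LO. sin (pi * x$i) \<noteq> 0"
    using i sin_pi_pos by (intro AE_LO_I) (force simp: Omega_def)
  with g show ?thesis by eventually_elim simp
qed

text \<open>The product of \<open>sin (\<pi> x\<^sub>1)\<close> with a cosine is a combination of sines. So if \<open>f\<close> is orthogonal to the
  sines, then \<open>f sin (\<pi> x\<^sub>1)\<close> is orthogonal to the cosines, and the factor is positive on the square.\<close>

lemma trig_total_sin1:
  assumes "trig_total True b" shows "trig_total False b"
  unfolding trig_total_def
proof (intro ballI impI)
  fix f :: "real^2 \<Rightarrow> real" assume f: "f \<in> L2" and o: "\<forall>j k. (LINT x|LO. f x * trig2 False b j k x) = 0"
  have "(\<lambda>x. sin (pi * x$1) * f x) \<in> L2"
    using smooth_trig(1)[of pi 1] by (intro L2_bounded_mult[where B=1] f smooth_measurable) auto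
  then have gL2: "(\<lambda>x. f x * sin (pi * x$1)) \<in> L2" by (simp add: mult.commute)
  have "(LINT x|LO. f x * sin (pi * x$1) * trig2 True b j k x) = 0" for j k
  proof (cases "j = 0")
    case True
    have eq: "f x * sin (pi * x$1) * trig2 True b j k x = f x * trig2 False b 1 k x" for x
      using trig_sin_mult[of "x$1" j] True by (simp add: trig2_def)
    show ?thesis unfolding eq using o by blast
  next
    case False
    have "f x * sin (pi * x$1) * trig2 True b j k x = 1/2 * (f x * trig2 False b (j+1) k x) - 1/2 * (f x * trig2 False b (j-1) k x)" for x
    proof -
      have "f x * sin (pi * x$1) * trig2 True b j k x = f x * (sin (pi * x$1) * trig True j (x$1)) * trig b k (x$2)"
        by (simp add: trig2_def)
      then show ?thesis unfolding trig_sin_mult using False by (simp add: trig2_def algebra_simps)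
    qed
    then show ?thesis using o by (simp add: L2_mult_integrable f trig2_L2)
  qed
  then have "AE x in LO. f x * sin (pi * x$1) = 0"
    using assms[unfolded trig_total_def, rule_format, OF gL2] by simp
  then show "AE x in LO. f x = 0" using mult_sin_total[OF f] by blast
qed

lemma trig_total_sin2:
  assumes "trig_total a True" shows "trig_total a False"
  unfolding trig_total_def
proof (intro ballI impI)
  fix f :: "real^2 \<Rightarrow> real" assume f: "f \<in> L2" and o: "\<forall>j k. (LINT x|LO. f x * trig2 a False j k x) = 0"
  have "(\<lambda>x. sin (pi * x$2) * f x) \<in> L2"
    using smooth_trig(1)[of pi 2] by (intro L2_bounded_mult[where B=1] f smooth_measurable) auto
  then have gL2: "(\<lambda>x. f x * sin (pi * x$2)) \<in> L2" by (simp add: mult.commute)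
  have "(LINT x|LO. f x * sin (pi * x$2) * trig2 a True j k x) = 0" for j k
  proof (cases "k = 0")
    case True
    have eq: "f x * sin (pi * x$2) * trig2 a True j k x = f x * trig2 a False j 1 x" for x
      using trig_sin_mult[of "x$2" k] True by (simp add: trig2_def)
    show ?thesis unfolding eq using o by blast
  next
    case False
    have "f x * sin (pi * x$2) * trig2 a True j k x = 1/2 * (f x * trig2 a False j (k+1) x) - 1/2 * (f x * trig2 a False j (k-1) x)" for x
    proof -
      have "f x * sin (pi * x$2) * trig2 a True j k x = f x * (sin (pi * x$2) * trig True k (x$2)) * trig a j (x$1)"
        by (simp add: trig2_def)
      then show ?thesis unfolding trig_sin_mult using False by (simp add: trig2_def algebra_simps)
    qed
    then show ?thesis using o by (simp add: L2_mult_integrable f trig2_L2)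
  qed
  then have "AE x in LO. f x * sin (pi * x$2) = 0"
    using assms[unfolded trig_total_def, rule_format, OF gL2] by simp
  then show "AE x in LO. f x = 0" using mult_sin_total[OF f] by blast
qed

lemma trig_total: "trig_total a b"
proof -
  have "trig_total True True" using cos_total by (auto simp: trig_total_def)
  then show ?thesis by (cases a; cases b) (simp_all add: trig_total_sin1 trig_total_sin2)
qed

definition trigpoly :: "bool \<Rightarrow> bool \<Rightarrow> (nat \<Rightarrow> nat \<Rightarrow> real) \<Rightarrow> nat \<Rightarrow> real^2 \<Rightarrow> real" where
  "trigpoly a b c N x = (\<Sum>j\<le>N. \<Sum>k\<le>N. c j k * trig2 a b j k x)"

definition fourier :: "bool \<Rightarrow> bool \<Rightarrow> (real^2 \<Rightarrow> real) \<Rightarrow> nat \<Rightarrow> nat \<Rightarrow> real" where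
  "fourier a b f j k = (LINT x|LO. f x * trig2 a b j k x) / (trig_sq a j * trig_sq b k)"

lemma smooth_trigpoly: "smooth (trigpoly a b c N)"
  unfolding trigpoly_def[abs_def] by (intro smooth_sum smooth_cmult smooth_trig2)

lemma fourier_lim:
  assumes "f \<in> L2" shows "L2_lim (trigpoly a b (fourier a b f)) f"
proof -
  have "L2_lim (\<lambda>n x. \<Sum>i\<in>{..n}\<times>{..n}. (LINT y|LO. f y * trig2 a b (fst i) (snd i) y) / (trig_sq a (fst i) * trig_sq b (snd i)) * trig2 a b (fst i) (snd i) x) f"
  proof (rule orthogonal_expansion)
    show "(LINT x|LO. trig2 a b (fst i) (snd i) x * trig2 a b (fst i') (snd i') x) =
      (if i = i' then trig_sq a (fst i') * trig_sq b (snd i') else 0)" for i i'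
      by (simp add: trig2_orthogonal prod_eq_iff)
    show "(\<Union>n. {..n} \<times> {..n}) = (UNIV :: (nat \<times> nat) set)"
      by (auto intro: max.cobounded1 max.cobounded2)
    show "AE x in LO. h x = 0" if "h \<in> L2" "\<And>i. (LINT x|LO. h x * trig2 a b (fst i) (snd i) x) = 0" for h
      using that(1) that(2)[of "(_, _)"] trig_total[of a b] by (simp add: trig_total_def)
  qed (auto intro: trig2_L2 assms)
  then show ?thesis
    by (simp add: trigpoly_def[abs_def] fourier_def sum.cartesian_product case_prod_beta)
qed

lemma partial_trigpoly:
  "partial 1 (trigpoly a b c N) x = trigpoly (\<not> a) b (\<lambda>j k. trig_sgn a * (pi * real j) * c j k) N x"
  "partial 2 (trigpoly a b c N) x = trigpoly a (\<not> b) (\<lambda>j k. trig_sgn b * (pi * real k) * c j k) N x"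
  unfolding trigpoly_def[abs_def]
  by (simp_all add: partial_sum smooth_sum smooth_cmult smooth_trig2 partial_cmult smooth_differentiable partial_trig2 mult_ac)

lemma trigpoly_cong: "(\<And>j k. c j k = d j k) \<Longrightarrow> trigpoly a b c = trigpoly a b d"
  by (intro ext) (simp add: trigpoly_def)

lemma sin_le_dist:
  assumes "0 < t" "t < 1" shows "\<bar>sin (pi * real k * t)\<bar> \<le> 2 * pi * real k * (t * (1 - t))"
proof (cases "t \<le> 1/2")
  case True
  have "\<bar>sin (pi * real k * t)\<bar> \<le> pi * real k * t" using abs_sin_x_le_abs_x[of "pi * real k * t"] assms by simp
  also have "\<dots> \<le> pi * real k * t * (2 * (1 - t))" using True assms mult_left_mono[of 1 "2 * (1 - t)" "pi * real k * t"] by simp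
  finally show ?thesis by (simp add: mult_ac)
next
  case False
  have "sin (pi * real k * t) = sin (pi * real k - pi * real k * (1 - t))" by (simp add: algebra_simps)
  also have "\<bar>\<dots>\<bar> = \<bar>sin (pi * real k * (1 - t))\<bar>" by (simp add: sin_diff sin_pi_nat cos_npi2 abs_mult)
  also have "\<dots> \<le> pi * real k * (1 - t)" using abs_sin_x_le_abs_x[of "pi * real k * (1 - t)"] assms by simp
  also have "\<dots> \<le> pi * real k * (1 - t) * (2 * t)" using False assms mult_left_mono[of 1 "2 * t" "pi * real k * (1 - t)"] by simp
  finally show ?thesis by (simp add: mult_ac)
qed

lemma abs_trig_le: "\<bar>trig b k t\<bar> \<le> 1" by (simp add: trig_def)

text \<open>There are no boundary terms because the sine vanishes at both end points.\<close>

lemma fourier_by_parts: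
  assumes "weak_gradient f g"
  shows "(LINT x|LO. g x $ 1 * trig2 False b j k x) = - (pi * real j) * (LINT x|LO. f x * trig2 True b j k x)"
    and "(LINT x|LO. g x $ 2 * trig2 a False j k x) = - (pi * real k) * (LINT x|LO. f x * trig2 a True j k x)"
proof -
  have "(LINT x|LO. g x $ 1 * trig2 False b j k x) = - (LINT x|LO. f x * partial 1 (trig2 False b j k) x)"
  proof (rule weak_gradient_by_parts[OF assms smooth_trig2])
    show "\<bar>trig2 False b j k x\<bar> \<le> 2 * pi * real j * (x$1 * (1 - x$1))" if "x \<in> Omega" for x
      using mult_mono[OF sin_le_dist[of "x$1" j] abs_trig_le[of b k "x$2"]] that
      by (simp add: trig2_def trig_def[of False] abs_mult Omega_def)
  qed
  then show "(LINT x|LO. g x $ 1 * trig2 False b j k x) = - (pi * real j) * (LINT x|LO. f x * trig2 True b j k x)"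
    by (simp add: partial_trig2 trig_sgn_def mult.left_commute[of "f _"])
  have "(LINT x|LO. g x $ 2 * trig2 a False j k x) = - (LINT x|LO. f x * partial 2 (trig2 a False j k) x)"
  proof (rule weak_gradient_by_parts[OF assms smooth_trig2])
    show "\<bar>trig2 a False j k x\<bar> \<le> 2 * pi * real k * (x$2 * (1 - x$2))" if "x \<in> Omega" for x
      using mult_mono[OF abs_trig_le[of a j "x$1"] sin_le_dist[of "x$2" k]] that
      by (simp add: trig2_def trig_def[of False] abs_mult Omega_def)
  qed
  then show "(LINT x|LO. g x $ 2 * trig2 a False j k x) = - (pi * real k) * (LINT x|LO. f x * trig2 a True j k x)"
    by (simp add: partial_trig2 trig_sgn_def mult.left_commute[of "f _"])
qed

lemma trig_sq_flip: "k \<noteq> 0 \<Longrightarrow> trig_sq b k = trig_sq (\<not> b) k"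
  by (simp add: trig_sq_def)

text \<open>Cosine series may be differentiated term by term: the differentiated partial sums are the partial
  sums of the sine series of the weak derivative.\<close>

lemma fourier_gradient_lim:
  assumes wg: "weak_gradient f g"
  shows "L2_lim (\<lambda>N. partial 1 (trigpoly True b (fourier True b f) N)) (\<lambda>x. g x $ 1)"
    and "L2_lim (\<lambda>N. partial 2 (trigpoly a True (fourier a True f) N)) (\<lambda>x. g x $ 2)"
proof -
  have "trig_sgn True * (pi * real j) * fourier True b f j k = fourier False b (\<lambda>x. g x $ 1) j k" for j k
    unfolding fourier_def fourier_by_parts(1)[OF wg] trig_sgn_def trig_sq_def by simp
  note * = trigpoly_cong[OF this]
  show "L2_lim (\<lambda>N. partial 1 (trigpoly True b (fourier True b f) N)) (\<lambda>x. g x $ 1)"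
    unfolding partial_trigpoly[abs_def] * not_True_eq_False eta_contract_eq
    by (rule fourier_lim) (rule weak_gradientD(2)[OF wg])
  have "trig_sgn True * (pi * real k) * fourier a True f j k = fourier a False (\<lambda>x. g x $ 2) j k" for j k
    unfolding fourier_def fourier_by_parts(2)[OF wg] trig_sgn_def trig_sq_def by simp
  note * = trigpoly_cong[OF this]
  show "L2_lim (\<lambda>N. partial 2 (trigpoly a True (fourier a True f) N)) (\<lambda>x. g x $ 2)"
    unfolding partial_trigpoly[abs_def] * not_True_eq_False eta_contract_eq
    by (rule fourier_lim) (rule weak_gradientD(2)[OF wg])
qed

text \<open>For sine series in the second coordinate the boundary terms vanish because of the traces.\<close>

lemma fourier_gradient_lim_trace:
  assumes wg: "weak_gradient f g" and tr: "has_trace 1 f (\<lambda>_. 0)" "has_trace 0 f (\<lambda>_. 0)"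
  shows "L2_lim (\<lambda>N. partial 2 (trigpoly a False (fourier a False f) N)) (\<lambda>x. g x $ 2)"
proof -
  have "(LINT x|LO. g x $ 2 * trig2 a True j k x) = pi * real k * (LINT x|LO. f x * trig2 a False j k x)" for j k
    using trace_by_parts[OF tr wg smooth_trig2[of a True j k]]
    by (simp add: partial_trig2 trig_sgn_def mult.left_commute[of "f _"])
  then have "trig_sgn False * (pi * real k) * fourier a False f j k = fourier a True (\<lambda>x. g x $ 2) j k" for j k
    unfolding fourier_def trig_sgn_def trig_sq_def by simp
  note * = trigpoly_cong[OF this]
  show ?thesis
    unfolding partial_trigpoly[abs_def] * not_False_eq_True
    by (rule fourier_lim) (rule weak_gradientD(2)[OF wg])
qed

section \<open>Korn's inequality\<close>

lemma weighted_young: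
  fixes \<theta> u v :: real
  assumes "\<bar>\<theta>\<bar> \<le> 1" shows "- (u\<^sup>2/4 + v\<^sup>2) \<le> \<theta> * (u * v)"
proof -
  have "\<bar>\<theta> * (u * v)\<bar> \<le> \<bar>u * v\<bar>" using assms by (simp add: abs_mult mult_left_le_one_le)
  also have "\<dots> \<le> u\<^sup>2/4 + v\<^sup>2"
    using zero_le_power2[of "u/2 - v"] zero_le_power2[of "u/2 + v"]
    by (simp add: power2_eq_square algebra_simps abs_le_iff)
  finally show ?thesis by linarith
qed

text \<open>A lower bound for the derivative of the function \<open>\<Phi>\<close> in the next proof. There \<open>S\<close> and \<open>c\<close> are a sine
  and a cosine, \<open>X\<close> is the quantity to be estimated, and \<open>a\<close>, \<open>Y\<close>, \<open>g\<close> are the three strains. The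
  square of \<open>X\<close> enters with the factor \<open>(1 - 2 S\<^sup>2) + 2 S\<^sup>2 = 1\<close>; the products cost at most three
  quarters of it.\<close>

lemma korn_pointwise:
  fixes S c X Y a g :: real
  assumes "S\<^sup>2 + c\<^sup>2 = 1"
  shows "X\<^sup>2/4 - 5 * (a\<^sup>2 + Y\<^sup>2 + g\<^sup>2) \<le>
    (1 - 2 * S\<^sup>2) * X\<^sup>2 + 2 * S * c * (X * a) + 4 * S * c * (X * Y) + 2 * S\<^sup>2 * (a * Y) + 2 * S\<^sup>2 * (X * (g + X))"
proof -
  have P: "\<bar>2 * S * c\<bar> \<le> 1"
    using zero_le_power2[of "S - c"] zero_le_power2[of "S + c"] assms
    by (simp add: power2_eq_square algebra_simps abs_le_iff)
  have Q: "\<bar>S\<^sup>2\<bar> \<le> 1" using assms zero_le_power2[of c] zero_le_power2[of S] unfolding abs_le_iff by linarith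
  have 1: "- (X\<^sup>2/4 + a\<^sup>2) \<le> 2 * S * c * (X * a)" by (rule weighted_young[OF P])
  have 2: "- (X\<^sup>2/4 + (2*Y)\<^sup>2) \<le> 2 * S * c * (X * (2*Y))" by (rule weighted_young[OF P])
  have 3: "- ((2*a)\<^sup>2/4 + Y\<^sup>2) \<le> S\<^sup>2 * (2 * a * Y)" by (rule weighted_young[OF Q])
  have 4: "- (X\<^sup>2/4 + (2*g)\<^sup>2) \<le> S\<^sup>2 * (X * (2 * g))" by (rule weighted_young[OF Q])
  have pos: "0 \<le> a\<^sup>2" "0 \<le> g\<^sup>2" by simp_all
  have eq: "(1 - 2 * S\<^sup>2) * X\<^sup>2 + 2 * S * c * (X * a) + 4 * S * c * (X * Y) + 2 * S\<^sup>2 * (a * Y) + 2 * S\<^sup>2 * (X * (g + X))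
     = X\<^sup>2 + 2 * S * c * (X * a) + 2 * S * c * (X * (2*Y)) + S\<^sup>2 * (2 * a * Y) + S\<^sup>2 * (X * (2 * g))"
    by (simp add: power2_eq_square algebra_simps)
  have sq: "(2*Y)\<^sup>2 = 4 * Y\<^sup>2" "(2*a)\<^sup>2/4 = a\<^sup>2" "(2*g)\<^sup>2 = 4 * g\<^sup>2" by (simp_all add: power_mult_distrib)
  have gen: "X2/4 - 5 * (a2 + Y2 + g2) \<le> X2 + t1 + t2 + t3 + t4"
    if "- (X2/4 + a2) \<le> t1" "- (X2/4 + 4 * Y2) \<le> t2" "- (a2 + Y2) \<le> t3" "- (X2/4 + 4 * g2) \<le> t4" "0 \<le> a2" "0 \<le> g2"
    for X2 a2 Y2 g2 t1 t2 t3 t4 :: real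
    using that by (simp add: algebra_simps)
  show ?thesis unfolding eq by (rule gen[OF 1 2[unfolded sq] 3[unfolded sq] 4[unfolded sq] pos])
qed

text \<open>Korn's inequality for the mode \<open>(A(s) cos \<kappa>t, B(s) sin \<kappa>t)\<close>, with a constant independent of
  \<open>\<kappa> = \<pi>k\<close>. The shear strain \<open>B' - \<kappa> A\<close> bounds \<open>A\<close> after an integration by parts that needs a weight
  vanishing at both ends; \<open>sin\<^sup>2 \<kappa>s\<close> is one. What the weight loses is \<open>cos 2\<kappa>s = 1 - 2 sin\<^sup>2 \<kappa>s\<close>, the
  derivative of \<open>sin 2\<kappa>s / 2\<kappa>\<close>, which vanishes at both ends as well and can be integrated by parts
  against \<open>A\<^sup>2\<close>.\<close>

lemma korn_mode:
  fixes A B A' B' :: "real \<Rightarrow> real" and k :: nat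
  defines "\<kappa> \<equiv> pi * real k"
  assumes A: "\<And>s. (A has_real_derivative A' s) (at s)" and B: "\<And>s. (B has_real_derivative B' s) (at s)"
    and cont: "continuous_on {0..1} A'" "continuous_on {0..1} B'"
  shows "integral {0..1} (\<lambda>s. (\<kappa> * A s)\<^sup>2) \<le>
    20 * (integral {0..1} (\<lambda>s. (A' s)\<^sup>2) + integral {0..1} (\<lambda>s. (\<kappa> * B s)\<^sup>2) + integral {0..1} (\<lambda>s. (B' s - \<kappa> * A s)\<^sup>2))"
proof -
  have cA: "continuous_on {0..1} A" and cB: "continuous_on {0..1} B"
    using A B by (meson DERIV_isCont continuous_at_imp_continuous_on)+
  (* The boundary terms of the two integrations by parts; they vanish at 0 and 1 because kappa is a multiple of pi. *)
  define \<Phi> where "\<Phi> s = \<kappa> * (sin (\<kappa> * s) * cos (\<kappa> * s)) * (A s)\<^sup>2 + 2 * \<kappa> * (sin (\<kappa> * s))\<^sup>2 * (A s * B s)" for s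
  define D where "D s = (1 - 2 * (sin (\<kappa> * s))\<^sup>2) * (\<kappa> * A s)\<^sup>2 + 2 * sin (\<kappa> * s) * cos (\<kappa> * s) * (\<kappa> * A s * A' s)
    + 4 * sin (\<kappa> * s) * cos (\<kappa> * s) * (\<kappa> * A s * (\<kappa> * B s)) + 2 * (sin (\<kappa> * s))\<^sup>2 * (A' s * (\<kappa> * B s))
    + 2 * (sin (\<kappa> * s))\<^sup>2 * (\<kappa> * A s * (B' s - \<kappa> * A s + \<kappa> * A s))" for s
  have der: "(\<Phi> has_real_derivative D s) (at s)" for s
  proof -
    have c2: "(cos (\<kappa> * s))\<^sup>2 = 1 - (sin (\<kappa> * s))\<^sup>2" by (simp add: cos_squared_eq)
    have der: "(\<Phi> has_real_derivative
       \<kappa> * ((\<kappa> * cos (\<kappa> * s)) * cos (\<kappa> * s) - sin (\<kappa> * s) * (\<kappa> * sin (\<kappa> * s))) * (A s)\<^sup>2 + \<kappa> * (sin (\<kappa> * s) * cos (\<kappa> * s)) * (2 * A s * A' s)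
      + (2 * \<kappa> * (2 * sin (\<kappa> * s) * (\<kappa> * cos (\<kappa> * s))) * (A s * B s) + 2 * \<kappa> * (sin (\<kappa> * s))\<^sup>2 * (A' s * B s + A s * B' s))) (at s)"
      unfolding \<Phi>_def[abs_def]
      by (rule derivative_eq_intros A B refl | simp add: algebra_simps)+
    have K: "\<kappa> * ((\<kappa> * cos (\<kappa> * s)) * cos (\<kappa> * s) - sin (\<kappa> * s) * (\<kappa> * sin (\<kappa> * s))) = \<kappa>\<^sup>2 * (1 - 2 * (sin (\<kappa> * s))\<^sup>2)"
    proof -
      have "\<kappa> * ((\<kappa> * cos (\<kappa> * s)) * cos (\<kappa> * s) - sin (\<kappa> * s) * (\<kappa> * sin (\<kappa> * s))) = \<kappa>\<^sup>2 * ((cos (\<kappa> * s))\<^sup>2 - (sin (\<kappa> * s))\<^sup>2)"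
        by (simp add: power2_eq_square algebra_simps)
      then show ?thesis by (simp add: c2)
    qed
    show ?thesis
      by (rule DERIV_cong[OF der[unfolded K]]) (simp add: D_def power2_eq_square algebra_simps)
  qed
  have "(D has_integral (\<Phi> 1 - \<Phi> 0)) {0..1}"
    by (rule fundamental_theorem_of_calculus)
       (auto intro!: has_field_derivative_at_within der simp flip: has_real_derivative_iff_has_vector_derivative)
  moreover have "\<Phi> 1 - \<Phi> 0 = 0" by (simp add: \<Phi>_def \<kappa>_def sin_pi_nat)
  ultimately have int0: "(D has_integral 0) {0..1}" by simp
  have le: "(\<kappa> * A s)\<^sup>2 / 4 - 5 * ((A' s)\<^sup>2 + (\<kappa> * B s)\<^sup>2 + (B' s - \<kappa> * A s)\<^sup>2) \<le> D s" for s
    unfolding D_def by (rule korn_pointwise) simp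
  have "integral {0..1} (\<lambda>s. (\<kappa> * A s)\<^sup>2 / 4 - 5 * ((A' s)\<^sup>2 + (\<kappa> * B s)\<^sup>2 + (B' s - \<kappa> * A s)\<^sup>2)) \<le> integral {0..1} D"
    by (intro integral_le le has_integral_integrable[OF int0] integrable_continuous_interval
        continuous_intros cA cB cont) simp
  also have "\<dots> = 0" using int0 by (rule integral_unique)
  also have "integral {0..1} (\<lambda>s. (\<kappa> * A s)\<^sup>2 / 4 - 5 * ((A' s)\<^sup>2 + (\<kappa> * B s)\<^sup>2 + (B' s - \<kappa> * A s)\<^sup>2))
     = integral {0..1} (\<lambda>s. (\<kappa> * A s)\<^sup>2) / 4 - 5 * (integral {0..1} (\<lambda>s. (A' s)\<^sup>2)
      + integral {0..1} (\<lambda>s. (\<kappa> * B s)\<^sup>2) + integral {0..1} (\<lambda>s. (B' s - \<kappa> * A s)\<^sup>2))"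
  proof -
    have i: "(\<lambda>s. (\<kappa> * A s)\<^sup>2) integrable_on {0..1}" "(\<lambda>s. (A' s)\<^sup>2) integrable_on {0..1}"
      "(\<lambda>s. (\<kappa> * B s)\<^sup>2) integrable_on {0..1}" "(\<lambda>s. (B' s - \<kappa> * A s)\<^sup>2) integrable_on {0..1}"
      by (intro integrable_continuous_interval continuous_intros cA cB cont)+
    note h = i[THEN integrable_integral]
    have "((\<lambda>s. (\<kappa> * A s)\<^sup>2 * (1/4) - 5 * ((A' s)\<^sup>2 + (\<kappa> * B s)\<^sup>2 + (B' s - \<kappa> * A s)\<^sup>2)) has_integral
      integral {0..1} (\<lambda>s. (\<kappa> * A s)\<^sup>2) * (1/4) - 5 * (integral {0..1} (\<lambda>s. (A' s)\<^sup>2)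
      + integral {0..1} (\<lambda>s. (\<kappa> * B s)\<^sup>2) + integral {0..1} (\<lambda>s. (B' s - \<kappa> * A s)\<^sup>2))) {0..1}"
      by (intro has_integral_diff has_integral_add has_integral_mult_right has_integral_mult_left h)
    then show ?thesis by (simp add: integral_unique)
  qed
  finally show ?thesis by linarith
qed

text \<open>Collecting the terms with a fixed frequency in the second coordinate leaves a function of the first.\<close>

definition mode :: "bool \<Rightarrow> (nat \<Rightarrow> nat \<Rightarrow> real) \<Rightarrow> nat \<Rightarrow> nat \<Rightarrow> real \<Rightarrow> real" where
  "mode a c N k s = (\<Sum>j\<le>N. c j k * trig a j s)"

lemma trigpoly_mode: "trigpoly a b c N x = (\<Sum>k\<le>N. mode a c N k (x$1) * trig b k (x$2))"
  unfolding trigpoly_def mode_def trig2_def sum_distrib_right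
  by (subst sum.swap) (simp add: mult.assoc)

lemma mode_cmult: "mode a (\<lambda>j k. r k * c j k) N k s = r k * mode a c N k s"
  by (simp add: mode_def sum_distrib_left mult.assoc)

lemma continuous_mode: "continuous_on S (mode a c N k)"
  unfolding mode_def[abs_def] by (intro continuous_intros continuous_trig)

lemma mode_deriv:
  "(mode a c N k has_real_derivative mode (\<not> a) (\<lambda>j k. trig_sgn a * (pi * real j) * c j k) N k s) (at s)"
  unfolding mode_def[abs_def]
  by (rule DERIV_cong[OF DERIV_sum[OF DERIV_cmult[OF trig_deriv]]]) (simp add: mult_ac)

lemma trig_integral_sq_sum:
  "integral {0..1} (\<lambda>t. (\<Sum>k\<le>N. c k * trig b k t)\<^sup>2) = (\<Sum>k\<le>N. trig_sq b k * (c k)\<^sup>2)"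
proof -
  have "(\<Sum>k\<le>N. c k * trig b k t)\<^sup>2 = (\<Sum>k\<le>N. \<Sum>k'\<le>N. c k * c k' * (trig b k t * trig b k' t))" for t
    unfolding power2_eq_square sum_product by (intro sum.cong refl) (simp add: mult_ac)
  then have "integral {0..1} (\<lambda>t. (\<Sum>k\<le>N. c k * trig b k t)\<^sup>2) =
     (\<Sum>k\<le>N. \<Sum>k'\<le>N. c k * c k' * integral {0..1} (\<lambda>t. trig b k t * trig b k' t))"
    by (simp add: integral_sum integrable_sum integrable_continuous_interval continuous_intros continuous_trig)
  also have "\<dots> = (\<Sum>k\<le>N. trig_sq b k * (c k)\<^sup>2)"
    by (intro sum.cong refl) (simp add: trig_orthogonal if_distrib sum.delta power2_eq_square cong: if_cong)
  finally show ?thesis .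
qed

text \<open>Parseval's identity in the second coordinate.\<close>

lemma LINT_mode_sum_sq:
  assumes f: "\<And>k. continuous_on UNIV (f k)"
  shows "(LINT x|LO. (\<Sum>k\<le>N. f k (x$1) * trig b k (x$2))\<^sup>2) = (\<Sum>k\<le>N. trig_sq b k * integral {0..1} (\<lambda>s. (f k s)\<^sup>2))"
proof -
  have cf: "continuous_on S (\<lambda>x. f k (g x))" if "continuous_on S g" for S and g :: "'a::topological_space \<Rightarrow> real" and k
    by (rule continuous_on_compose2[OF f that subset_UNIV])
  have ct: "continuous_on S (\<lambda>x. trig b k (g x))" if "continuous_on S g" for S and g :: "'a::topological_space \<Rightarrow> real" and k
    by (rule continuous_on_compose2[OF continuous_trig[of UNIV] that subset_UNIV])
  have "continuous_on UNIV (\<lambda>x::real^2. (\<Sum>k\<le>N. f k (x$1) * trig b k (x$2))\<^sup>2)"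
    by (intro continuous_intros cf ct)
  from LINT_Omega_iterated[OF this]
  have "(LINT x|LO. (\<Sum>k\<le>N. f k (x$1) * trig b k (x$2))\<^sup>2) = integral {0..1} (\<lambda>s. \<Sum>k\<le>N. trig_sq b k * (f k s)\<^sup>2)"
    by (simp add: trig_integral_sq_sum)
  also have "\<dots> = (\<Sum>k\<le>N. trig_sq b k * integral {0..1} (\<lambda>s. (f k s)\<^sup>2))"
    by (subst integral_sum) (auto intro!: integrable_continuous_interval continuous_intros continuous_on_subset[OF f])
  finally show ?thesis .
qed

lemma LINT_trigpoly_sq:
  "(LINT x|LO. (trigpoly a b c N x)\<^sup>2) = (\<Sum>k\<le>N. \<Sum>j\<le>N. trig_sq b k * (trig_sq a j * (c j k)\<^sup>2))"
  unfolding trigpoly_mode LINT_mode_sum_sq[OF continuous_mode]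
  unfolding mode_def trig_integral_sq_sum sum_distrib_left ..

lemma trig_sq_False_le: "trig_sq False k \<le> trig_sq True k" by (simp add: trig_sq_def)

lemma pi_nat_ge_1: "k \<noteq> 0 \<Longrightarrow> 1 \<le> (pi * real k)\<^sup>2"
proof -
  assume "k \<noteq> 0"
  then have "1 * 1 \<le> pi * real k" using pi_gt3 by (intro mult_mono) auto
  then show ?thesis by (simp add: one_le_power)
qed

text \<open>Parseval's identity in the second coordinate reduces the inequality to the single modes. Rigid motions
  are excluded: \<open>\<alpha> 0 0 = 0\<close> removes the horizontal translations, and the sines remove vertical
  translations and rotations.\<close>

lemma korn_trigpoly:
  fixes \<alpha> \<beta> :: "nat \<Rightarrow> nat \<Rightarrow> real" and N :: nat
  defines "p \<equiv> trigpoly True True \<alpha> N" and "q \<equiv> trigpoly True False \<beta> N"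
  defines "D \<equiv> (LINT x|LO. (partial 1 p x)\<^sup>2) + (LINT x|LO. (partial 2 q x)\<^sup>2) + (LINT x|LO. (partial 2 p x + partial 1 q x)\<^sup>2)"
  assumes \<alpha>0: "\<alpha> 0 0 = 0"
  shows "(LINT x|LO. (p x)\<^sup>2) \<le> 50 * D" "(LINT x|LO. (q x)\<^sup>2) \<le> 50 * D"
    "(LINT x|LO. (partial 2 p x)\<^sup>2) \<le> 50 * D" "(LINT x|LO. (partial 1 q x)\<^sup>2) \<le> 50 * D"
proof -
  define \<kappa> where "\<kappa> k = pi * real k" for k
  define A where "A k = mode True \<alpha> N k" for k
  define B where "B k = mode True \<beta> N k" for k
  define A' where "A' k = mode False (\<lambda>j k. trig_sgn True * (pi * real j) * \<alpha> j k) N k" for k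
  define B' where "B' k = mode False (\<lambda>j k. trig_sgn True * (pi * real j) * \<beta> j k) N k" for k
  have p1: "partial 1 p x = (\<Sum>k\<le>N. A' k (x$1) * trig True k (x$2))" for x
    unfolding p_def partial_trigpoly trigpoly_mode A'_def by simp
  have p2: "partial 2 p x = (\<Sum>k\<le>N. (- (\<kappa> k * A k (x$1))) * trig False k (x$2))" for x
    unfolding p_def partial_trigpoly trigpoly_mode A_def \<kappa>_def mode_cmult by (simp add: trig_sgn_def)
  have q1: "partial 1 q x = (\<Sum>k\<le>N. B' k (x$1) * trig False k (x$2))" for x
    unfolding q_def partial_trigpoly trigpoly_mode B'_def by simp
  have q2: "partial 2 q x = (\<Sum>k\<le>N. (\<kappa> k * B k (x$1)) * trig True k (x$2))" for x
    unfolding q_def partial_trigpoly trigpoly_mode B_def \<kappa>_def mode_cmult by (simp add: trig_sgn_def)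
  have q0: "q x = (\<Sum>k\<le>N. B k (x$1) * trig False k (x$2))" for x
    unfolding q_def trigpoly_mode B_def ..
  have s: "partial 2 p x + partial 1 q x = (\<Sum>k\<le>N. (B' k (x$1) - \<kappa> k * A k (x$1)) * trig False k (x$2))" for x
    unfolding p2 q1 sum.distrib[symmetric] by (intro sum.cong refl) (simp add: algebra_simps)
  have cont: "continuous_on S (A k)" "continuous_on S (A' k)" "continuous_on S (B k)" "continuous_on S (B' k)" for k S
    unfolding A_def A'_def B_def B'_def by (intro continuous_mode)+
  define I where "I f = integral {0..1} (\<lambda>s. (f s)\<^sup>2)" for f :: "real \<Rightarrow> real"
  have I0: "0 \<le> I f" if "continuous_on {0..1} f" for f
    unfolding I_def by (intro integral_nonneg integrable_continuous_interval continuous_intros that) simp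
  have n_p1: "(LINT x|LO. (partial 1 p x)\<^sup>2) = (\<Sum>k\<le>N. trig_sq True k * I (A' k))"
    unfolding p1 I_def by (intro LINT_mode_sum_sq cont)
  have n_p2: "(LINT x|LO. (partial 2 p x)\<^sup>2) = (\<Sum>k\<le>N. trig_sq False k * I (\<lambda>s. \<kappa> k * A k s))"
    unfolding p2 by (subst LINT_mode_sum_sq) (auto intro!: continuous_intros cont simp: I_def)
  have n_q2: "(LINT x|LO. (partial 2 q x)\<^sup>2) = (\<Sum>k\<le>N. trig_sq True k * I (\<lambda>s. \<kappa> k * B k s))"
    unfolding q2 I_def by (intro LINT_mode_sum_sq continuous_intros cont)
  have n_s: "(LINT x|LO. (partial 2 p x + partial 1 q x)\<^sup>2) = (\<Sum>k\<le>N. trig_sq False k * I (\<lambda>s. B' k s - \<kappa> k * A k s))"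
    unfolding s I_def by (intro LINT_mode_sum_sq continuous_intros cont)
  have n_q: "(LINT x|LO. (q x)\<^sup>2) = (\<Sum>k\<le>N. trig_sq False k * I (B k))"
    unfolding q0 I_def by (intro LINT_mode_sum_sq cont)
  have km: "I (\<lambda>s. \<kappa> k * A k s) \<le> 20 * (I (A' k) + I (\<lambda>s. \<kappa> k * B k s) + I (\<lambda>s. B' k s - \<kappa> k * A k s))" for k
    unfolding I_def \<kappa>_def
    by (rule korn_mode) (use mode_deriv[of True] in \<open>auto simp: A_def A'_def B_def B'_def intro: continuous_mode\<close>)
  have "(LINT x|LO. (partial 2 p x)\<^sup>2) \<le> (\<Sum>k\<le>N. 20 * (trig_sq True k * I (A' k) + trig_sq True k * I (\<lambda>s. \<kappa> k * B k s)
      + trig_sq False k * I (\<lambda>s. B' k s - \<kappa> k * A k s)))"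
    unfolding n_p2
  proof (rule sum_mono)
    fix k
    have "trig_sq False k * I (\<lambda>s. \<kappa> k * A k s) \<le>
        trig_sq False k * (20 * (I (A' k) + I (\<lambda>s. \<kappa> k * B k s) + I (\<lambda>s. B' k s - \<kappa> k * A k s)))"
      by (intro mult_left_mono km trig_sq_nonneg)
    also have "\<dots> = 20 * (trig_sq False k * I (A' k) + trig_sq False k * I (\<lambda>s. \<kappa> k * B k s) + trig_sq False k * I (\<lambda>s. B' k s - \<kappa> k * A k s))"
      by (simp add: algebra_simps)
    also have "\<dots> \<le> 20 * (trig_sq True k * I (A' k) + trig_sq True k * I (\<lambda>s. \<kappa> k * B k s) + trig_sq False k * I (\<lambda>s. B' k s - \<kappa> k * A k s))"
      by (intro mult_left_mono add_mono mult_right_mono trig_sq_False_le I0 continuous_intros cont) auto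
    finally show "trig_sq False k * I (\<lambda>s. \<kappa> k * A k s) \<le> \<dots>" .
  qed
  also have "\<dots> = 20 * D"
    unfolding D_def n_p1 n_q2 n_s by (simp add: sum.distrib sum_distrib_left)
  finally have P2: "(LINT x|LO. (partial 2 p x)\<^sup>2) \<le> 20 * D" .
  have sm: "smooth p" "smooth q" unfolding p_def q_def by (rule smooth_trigpoly)+
  have L: "partial j p \<in> L2" "partial j q \<in> L2" "p \<in> L2" "q \<in> L2" for j
    by (intro L2_smooth smooth_partial sm)+
  have D: "0 \<le> (LINT x|LO. (partial 1 p x)\<^sup>2)" "0 \<le> (LINT x|LO. (partial 2 q x)\<^sup>2)"
    "0 \<le> (LINT x|LO. (partial 2 p x + partial 1 q x)\<^sup>2)" by simp_all
  then have D0: "0 \<le> D" by (simp add: D_def)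
  have part_le_D: "(LINT x|LO. (partial 1 p x)\<^sup>2) \<le> D" "(LINT x|LO. (partial 2 q x)\<^sup>2) \<le> D"
    "(LINT x|LO. (partial 2 p x + partial 1 q x)\<^sup>2) \<le> D"
    using D by (simp_all add: D_def)
  show "(LINT x|LO. (partial 2 p x)\<^sup>2) \<le> 50 * D" using P2 D0 by linarith
  have "(LINT x|LO. (partial 1 q x)\<^sup>2) \<le> (LINT x|LO. 2 * (partial 2 p x + partial 1 q x)\<^sup>2 + 2 * (partial 2 p x)\<^sup>2)"
  proof (rule integral_mono)
    show "integrable LO (\<lambda>x. (partial 1 q x)\<^sup>2)" by (intro L2_square_integrable L)
    show "integrable LO (\<lambda>x. 2 * (partial 2 p x + partial 1 q x)\<^sup>2 + 2 * (partial 2 p x)\<^sup>2)"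
      by (intro Bochner_Integration.integrable_add integrable_mult_right L2_square_integrable L2_add L)
    show "(partial 1 q x)\<^sup>2 \<le> 2 * (partial 2 p x + partial 1 q x)\<^sup>2 + 2 * (partial 2 p x)\<^sup>2" for x
      using zero_le_power2[of "partial 1 q x + 2 * partial 2 p x"] by (simp add: power2_eq_square algebra_simps)
  qed
  also have "\<dots> = 2 * (LINT x|LO. (partial 2 p x + partial 1 q x)\<^sup>2) + 2 * (LINT x|LO. (partial 2 p x)\<^sup>2)"
    by (simp add: L2_square_integrable L2_add L)
  also have "\<dots> \<le> 2 * D + 2 * (20 * D)"
    using P2 part_le_D(3) by linarith
  finally show "(LINT x|LO. (partial 1 q x)\<^sup>2) \<le> 50 * D" using D0 by linarith
  have "(LINT x|LO. (q x)\<^sup>2) \<le> (LINT x|LO. (partial 2 q x)\<^sup>2)"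
    unfolding n_q n_q2
  proof (rule sum_mono)
    fix k
    show "trig_sq False k * I (B k) \<le> trig_sq True k * I (\<lambda>s. \<kappa> k * B k s)"
    proof (cases "k = 0")
      case True
      then show ?thesis using mult_nonneg_nonneg[OF trig_sq_nonneg I0, of "\<lambda>s. \<kappa> k * B k s" True k]
        by (simp add: trig_sq_def continuous_intros cont)
    next
      case False
      have "I (\<lambda>s. \<kappa> k * B k s) = (\<kappa> k)\<^sup>2 * I (B k)" by (simp add: I_def power_mult_distrib)
      moreover have "1 * I (B k) \<le> (\<kappa> k)\<^sup>2 * I (B k)"
        unfolding \<kappa>_def using pi_nat_ge_1[OF False] by (intro mult_right_mono I0 cont)
      ultimately show ?thesis using False by (simp add: trig_sq_def)
    qed
  qed
  then show "(LINT x|LO. (q x)\<^sup>2) \<le> 50 * D" using part_le_D(2) D0 by linarith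
  have "(LINT x|LO. (p x)\<^sup>2) \<le> (LINT x|LO. (partial 1 p x)\<^sup>2) + (LINT x|LO. (partial 2 p x)\<^sup>2)"
    unfolding p_def partial_trigpoly LINT_trigpoly_sq sum.distrib[symmetric]
  proof (intro sum_mono)
    fix j k
    show "trig_sq True k * (trig_sq True j * (\<alpha> j k)\<^sup>2) \<le>
      trig_sq True k * (trig_sq (\<not> True) j * (trig_sgn True * (pi * real j) * \<alpha> j k)\<^sup>2) +
      trig_sq (\<not> True) k * (trig_sq True j * (trig_sgn True * (pi * real k) * \<alpha> j k)\<^sup>2)" (is "?l \<le> ?a + ?b")
    proof -
      have nn: "0 \<le> ?a" "0 \<le> ?b" by (intro mult_nonneg_nonneg trig_sq_nonneg zero_le_power2)+
      have sgn: "(trig_sgn True * (pi * real i) * \<alpha> j k)\<^sup>2 = (pi * real i)\<^sup>2 * (\<alpha> j k)\<^sup>2" for i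
        by (simp add: trig_sgn_def power_mult_distrib)
      consider "j = 0" "k = 0" | "j \<noteq> 0" | "k \<noteq> 0" by blast
      then show ?thesis
      proof cases
        case 1 then show ?thesis using \<alpha>0 nn by simp
      next
        case 2
        have "1 * ?l \<le> (pi * real j)\<^sup>2 * ?l"
          by (intro mult_right_mono pi_nat_ge_1 2 mult_nonneg_nonneg trig_sq_nonneg zero_le_power2)
        also have "\<dots> = ?a" unfolding sgn using trig_sq_flip[OF 2, of True] by simp
        finally show ?thesis using nn by simp
      next
        case 3
        have "1 * ?l \<le> (pi * real k)\<^sup>2 * ?l"
          by (intro mult_right_mono pi_nat_ge_1 3 mult_nonneg_nonneg trig_sq_nonneg zero_le_power2)
        also have "\<dots> = ?b" unfolding sgn using trig_sq_flip[OF 3, of True] by simp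
        finally show ?thesis using nn by simp
      qed
    qed
  qed
  then show "(LINT x|LO. (p x)\<^sup>2) \<le> 50 * D" using P2 part_le_D(1) D0 by linarith
qed

section \<open>The elastic energy\<close>

text \<open>For a displacement gradient these are the trace of the strain and twice its shear component.\<close>

abbreviation mtr :: "real^2^2 \<Rightarrow> real" where "mtr G \<equiv> G$1$1 + G$2$2"
abbreviation msh :: "real^2^2 \<Rightarrow> real" where "msh G \<equiv> G$1$2 + G$2$1"

definition mat_L2 :: "(real^2 \<Rightarrow> real^2^2) \<Rightarrow> bool" where
  "mat_L2 G \<longleftrightarrow> (\<forall>i j. (\<lambda>x. G x $ i $ j) \<in> L2)"

text \<open>The bilinear form of the tensile test, as a function of the displacement gradients. This covers
  affine gradients and limits of gradients without reference to a displacement.\<close>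

definition energy :: "(real^2 \<Rightarrow> real) \<Rightarrow> real \<Rightarrow> (real^2 \<Rightarrow> real^2^2) \<Rightarrow> (real^2 \<Rightarrow> real^2^2) \<Rightarrow> real" where
  "energy lam mu G H = (LINT x|LO. (lam x * mtr (G x)) * mtr (H x))
     + 2 * mu * ((LINT x|LO. G x $1$1 * H x $1$1) + (LINT x|LO. G x $2$2 * H x $2$2)
     + 1/2 * (LINT x|LO. msh (G x) * msh (H x)))"

definition admissible :: "(real^2 \<Rightarrow> real) \<Rightarrow> bool" where
  "admissible lam \<longleftrightarrow> lam \<in> borel_measurable LO \<and> (\<exists>B. \<forall>x\<in>Omega. 0 \<le> lam x \<and> lam x \<le> B)"

lemma admissibleE:
  assumes "admissible lam"
  obtains B where "lam \<in> borel_measurable LO" "\<And>x. x \<in> Omega \<Longrightarrow> \<bar>lam x\<bar> \<le> B"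
proof -
  obtain B where "lam \<in> borel_measurable LO" and B: "\<forall>x\<in>Omega. 0 \<le> lam x \<and> lam x \<le> B"
    using assms unfolding admissible_def by blast
  moreover have "\<bar>lam x\<bar> \<le> B" if "x \<in> Omega" for x using B that by simp
  ultimately show ?thesis using that by blast
qed

lemma admissible_mult_L2:
  assumes "admissible lam" "f \<in> L2" shows "(\<lambda>x. lam x * f x) \<in> L2"
proof -
  obtain B where "lam \<in> borel_measurable LO" "\<And>x. x \<in> Omega \<Longrightarrow> \<bar>lam x\<bar> \<le> B"
    using admissibleE[OF assms(1)] by blast
  then show ?thesis using assms(2) by (rule L2_bounded_mult)
qed

lemma mat_L2_D: "mat_L2 G \<Longrightarrow> (\<lambda>x. G x $ i $ j) \<in> L2"
  by (simp add: mat_L2_def)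

lemma mat_L2_parts:
  assumes "mat_L2 G" shows "(\<lambda>x. mtr (G x)) \<in> L2" "(\<lambda>x. msh (G x)) \<in> L2"
  using assms by (auto simp: mat_L2_def intro!: L2_add)

lemma mat_L2_lincomb: "mat_L2 G \<Longrightarrow> mat_L2 H \<Longrightarrow> mat_L2 (\<lambda>x. a *\<^sub>R G x + b *\<^sub>R H x)"
  by (simp add: mat_L2_def L2_add L2_cmult)

lemma energy_commute: "energy lam mu G H = energy lam mu H G"
  by (simp add: energy_def mult_ac)

lemma energy_lincomb:
  assumes "admissible lam" "mat_L2 G" "mat_L2 G'" "mat_L2 H"
  shows "energy lam mu (\<lambda>x. a *\<^sub>R G x + b *\<^sub>R G' x) H = a * energy lam mu G H + b * energy lam mu G' H"
proof -
  note L = mat_L2_D[OF assms(2)] mat_L2_D[OF assms(3)] mat_L2_D[OF assms(4)] mat_L2_parts[OF assms(2)]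
    mat_L2_parts[OF assms(3)] mat_L2_parts[OF assms(4)] admissible_mult_L2[OF assms(1) mat_L2_parts(1)[OF assms(2)]]
    admissible_mult_L2[OF assms(1) mat_L2_parts(1)[OF assms(3)]]
  have lin: "(LINT x|LO. (a * f x + b * g x) * h x) = a * (LINT x|LO. f x * h x) + b * (LINT x|LO. g x * h x)"
    if "f \<in> L2" "g \<in> L2" "h \<in> L2" for f g h :: "real^2 \<Rightarrow> real"
    using that by (simp add: distrib_right mult.assoc L2_mult_integrable)
  have eq: "lam x * mtr (a *\<^sub>R G x + b *\<^sub>R G' x) = a * (lam x * mtr (G x)) + b * (lam x * mtr (G' x))"
    "msh (a *\<^sub>R G x + b *\<^sub>R G' x) = a * msh (G x) + b * msh (G' x)"
    "(a *\<^sub>R G x + b *\<^sub>R G' x) $ i $ j = a * G x $ i $ j + b * G' x $ i $ j" for x i j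
    by (simp_all add: algebra_simps)
  have e: "energy lam mu (\<lambda>x. a *\<^sub>R G x + b *\<^sub>R G' x) H = 
    (LINT x|LO. (a * (lam x * mtr (G x)) + b * (lam x * mtr (G' x))) * mtr (H x))
     + 2 * mu * ((LINT x|LO. (a * G x $ 1 $ 1 + b * G' x $ 1 $ 1) * H x $1$1) + (LINT x|LO. (a * G x $ 2 $ 2 + b * G' x $ 2 $ 2) * H x $2$2)
     + 1/2 * (LINT x|LO. (a * msh (G x) + b * msh (G' x)) * msh (H x)))"
    unfolding energy_def eq(1) eq(2) unfolding eq(3) ..
  show ?thesis unfolding e by (subst lin, (rule L)+)+ (simp add: energy_def algebra_simps)
qed

lemma energy_lincomb2:
  assumes "admissible lam" "mat_L2 G" "mat_L2 G'" "mat_L2 H"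
  shows "energy lam mu H (\<lambda>x. a *\<^sub>R G x + b *\<^sub>R G' x) = a * energy lam mu H G + b * energy lam mu H G'"
  using energy_lincomb[OF assms] by (simp add: energy_commute)

lemma energy_quadratic:
  assumes "admissible lam" "mat_L2 G" "mat_L2 H"
  shows "energy lam mu (\<lambda>x. a *\<^sub>R G x + b *\<^sub>R H x) (\<lambda>x. a *\<^sub>R G x + b *\<^sub>R H x) =
    a\<^sup>2 * energy lam mu G G + 2 * a * b * energy lam mu G H + b\<^sup>2 * energy lam mu H H"
  by (simp add: energy_lincomb[OF assms(1) assms(2,3) mat_L2_lincomb[OF assms(2,3)]]
      energy_lincomb2[OF assms(1) assms(2,3)] assms energy_commute[of lam mu H G] power2_eq_square algebra_simps)

lemma energy_cong_AE:
  assumes "admissible lam" "mat_L2 G" "mat_L2 G'" "mat_L2 H" "AE x in LO. G x = G' x"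
  shows "energy lam mu G H = energy lam mu G' H"
proof -
  note L = mat_L2_D[OF assms(2)] mat_L2_D[OF assms(3)] mat_L2_D[OF assms(4)] mat_L2_parts[OF assms(2)]
    mat_L2_parts[OF assms(3)] mat_L2_parts[OF assms(4)] admissible_mult_L2[OF assms(1) mat_L2_parts(1)[OF assms(2)]]
    admissible_mult_L2[OF assms(1) mat_L2_parts(1)[OF assms(3)]]
  have c: "(LINT x|LO. f x * h x) = (LINT x|LO. g x * h x)"
    if "AE x in LO. f x = g x" "f \<in> L2" "g \<in> L2" "h \<in> L2" for f g h :: "real^2 \<Rightarrow> real"
    by (rule integral_cong_AE)
       (use that L2_measurable[OF that(2)] L2_measurable[OF that(3)] L2_measurable[OF that(4)] in auto)
  have "AE x in LO. lam x * mtr (G x) = lam x * mtr (G' x)" "AE x in LO. msh (G x) = msh (G' x)"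
     "AE x in LO. G x $ i $ j = G' x $ i $ j" for i j
    using assms(5) by (eventually_elim, simp)+
  note c1 = this
  show ?thesis unfolding energy_def
    unfolding c[OF c1(1) L(10,11,8)] c[OF c1(2) L(5,7,9)] c[OF c1(3) L(1,2,3)] ..
qed

lemma energy_lim:
  assumes "admissible lam" "\<And>i j. L2_lim (\<lambda>n x. G n x $ i $ j) (\<lambda>x. G' x $ i $ j)"
    and "\<And>i j. L2_lim (\<lambda>n x. H n x $ i $ j) (\<lambda>x. H' x $ i $ j)"
  shows "(\<lambda>n. energy lam mu (G n) (H n)) \<longlonglongrightarrow> energy lam mu G' H'"
proof -
  obtain B where B: "lam \<in> borel_measurable LO" "\<And>x. x \<in> Omega \<Longrightarrow> \<bar>lam x\<bar> \<le> B"
    using admissibleE[OF assms(1)] by blast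
  show ?thesis unfolding energy_def
    by (intro tendsto_add tendsto_mult_left L2_lim_ip2 L2_lim_bounded_mult[OF _ B] L2_lim_add assms(2,3))
qed

lemma energy_ge:
  assumes "admissible lam" "mat_L2 G" "mu > 0"
  shows "2 * mu * ((LINT x|LO. (G x $1$1)\<^sup>2) + (LINT x|LO. (G x $2$2)\<^sup>2) + 1/2 * (LINT x|LO. (msh (G x))\<^sup>2)) \<le> energy lam mu G G"
proof -
  have "0 \<le> (LINT x|LO. (lam x * mtr (G x)) * mtr (G x))"
    using assms(1) by (intro integral_nonneg_AE AE_LO_I) (auto simp: admissible_def mult.assoc)
  then show ?thesis by (simp add: energy_def power2_eq_square)
qed

lemma energy_integral:
  assumes "admissible lam" "mat_L2 G" "mat_L2 H"
  shows "(LINT x|LO. lam x * mtr (G x) * mtr (H x) + 2 * mu * (G x $1$1 * H x $1$1 + G x $2$2 * H x $2$2 + 1/2 * (msh (G x) * msh (H x))))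
    = energy lam mu G H"
  using L2_mult_integrable[OF admissible_mult_L2[OF assms(1) mat_L2_parts(1)[OF assms(2)]] mat_L2_parts(1)[OF assms(3)]]
    L2_mult_integrable[OF mat_L2_D[OF assms(2)] mat_L2_D[OF assms(3)]]
    L2_mult_integrable[OF mat_L2_parts(2)[OF assms(2)] mat_L2_parts(2)[OF assms(3)]]
  by (simp add: energy_def)

lemma trace_sym_grad: "trace (sym_grad u x) = mtr (Jac u x)"
  by (simp add: sym_grad_def trace_def sum_2 transpose_def)

lemma frob_sym_grad: "frob (sym_grad u x) (sym_grad v x) =
    Jac u x $1$1 * Jac v x $1$1 + Jac u x $2$2 * Jac v x $2$2 + 1/2 * (msh (Jac u x) * msh (Jac v x))"
  by (simp add: sym_grad_def frob_def trace_def sum_2 transpose_def matrix_matrix_mult_def algebra_simps)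

lemma mat_L2_Jac: "u \<in> H1 \<Longrightarrow> mat_L2 (Jac u)"
  by (simp add: mat_L2_def Jac_L2)

lemma W_H1: "u \<in> W l \<Longrightarrow> u \<in> H1" by (simp add: W_def)

lemma tensile_solution_iff:
  assumes "admissible lam"
  shows "tensile_solution lam (\<lambda>_. mu) l u \<longleftrightarrow> u \<in> W l \<and> (\<forall>v\<in>W 0. energy lam mu (Jac u) (Jac v) = 0)"
proof -
  have "(LINT x|LO. lam x * trace (sym_grad u x) * trace (sym_grad v x) + 2 * mu * frob (sym_grad u x) (sym_grad v x))
     = energy lam mu (Jac u) (Jac v)" if "u \<in> W l" "v \<in> W 0" for v
    unfolding trace_sym_grad frob_sym_grad
    by (intro energy_integral assms mat_L2_Jac W_H1[OF that(1)] W_H1[OF that(2)])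
  then show ?thesis unfolding tensile_solution_def by auto
qed

section \<open>Existence of the solution of the tensile test\<close>

text \<open>Smooth fields that satisfy the homogeneous boundary conditions and the mean value condition
  exactly.\<close>

definition trig_fields :: "((real^2 \<Rightarrow> real) \<times> (real^2 \<Rightarrow> real)) set" where
  "trig_fields = {(trigpoly True True \<alpha> N, trigpoly True False \<beta> N) | \<alpha> \<beta> N. \<alpha> 0 0 = 0}"

lemma trigpoly_pad:
  assumes "N \<le> M"
  shows "trigpoly a b c N = trigpoly a b (\<lambda>j k. if j \<le> N \<and> k \<le> N then c j k else 0) M"
proof
  fix x
  have "trigpoly a b c N x = (\<Sum>(j,k)\<in>{..N}\<times>{..N}. c j k * trig2 a b j k x)"
    by (simp add: trigpoly_def sum.cartesian_product)
  also have "\<dots> = (\<Sum>(j,k)\<in>{..M}\<times>{..M}. (if j \<le> N \<and> k \<le> N then c j k else 0) * trig2 a b j k x)"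
    by (rule sum.mono_neutral_cong_left) (use assms in \<open>auto split: if_splits\<close>)
  finally show "trigpoly a b c N x = trigpoly a b (\<lambda>j k. if j \<le> N \<and> k \<le> N then c j k else 0) M x"
    by (simp add: trigpoly_def sum.cartesian_product)
qed

lemma trigpoly_lincomb:
  "r * trigpoly a b c N x + s * trigpoly a b d N x = trigpoly a b (\<lambda>j k. r * c j k + s * d j k) N x"
  by (simp add: trigpoly_def sum_distrib_left sum.distrib[symmetric] algebra_simps)

lemma trig_fields_lincomb:
  assumes "(p, q) \<in> trig_fields" "(p', q') \<in> trig_fields"
  shows "(\<lambda>x. r * p x + s * p' x, \<lambda>x. r * q x + s * q' x) \<in> trig_fields"
proof -
  obtain \<alpha> \<beta> N where 1: "p = trigpoly True True \<alpha> N" "q = trigpoly True False \<beta> N" "\<alpha> 0 0 = 0"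
    using assms(1) by (auto simp: trig_fields_def)
  obtain \<alpha>' \<beta>' N' where 2: "p' = trigpoly True True \<alpha>' N'" "q' = trigpoly True False \<beta>' N'" "\<alpha>' 0 0 = 0"
    using assms(2) by (auto simp: trig_fields_def)
  define M where "M = max N N'"
  define pad where "pad c N = (\<lambda>j k. if j \<le> N \<and> k \<le> N then c j k else (0::real))" for c :: "nat \<Rightarrow> nat \<Rightarrow> real" and N :: nat
  have p: "p = trigpoly True True (pad \<alpha> N) M" "q = trigpoly True False (pad \<beta> N) M"
    "p' = trigpoly True True (pad \<alpha>' N') M" "q' = trigpoly True False (pad \<beta>' N') M"
    unfolding 1 2 pad_def by (rule trigpoly_pad; simp add: M_def)+
  show ?thesis unfolding p trigpoly_lincomb trig_fields_def using 1(3) 2(3)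
    by (auto simp: pad_def intro!: exI)
qed

lemma trig_fields_smooth: "(p, q) \<in> trig_fields \<Longrightarrow> smooth p \<and> smooth q"
  by (auto simp: trig_fields_def smooth_trigpoly)

lemma trigpoly_sin_edge: "trigpoly a False c N (pt t 0) = 0" "trigpoly a False c N (pt t 1) = 0"
  by (simp_all add: trigpoly_def trig2_def trig_def sin_pi_nat)

lemma trig_fields_mean: "(p, q) \<in> trig_fields \<Longrightarrow> (LINT x|LO. p x) = 0"
proof -
  assume "(p, q) \<in> trig_fields"
  then obtain \<alpha> N where p: "p = trigpoly True True \<alpha> N" "\<alpha> 0 0 = 0" by (auto simp: trig_fields_def)
  have "trig2 True True 0 0 = (\<lambda>x. 1)" by (auto simp: trig2_def trig_def)
  then have "(LINT x|LO. trig2 True True j k x) = (if (j, k) = (0, 0) then 1 else 0)" for j k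
    using trig2_orthogonal[of True True j k 0 0] by (simp add: trig_sq_def)
  then have "(LINT x|LO. p x) = (\<Sum>j\<le>N. \<Sum>k\<le>N. \<alpha> j k * (if (j, k) = (0, 0) then 1 else 0))"
    unfolding p trigpoly_def by (simp add: L2_integrable L2_cmult trig2_L2)
  also have "\<dots> = 0" using p(2) by (intro sum.neutral ballI) auto
  finally show ?thesis .
qed

lemma vfield_jac_nth: "vfield_jac p q x $ 1 $ j = partial j p x" "vfield_jac p q x $ 2 $ j = partial j q x"
  by (simp_all add: vfield_jac_def grad_nth)

lemma all_2_matrix: "(\<forall>(i::2) (j::2). P i j) \<longleftrightarrow> P 1 1 \<and> P 1 2 \<and> P 2 1 \<and> P 2 2"
  by (auto simp: forall_2)

lemma vfield_jac_L2: "smooth p \<Longrightarrow> smooth q \<Longrightarrow> mat_L2 (vfield_jac p q)"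
  unfolding mat_L2_def all_2_matrix vfield_jac_nth by (simp add: L2_smooth smooth_partial)

lemma partial_lincomb:
  "smooth p \<Longrightarrow> smooth p' \<Longrightarrow> partial j (\<lambda>x. r * p x + s * p' x) x = r * partial j p x + s * partial j p' x"
  by (simp add: partial_add partial_cmult smooth_differentiable smooth_cmult)

lemma vfield_jac_lincomb:
  assumes "smooth p" "smooth p'" "smooth q" "smooth q'"
  shows "vfield_jac (\<lambda>x. r * p x + s * p' x) (\<lambda>x. r * q x + s * q' x) x = r *\<^sub>R vfield_jac p q x + s *\<^sub>R vfield_jac p' q' x"
  by (simp add: vec_eq_iff forall_2 vfield_jac_nth partial_lincomb assms)

lemma trig_fields_korn:
  assumes "(p, q) \<in> trig_fields" "admissible lam" "mu > 0"
  shows "(L2_norm p)\<^sup>2 \<le> 50 / mu * energy lam mu (vfield_jac p q) (vfield_jac p q)"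
    "(L2_norm q)\<^sup>2 \<le> 50 / mu * energy lam mu (vfield_jac p q) (vfield_jac p q)"
    "(L2_norm (\<lambda>x. vfield_jac p q x $ i $ j))\<^sup>2 \<le> 50 / mu * energy lam mu (vfield_jac p q) (vfield_jac p q)"
proof -
  define E where "E = energy lam mu (vfield_jac p q) (vfield_jac p q)"
  obtain \<alpha> \<beta> N where pq: "p = trigpoly True True \<alpha> N" "q = trigpoly True False \<beta> N" "\<alpha> 0 0 = 0"
    using assms(1) by (auto simp: trig_fields_def)
  define D where "D = (LINT x|LO. (partial 1 p x)\<^sup>2) + (LINT x|LO. (partial 2 q x)\<^sup>2) + (LINT x|LO. (partial 2 p x + partial 1 q x)\<^sup>2)"
  note K = korn_trigpoly[where \<alpha>=\<alpha> and N=N and \<beta>=\<beta>, OF pq(3), folded pq(1,2), folded D_def]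
  have nn: "0 \<le> (LINT x|LO. (partial 1 p x)\<^sup>2)" "0 \<le> (LINT x|LO. (partial 2 q x)\<^sup>2)"
    "0 \<le> (LINT x|LO. (partial 2 p x + partial 1 q x)\<^sup>2)" by simp_all
  have "mu * D \<le> 2 * mu * ((LINT x|LO. (partial 1 p x)\<^sup>2) + (LINT x|LO. (partial 2 q x)\<^sup>2) + 1/2 * (LINT x|LO. (partial 2 p x + partial 1 q x)\<^sup>2))"
    unfolding D_def using mult_nonneg_nonneg[OF less_imp_le[OF assms(3)] nn(1)] mult_nonneg_nonneg[OF less_imp_le[OF assms(3)] nn(2)]
    by (simp add: algebra_simps)
  also have "\<dots> \<le> E"
    using energy_ge[OF assms(2) vfield_jac_L2[of p q] assms(3)] trig_fields_smooth[OF assms(1)]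
    by (simp add: E_def vfield_jac_nth)
  finally have DE: "50 * D \<le> 50 / mu * E" using assms(3) by (simp add: field_simps)
  have le: "(L2_norm f)\<^sup>2 \<le> 50 / mu * E" if "(LINT x|LO. (f x)\<^sup>2) \<le> 50 * D" for f :: "real^2 \<Rightarrow> real"
    using that DE by (simp add: L2_norm_sq)
  have d: "D \<ge> 0" "(LINT x|LO. (partial 1 p x)\<^sup>2) \<le> D" "(LINT x|LO. (partial 2 q x)\<^sup>2) \<le> D"
    using nn by (simp_all add: D_def)
  show "(L2_norm p)\<^sup>2 \<le> 50 / mu * energy lam mu (vfield_jac p q) (vfield_jac p q)"
    "(L2_norm q)\<^sup>2 \<le> 50 / mu * energy lam mu (vfield_jac p q) (vfield_jac p q)"
    unfolding E_def[symmetric] by (intro le K)+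
  have "\<forall>i j. (L2_norm (\<lambda>x. vfield_jac p q x $ i $ j))\<^sup>2 \<le> 50 / mu * E"
    unfolding all_2_matrix vfield_jac_nth using d K by (intro conjI le) auto
  then show "(L2_norm (\<lambda>x. vfield_jac p q x $ i $ j))\<^sup>2 \<le> 50 / mu * energy lam mu (vfield_jac p q) (vfield_jac p q)"
    unfolding E_def by blast
qed

lemma LINT_eq_0_of_lim:
  assumes "L2_lim f g" "\<And>n. (LINT x|LO. f n x) = 0" shows "(LINT x|LO. g x) = 0"
  using L2_lim_ip[OF assms(1) L2_const[of 1]] assms(2) by (simp add: LIMSEQ_const_iff)

text \<open>The second components vanish on both edges, so they serve as the approximants that the definition of
  the trace asks for.\<close>

lemma trig_fields_limit_W:
  assumes pq: "\<And>n. (p n, q n) \<in> trig_fields" and p: "L2_lim p P" and q: "L2_lim q Q"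
    and G: "\<And>i j. L2_lim (\<lambda>n x. vfield_jac (p n) (q n) x $ i $ j) (\<lambda>x. G x $ i $ j)"
  shows "vfield P Q \<in> W 0" "weak_jacobian (vfield P Q) G"
proof -
  have s: "smooth (p n)" "smooth (q n)" for n using trig_fields_smooth[OF pq] by auto
  have wp: "weak_gradient P (\<lambda>x. G x $ 1)"
    by (rule weak_gradient_lim[OF weak_gradient_smooth[OF s(1)] p]) (use G[of 1] in \<open>simp add: vfield_jac_nth grad_nth\<close>)
  have wq: "weak_gradient Q (\<lambda>x. G x $ 2)"
    by (rule weak_gradient_lim[OF weak_gradient_smooth[OF s(2)] q]) (use G[of 2] in \<open>simp add: vfield_jac_nth grad_nth\<close>)
  show wj: "weak_jacobian (vfield P Q) G"
    using wp wq by (simp add: weak_jacobian_def forall_2 vfield_def)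
  have "q n (pt t 0) = 0" "q n (pt t 1) = 0" for n t
    using pq[of n] by (auto simp: trig_fields_def trigpoly_sin_edge)
  then have "has_trace 1 Q (\<lambda>_. 0)" "has_trace 0 Q (\<lambda>_. 0)"
    unfolding has_trace_const_iff using wq s(2) q G[of 2]
    by (auto intro!: exI[of _ "\<lambda>x. G x $ 2"] exI[of _ q] simp: vfield_jac_nth)
  moreover have "(LINT x|LO. P x) = 0"
    by (rule LINT_eq_0_of_lim[OF p trig_fields_mean[OF pq]])
  ultimately show "vfield P Q \<in> W 0"
    using weak_jacobian_H1[OF wj] by (simp add: W_def vfield_def)
qed

text \<open>Fourier partial sums. The boundary condition is what makes the sine series of the second component
  differentiable term by term.\<close>

lemma trig_fields_dense:
  assumes "v \<in> W 0"
  obtains p q where "\<And>n. (p n, q n) \<in> trig_fields"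
    "\<And>i j. L2_lim (\<lambda>n x. vfield_jac (p n) (q n) x $ i $ j) (\<lambda>x. Jac v x $ i $ j)"
proof -
  have wj: "weak_jacobian v (Jac v)" by (rule weak_jacobian_Jac[OF W_H1[OF assms]])
  then have w: "weak_gradient (\<lambda>x. v x $ i) (\<lambda>x. Jac v x $ i)" for i by (simp add: weak_jacobian_def)
  define p where "p = trigpoly True True (fourier True True (\<lambda>x. v x $ 1))"
  define q where "q = trigpoly True False (fourier True False (\<lambda>x. v x $ 2))"
  have "trig2 True True 0 0 x = 1" for x by (simp add: trig2_def trig_def)
  then have "fourier True True (\<lambda>x. v x $ 1) 0 0 = 0"
    using assms by (simp add: fourier_def W_def)
  then have "(p n, q n) \<in> trig_fields" for n
    by (auto simp: trig_fields_def p_def q_def)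
  moreover have "\<forall>i j. L2_lim (\<lambda>n x. vfield_jac (p n) (q n) x $ i $ j) (\<lambda>x. Jac v x $ i $ j)"
    unfolding all_2_matrix vfield_jac_nth p_def q_def eta_contract_eq
    using assms by (intro conjI fourier_gradient_lim fourier_gradient_lim_trace w) (auto simp: W_def)
  ultimately show ?thesis using that by blast
qed

text \<open>The direct method. The energy is minimised over trigonometric fields, for which Korn's inequality
  turns convergence of the strains into convergence of the gradients. Density then extends the
  Euler--Lagrange equation to all of \<open>W 0\<close>.\<close>

theorem tensile_solution_exists:
  assumes adm: "admissible lam" and mu: "mu > 0"
  shows "\<exists>u. tensile_solution lam (\<lambda>_. mu) l u"
proof -
  define q0 :: "real^2 \<Rightarrow> real" where "q0 = (\<lambda>x. l * x$2)"
  define U where "U = vfield (\<lambda>_. 0) q0"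
  define G0 where "G0 = vfield_jac (\<lambda>_. 0) q0"
  have s0: "smooth (\<lambda>_. 0)" "smooth q0" unfolding q0_def by (intro smooth_const smooth_cmult smooth_coord)+
  have UW: "U \<in> W l" unfolding U_def by (rule vfield_W[OF s0]) (simp_all add: q0_def)
  have UG: "weak_jacobian U G0" unfolding U_def G0_def by (rule weak_jacobian_vfield[OF s0])
  have G0: "mat_L2 G0" unfolding G0_def by (rule vfield_jac_L2[OF s0])
  define J where "J = (\<lambda>(p, q). energy lam mu (\<lambda>x. G0 x + vfield_jac p q x) (\<lambda>x. G0 x + vfield_jac p q x))"
  have vL2: "mat_L2 (vfield_jac p q)" if "(p, q) \<in> trig_fields" for p q
    using trig_fields_smooth[OF that] vfield_jac_L2 by blast
  have sumL2: "mat_L2 (\<lambda>x. G0 x + vfield_jac p q x)" if "(p, q) \<in> trig_fields" for p q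
    using mat_L2_lincomb[OF G0 vL2[OF that], of 1 1] by simp
  have e0: "0 \<le> energy lam mu G G" if "mat_L2 G" for G
    by (rule order_trans[OF _ energy_ge[OF adm that mu]])
       (use mu in \<open>auto intro!: mult_nonneg_nonneg add_nonneg_nonneg\<close>)
  have J0: "0 \<le> J v" if "v \<in> trig_fields" for v
    using that sumL2 by (cases v) (auto simp: J_def intro!: e0)
  have "(trigpoly True True (\<lambda>_ _. 0) 0, trigpoly True False (\<lambda>_ _. 0) 0) \<in> trig_fields"
    unfolding trig_fields_def by blast
  then have ne: "trig_fields \<noteq> {}" by blast
  define m where "m = Inf (J ` trig_fields)"
  have bdd: "bdd_below (J ` trig_fields)" using J0 by (auto intro!: bdd_belowI[of _ 0])
  have m_le: "m \<le> J v" if "v \<in> trig_fields" for v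
    unfolding m_def by (rule cInf_lower[OF _ bdd]) (use that in auto)
  have "\<exists>v\<in>trig_fields. J v < m + 1 / real (Suc n)" for n
  proof -
    have "Inf (J ` trig_fields) < m + 1 / real (Suc n)" by (simp add: m_def)
    then show ?thesis using cInf_lessD[of "J ` trig_fields"] ne by blast
  qed
  then obtain V where V: "\<And>n. V n \<in> trig_fields" "\<And>n. J (V n) < m + 1 / real (Suc n)" by metis
  define p where "p n = fst (V n)" for n
  define q where "q n = snd (V n)" for n
  have pq: "(p n, q n) \<in> trig_fields" and Jpq: "J (p n, q n) < m + 1 / real (Suc n)" for n
    using V[of n] by (simp_all add: p_def q_def)
  have s: "smooth (p n)" "smooth (q n)" for n using trig_fields_smooth[OF pq] by auto
  have pqL2: "p n \<in> L2" "q n \<in> L2" "(\<lambda>x. vfield_jac (p n) (q n) x $ i $ j) \<in> L2" for n i j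
    using L2_smooth s mat_L2_D[OF vL2[OF pq]] by auto
  have lim_inv: "(\<lambda>n. 1 / real (Suc n)) \<longlonglongrightarrow> 0"
    using LIMSEQ_inverse_real_of_nat by (simp add: inverse_eq_divide)
  have Jlim: "(\<lambda>n. J (p n, q n)) \<longlonglongrightarrow> m"
  proof (rule real_tendsto_sandwich[where f = "\<lambda>_. m"])
    show "(\<lambda>n. m + 1 / real (Suc n)) \<longlonglongrightarrow> m" using tendsto_add[OF tendsto_const lim_inv, of m] by simp
  qed (use m_le[OF pq] less_imp_le[OF Jpq] in auto)
  (* By the parallelogram identity the strains of a minimising sequence form a Cauchy sequence:
     the midpoint of two of its members has at least the energy m. *)
  have diff_field: "(\<lambda>x. p n x - p k x, \<lambda>x. q n x - q k x) \<in> trig_fields" for n k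
    using trig_fields_lincomb[OF pq pq, of 1 n "-1" k] by simp
  have diff_jac: "vfield_jac (\<lambda>x. p n x - p k x) (\<lambda>x. q n x - q k x) x = vfield_jac (p n) (q n) x - vfield_jac (p k) (q k) x" for n k x
    using vfield_jac_lincomb[OF s(1) s(1) s(2) s(2), of 1 n "-1" k] by simp
  have par: "energy lam mu (\<lambda>x. vfield_jac (p n) (q n) x - vfield_jac (p k) (q k) x) (\<lambda>x. vfield_jac (p n) (q n) x - vfield_jac (p k) (q k) x)
      \<le> 2 * (1 / real (Suc n) + 1 / real (Suc k))" for n k
  proof -
    define A where "A = (\<lambda>x. G0 x + vfield_jac (p n) (q n) x)"
    define B where "B = (\<lambda>x. G0 x + vfield_jac (p k) (q k) x)"
    have AB: "mat_L2 A" "mat_L2 B" unfolding A_def B_def by (intro sumL2 pq)+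
    have h: "(\<lambda>x. 1/2 * p n x + 1/2 * p k x, \<lambda>x. 1/2 * q n x + 1/2 * q k x) \<in> trig_fields"
      by (rule trig_fields_lincomb[OF pq pq])
    have "(\<lambda>x. G0 x + vfield_jac (\<lambda>x. 1/2 * p n x + 1/2 * p k x) (\<lambda>x. 1/2 * q n x + 1/2 * q k x) x) = (\<lambda>x. (1/2) *\<^sub>R A x + (1/2) *\<^sub>R B x)"
    proof
      fix x
      have "G0 x = (1/2) *\<^sub>R G0 x + (1/2) *\<^sub>R G0 x" by (simp flip: scaleR_add_left)
      then show "G0 x + vfield_jac (\<lambda>x. 1/2 * p n x + 1/2 * p k x) (\<lambda>x. 1/2 * q n x + 1/2 * q k x) x = (1/2) *\<^sub>R A x + (1/2) *\<^sub>R B x"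
        unfolding vfield_jac_lincomb[OF s(1) s(1) s(2) s(2)] A_def B_def by (simp add: scaleR_add_right algebra_simps)
    qed
    then have "m \<le> energy lam mu (\<lambda>x. (1/2) *\<^sub>R A x + (1/2) *\<^sub>R B x) (\<lambda>x. (1/2) *\<^sub>R A x + (1/2) *\<^sub>R B x)"
      using m_le[OF h] by (simp add: J_def)
    also have "\<dots> = 1/4 * energy lam mu A A + 1/2 * energy lam mu A B + 1/4 * energy lam mu B B"
      unfolding energy_quadratic[OF adm AB] by (simp add: power2_eq_square)
    finally have 1: "4 * m \<le> energy lam mu A A + 2 * energy lam mu A B + energy lam mu B B" by simp
    have "energy lam mu (\<lambda>x. 1 *\<^sub>R A x + (-1) *\<^sub>R B x) (\<lambda>x. 1 *\<^sub>R A x + (-1) *\<^sub>R B x)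
      = energy lam mu A A - 2 * energy lam mu A B + energy lam mu B B"
      unfolding energy_quadratic[OF adm AB] by simp
    moreover have "(\<lambda>x. 1 *\<^sub>R A x + (-1) *\<^sub>R B x) = (\<lambda>x. vfield_jac (p n) (q n) x - vfield_jac (p k) (q k) x)"
      by (auto simp: A_def B_def)
    ultimately have 2: "energy lam mu (\<lambda>x. vfield_jac (p n) (q n) x - vfield_jac (p k) (q k) x) (\<lambda>x. vfield_jac (p n) (q n) x - vfield_jac (p k) (q k) x)
      = energy lam mu A A - 2 * energy lam mu A B + energy lam mu B B" by simp
    have 3: "energy lam mu A A < m + 1 / real (Suc n)" "energy lam mu B B < m + 1 / real (Suc k)"
      using Jpq[of n] Jpq[of k] by (simp_all add: J_def A_def B_def)
    have gen: "a - 2 * c + b \<le> 2 * (r + r')" if "a < m + r" "b < m + r'" "4 * m \<le> a + 2 * c + b" for a b c r r' :: real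
      using that by (simp add: algebra_simps)
    show ?thesis unfolding 2 by (rule gen[OF 3 1])
  qed
  have small: "\<exists>N. \<forall>n\<ge>N. \<forall>k\<ge>N. f n k < r"
    if "r > 0" and f: "\<And>n k. (f n k)\<^sup>2 \<le> 50 / mu * (2 * (1 / real (Suc n) + 1 / real (Suc k)))"
    for r and f :: "nat \<Rightarrow> nat \<Rightarrow> real"
  proof -
    have "0 < mu * r\<^sup>2 / 200" using \<open>r > 0\<close> mu by simp
    from nat_approx_posE[OF this] obtain N where N: "1 / real (Suc N) < mu * r\<^sup>2 / 200" by blast
    have "f n k < r" if "n \<ge> N" "k \<ge> N" for n k
    proof (rule power2_less_imp_less)
      have "1 / real (Suc n) \<le> 1 / real (Suc N)" "1 / real (Suc k) \<le> 1 / real (Suc N)"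
        using that by (simp_all add: frac_le)
      then have "1 / real (Suc n) + 1 / real (Suc k) < mu * r\<^sup>2 / 100" using N by linarith
      then have "50 / mu * (2 * (1 / real (Suc n) + 1 / real (Suc k))) < 50 / mu * (2 * (mu * r\<^sup>2 / 100))"
        using mu by (intro mult_strict_left_mono) auto
      also have "\<dots> = r\<^sup>2" using mu by simp
      finally show "(f n k)\<^sup>2 < r\<^sup>2" using f[of n k] by linarith
    qed (use \<open>r > 0\<close> in simp)
    then show ?thesis by blast
  qed
  have E: "50 / mu * energy lam mu (vfield_jac (\<lambda>x. p n x - p k x) (\<lambda>x. q n x - q k x)) (vfield_jac (\<lambda>x. p n x - p k x) (\<lambda>x. q n x - q k x))
     \<le> 50 / mu * (2 * (1 / real (Suc n) + 1 / real (Suc k)))" for n k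
    using par[of n k] mu unfolding diff_jac[abs_def] by (intro mult_left_mono) auto
  have cauchy_p: "(L2_norm (\<lambda>x. p n x - p k x))\<^sup>2 \<le> 50 / mu * (2 * (1 / real (Suc n) + 1 / real (Suc k)))" for n k
    by (rule order_trans[OF trig_fields_korn(1)[OF diff_field adm mu] E])
  obtain P where P: "L2_lim p P"
    by (rule L2_complete[of p, OF pqL2(1) small[OF _ cauchy_p]])
  have cauchy_q: "(L2_norm (\<lambda>x. q n x - q k x))\<^sup>2 \<le> 50 / mu * (2 * (1 / real (Suc n) + 1 / real (Suc k)))" for n k
    by (rule order_trans[OF trig_fields_korn(2)[OF diff_field adm mu] E])
  obtain Q where Q: "L2_lim q Q"
    by (rule L2_complete[of q, OF pqL2(2) small[OF _ cauchy_q]])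
  have "\<exists>g. L2_lim (\<lambda>n x. vfield_jac (p n) (q n) x $ i $ j) g" for i j
  proof -
    have cauchy: "(L2_norm (\<lambda>x. vfield_jac (p n) (q n) x $ i $ j - vfield_jac (p k) (q k) x $ i $ j))\<^sup>2
        \<le> 50 / mu * (2 * (1 / real (Suc n) + 1 / real (Suc k)))" for n k
      using order_trans[OF trig_fields_korn(3)[OF diff_field adm mu] E, of n k i j] by (simp add: diff_jac)
    show ?thesis
      by (rule L2_complete[of "\<lambda>n x. vfield_jac (p n) (q n) x $ i $ j", OF pqL2(3) small[OF _ cauchy]]) blast+
  qed
  note jac_conv = this
  define g where "g i j = (SOME h. L2_lim (\<lambda>n x. vfield_jac (p n) (q n) x $ i $ j) h)" for i j
  have g: "L2_lim (\<lambda>n x. vfield_jac (p n) (q n) x $ i $ j) (g i j)" for i j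
    unfolding g_def using jac_conv[of i j] by (rule someI_ex)
  define G :: "real^2 \<Rightarrow> real^2^2" where "G x = (\<chi> i j. g i j x)" for x
  have G: "L2_lim (\<lambda>n x. vfield_jac (p n) (q n) x $ i $ j) (\<lambda>x. G x $ i $ j)" for i j
    using g[of i j] by (simp add: G_def)
  have GL2: "mat_L2 G" using G by (simp add: mat_L2_def L2_lim_def)
  note vW = trig_fields_limit_W[OF pq P Q G]
  define u where "u = (\<lambda>x. 1 *\<^sub>R U x + 1 *\<^sub>R vfield P Q x)"
  have uW: "u \<in> W l" using W_lincomb[OF UW vW(1), of 1 1] by (simp add: u_def)
  have "weak_jacobian u (\<lambda>x. 1 *\<^sub>R G0 x + 1 *\<^sub>R G x)"
    unfolding u_def by (rule weak_jacobian_lincomb[OF UG vW(2)])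
  then have uG: "AE x in LO. Jac u x = G0 x + G x" using Jac_AE by fastforce
  have G0G: "mat_L2 (\<lambda>x. G0 x + G x)" using mat_L2_lincomb[OF G0 GL2, of 1 1] by simp
  have limA: "L2_lim (\<lambda>n x. (G0 x + vfield_jac (p n) (q n) x) $ i $ j) (\<lambda>x. (G0 x + G x) $ i $ j)" for i j
    unfolding vector_add_component by (intro L2_lim_add L2_lim_const G mat_L2_D G0)
  (* The energy of every variation of the minimising sequence is at least m, so in the limit the
     term that is linear in t has to vanish. *)
  have var: "energy lam mu (\<lambda>x. G0 x + G x) (vfield_jac a b) = 0" if ab: "(a, b) \<in> trig_fields" for a b
  proof -
    define H where "H = vfield_jac a b"
    have H: "mat_L2 H" unfolding H_def by (rule vL2[OF ab])
    have sab: "smooth a" "smooth b" using trig_fields_smooth[OF ab] by auto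
    have "0 \<le> 0 - 2 * t * energy lam mu (\<lambda>x. G0 x + G x) H + t\<^sup>2 * energy lam mu H H" for t
    proof -
      have "m \<le> J (p n, q n) - 2 * t * energy lam mu (\<lambda>x. G0 x + vfield_jac (p n) (q n) x) H + t\<^sup>2 * energy lam mu H H" for n
      proof -
        have "m \<le> J (\<lambda>x. 1 * p n x + (-t) * a x, \<lambda>x. 1 * q n x + (-t) * b x)"
          by (rule m_le[OF trig_fields_lincomb[OF pq ab]])
        also have "\<dots> = energy lam mu (\<lambda>x. 1 *\<^sub>R (G0 x + vfield_jac (p n) (q n) x) + (-t) *\<^sub>R H x) (\<lambda>x. 1 *\<^sub>R (G0 x + vfield_jac (p n) (q n) x) + (-t) *\<^sub>R H x)"
          unfolding J_def case_prod_conv vfield_jac_lincomb[OF s(1) sab(1) s(2) sab(2)] H_def by (simp add: algebra_simps)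
        also have "\<dots> = J (p n, q n) - 2 * t * energy lam mu (\<lambda>x. G0 x + vfield_jac (p n) (q n) x) H + t\<^sup>2 * energy lam mu H H"
          unfolding energy_quadratic[OF adm sumL2[OF pq] H] J_def by simp
        finally show ?thesis .
      qed
      moreover have "(\<lambda>n. J (p n, q n) - 2 * t * energy lam mu (\<lambda>x. G0 x + vfield_jac (p n) (q n) x) H + t\<^sup>2 * energy lam mu H H)
         \<longlonglongrightarrow> m - 2 * t * energy lam mu (\<lambda>x. G0 x + G x) H + t\<^sup>2 * energy lam mu H H"
        by (intro tendsto_add tendsto_diff tendsto_mult_left tendsto_const Jlim energy_lim[OF adm limA] L2_lim_const mat_L2_D H)
      ultimately have "m \<le> m - 2 * t * energy lam mu (\<lambda>x. G0 x + G x) H + t\<^sup>2 * energy lam mu H H"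
        by (intro LIMSEQ_le_const) auto
      then show ?thesis by simp
    qed
    then have "(energy lam mu (\<lambda>x. G0 x + G x) H)\<^sup>2 \<le> 0 * energy lam mu H H"
      by (rule nonneg_quadratic_discriminant) (rule e0[OF H])
    then show ?thesis by (simp add: H_def)
  qed
  have "energy lam mu (Jac u) (Jac v) = 0" if v: "v \<in> W 0" for v
  proof -
    obtain a b where ab: "\<And>n. (a n, b n) \<in> trig_fields"
      and lim: "\<And>i j. L2_lim (\<lambda>n x. vfield_jac (a n) (b n) x $ i $ j) (\<lambda>x. Jac v x $ i $ j)"
      using trig_fields_dense[OF v] by blast
    have "(\<lambda>n. energy lam mu (\<lambda>x. G0 x + G x) (vfield_jac (a n) (b n))) \<longlonglongrightarrow> energy lam mu (\<lambda>x. G0 x + G x) (Jac v)"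
      by (intro energy_lim[OF adm _ lim] L2_lim_const mat_L2_D G0G)
    then have "energy lam mu (\<lambda>x. G0 x + G x) (Jac v) = 0"
      by (simp add: var[OF ab] LIMSEQ_const_iff)
    then show ?thesis
      using energy_cong_AE[OF adm mat_L2_Jac[OF W_H1[OF uW]] G0G mat_L2_Jac[OF W_H1[OF v]] uG] by simp
  qed
  then show ?thesis using uW tensile_solution_iff[OF adm] by blast
qed

section \<open>The tensile force\<close>

definition diag_field :: "real \<Rightarrow> real \<Rightarrow> real^2 \<Rightarrow> real^2^2" where
  "diag_field a b x = vector [vector [a, 0], vector [0, b]]"

lemma diag_field_nth [simp]: "diag_field a b x $ 1 $ 1 = a" "diag_field a b x $ 2 $ 2 = b" "diag_field a b x $ 1 $ 2 = 0" "diag_field a b x $ 2 $ 1 = 0"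
  by (simp_all add: diag_field_def)

lemma mat_L2_diag_field: "mat_L2 (diag_field a b)"
  unfolding mat_L2_def all_2_matrix by (simp add: L2_const)

lemma energy_diag_field:
  "energy lam mu G (diag_field a b) = (a + b) * (LINT x|LO. lam x * mtr (G x))
    + 2 * mu * (a * (LINT x|LO. G x $1$1) + b * (LINT x|LO. G x $2$2))"
  by (simp add: energy_def)

lemma LINT_first_coordinate: "(LINT x|LO. x$1 - 1/2) = 0"
proof -
  have "((\<lambda>s. s - 1/2) has_integral ((1\<^sup>2/2 - 1/2 * 1) - (0\<^sup>2/2 - 1/2 * 0))) {0..1::real}"
    by (rule fundamental_theorem_of_calculus)
       (auto intro!: derivative_eq_intros simp flip: has_real_derivative_iff_has_vector_derivative)
  then have "integral {0..1} (\<lambda>s. s - 1/2) = (0::real)" by (simp add: integral_unique)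
  moreover have "continuous_on UNIV (\<lambda>x::real^2. x$1 - 1/2)" by (intro continuous_intros)
  ultimately show ?thesis by (simp add: LINT_Omega_iterated)
qed

text \<open>Affine fields serve as test fields and as the solutions for homogeneous materials.\<close>

lemma affine_field:
  obtains U where "U \<in> W b" "weak_jacobian U (diag_field a b)"
proof -
  define p :: "real^2 \<Rightarrow> real" where "p = (\<lambda>x. a * (x$1 - 1/2))"
  define q :: "real^2 \<Rightarrow> real" where "q = (\<lambda>x. b * x$2)"
  have s: "smooth p" "smooth q"
    unfolding p_def q_def by (intro smooth_cmult smooth_diff smooth_coord smooth_const)+
  have d: "((\<lambda>t. a * (t - 1/2)) has_real_derivative a) (at t)" "((\<lambda>t. b * t) has_real_derivative b) (at t)" for t
    by (auto intro!: derivative_eq_intros)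
  have "vfield_jac p q x = diag_field a b x" for x
    unfolding vec_eq_iff forall_2 vfield_jac_nth p_def q_def
    by (simp add: partial_coord(1)[OF d(1)] partial_coord(1)[OF d(2)])
  then have "weak_jacobian (vfield p q) (diag_field a b)"
    using weak_jacobian_vfield[OF s] by (metis ext)
  moreover have "vfield p q \<in> W b"
    by (rule vfield_W[OF s]) (simp_all add: p_def q_def LINT_first_coordinate)
  ultimately show ?thesis using that by blast
qed

definition force :: "(real^2 \<Rightarrow> real) \<Rightarrow> real \<Rightarrow> (real^2 \<Rightarrow> real^2) \<Rightarrow> real" where
  "force lam mu u = (LINT x|LO. lam x * mtr (Jac u x)) + 2 * mu * (LINT x|LO. Jac u x $2$2)"

lemma LINT_force:
  assumes "admissible lam" "u \<in> H1"
  shows "(LINT x|LO. lam x * trace (sym_grad u x) + 2 * mu * Jac u x $2$2) = force lam mu u"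
  using L2_integrable[OF admissible_mult_L2[OF assms(1) mat_L2_parts(1)[OF mat_L2_Jac[OF assms(2)]]]]
    L2_integrable[OF Jac_L2[OF assms(2)]]
  by (simp add: trace_sym_grad force_def mult.assoc)

text \<open>Integration by parts against the constant \<open>1\<close>.\<close>

lemma W_mean_strain:
  assumes "u \<in> W l" shows "(LINT x|LO. Jac u x $2$2) = l"
proof -
  have "weak_gradient (\<lambda>x. u x $ 2) (\<lambda>x. Jac u x $ 2)"
    using weak_jacobian_Jac[OF W_H1[OF assms]] by (simp add: weak_jacobian_def)
  from trace_by_parts[OF _ _ this smooth_const[of 1], of l] assms
  show ?thesis by (simp add: W_def partial_eqI[OF has_derivative_const])
qed

context
  fixes lam :: "real^2 \<Rightarrow> real" and mu l :: real and u :: "real^2 \<Rightarrow> real^2"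
  assumes adm: "admissible lam" and sol: "tensile_solution lam (\<lambda>_. mu) l u"
begin

lemma solution_W: "u \<in> W l" and solution_eq: "v \<in> W 0 \<Longrightarrow> energy lam mu (Jac u) (Jac v) = 0"
  using sol tensile_solution_iff[OF adm] by auto

lemma solution_mat_L2: "mat_L2 (Jac u)"
  by (rule mat_L2_Jac[OF W_H1[OF solution_W]])

lemma solution_same_energy:
  assumes "U \<in> W l" "U' \<in> W l"
  shows "energy lam mu (Jac u) (Jac U) = energy lam mu (Jac u) (Jac U')"
proof -
  note H = W_H1[OF assms(1)] W_H1[OF assms(2)]
  note L = mat_L2_Jac[OF H(1)] mat_L2_Jac[OF H(2)]
  have D: "(\<lambda>x. U x - U' x) \<in> W 0" by (rule W_diff[OF assms])
  have "AE x in LO. 1 *\<^sub>R Jac U x + (-1) *\<^sub>R Jac U' x = Jac (\<lambda>x. U x - U' x) x"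
    using Jac_diff[OF H] by eventually_elim simp
  then have "energy lam mu (\<lambda>x. 1 *\<^sub>R Jac U x + (-1) *\<^sub>R Jac U' x) (Jac u) = energy lam mu (Jac (\<lambda>x. U x - U' x)) (Jac u)"
    by (intro energy_cong_AE adm mat_L2_lincomb L solution_mat_L2 mat_L2_Jac[OF W_H1[OF D]])
  also have "\<dots> = 0" using solution_eq[OF D] by (simp add: energy_commute)
  finally show ?thesis
    unfolding energy_lincomb[OF adm L solution_mat_L2] by (simp add: energy_commute)
qed

lemma energy_Jac_affine:
  assumes "weak_jacobian U (diag_field a b)"
  shows "energy lam mu (Jac u) (Jac U) = energy lam mu (Jac u) (diag_field a b)"
  unfolding energy_commute[of _ _ "Jac u"]
  by (rule energy_cong_AE[OF adm mat_L2_Jac[OF weak_jacobian_H1[OF assms]] mat_L2_diag_field solution_mat_L2 Jac_AE[OF assms]])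

text \<open>The force is the energy product with \<open>(0, x\<^sub>2)\<close>, and \<open>(0, l x\<^sub>2)\<close> has the same boundary values as
  \<open>U\<close>.\<close>

lemma solution_energy:
  assumes "U \<in> W l" shows "energy lam mu (Jac u) (Jac U) = l * force lam mu u"
proof -
  obtain U0 where U0: "U0 \<in> W l" "weak_jacobian U0 (diag_field 0 l)" using affine_field by blast
  have "energy lam mu (Jac u) (Jac U) = energy lam mu (Jac u) (diag_field 0 l)"
    using solution_same_energy[OF assms U0(1)] energy_Jac_affine[OF U0(2)] by simp
  then show ?thesis by (simp add: energy_diag_field force_def algebra_simps)
qed

text \<open>The lateral edges are free, so the averaged normal stress in the first direction vanishes.\<close>

lemma solution_lateral: "(LINT x|LO. lam x * mtr (Jac u x)) + 2 * mu * (LINT x|LO. Jac u x $1$1) = 0"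
proof -
  obtain V where V: "V \<in> W 0" "weak_jacobian V (diag_field 1 0)" using affine_field by blast
  show ?thesis using solution_eq[OF V(1)] energy_Jac_affine[OF V(2)] by (simp add: energy_diag_field)
qed

lemma force_eq: "force lam mu u = 2 * mu * (l - (LINT x|LO. Jac u x $1$1))"
  using solution_lateral W_mean_strain[OF solution_W] by (simp add: force_def algebra_simps)

text \<open>Two solutions have the same force: \<open>l\<close> times either force is the energy product of the two, which is
  symmetric.\<close>

lemma tensile_force_eq:
  assumes "l > 0" shows "tensile_force lam (\<lambda>_. mu) l = force lam mu u"
  unfolding tensile_force_def
proof (rule the_equality)
  show "\<exists>u'. tensile_solution lam (\<lambda>_. mu) l u' \<and> force lam mu u =
      (LINT x|LO. lam x * trace (sym_grad u' x) + 2 * mu * Jac u' x $ 2 $ 2)"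
    using sol LINT_force[OF adm W_H1[OF solution_W]] by auto
next
  fix F assume "\<exists>u'. tensile_solution lam (\<lambda>_. mu) l u' \<and> F =
      (LINT x|LO. lam x * trace (sym_grad u' x) + 2 * mu * Jac u' x $ 2 $ 2)"
  then obtain u' where sol': "tensile_solution lam (\<lambda>_. mu) l u'" and
    F': "F = (LINT x|LO. lam x * trace (sym_grad u' x) + 2 * mu * Jac u' x $ 2 $ 2)" by blast
  from sol' have u': "u' \<in> W l" "\<And>v. v \<in> W 0 \<Longrightarrow> energy lam mu (Jac u') (Jac v) = 0"
    using tensile_solution_iff[OF adm] by auto
  have F: "F = force lam mu u'" unfolding F' by (rule LINT_force[OF adm W_H1[OF u'(1)]])
  obtain U0 where U0: "U0 \<in> W l" "weak_jacobian U0 (diag_field 0 l)" using affine_field by blast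
  have m': "mat_L2 (Jac u')" by (rule mat_L2_Jac[OF W_H1[OF u'(1)]])
  have D: "(\<lambda>x. u x - U0 x) \<in> W 0" by (rule W_diff[OF solution_W U0(1)])
  have "AE x in LO. 1 *\<^sub>R Jac u x + (-1) *\<^sub>R diag_field 0 l x = Jac (\<lambda>x. u x - U0 x) x"
    using Jac_diff[OF W_H1[OF solution_W] W_H1[OF U0(1)]] Jac_AE[OF U0(2)] by eventually_elim simp
  then have "energy lam mu (\<lambda>x. 1 *\<^sub>R Jac u x + (-1) *\<^sub>R diag_field 0 l x) (Jac u') = energy lam mu (Jac (\<lambda>x. u x - U0 x)) (Jac u')"
    by (intro energy_cong_AE adm mat_L2_lincomb mat_L2_diag_field m' solution_mat_L2 mat_L2_Jac[OF W_H1[OF D]])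
  also have "\<dots> = 0" using u'(2)[OF D] by (simp add: energy_commute)
  finally have "energy lam mu (Jac u) (Jac u') = energy lam mu (Jac u') (diag_field 0 l)"
    unfolding energy_lincomb[OF adm solution_mat_L2 mat_L2_diag_field m'] by (simp add: energy_commute)
  then have "l * force lam mu u = l * force lam mu u'"
    using solution_energy[OF u'(1)] by (simp add: energy_diag_field force_def[of _ _ u'] algebra_simps)
  then show "F = force lam mu u" using F assms by simp
qed

end

lemma solution_minimises:
  assumes adm: "admissible lam" and mu: "mu > 0" and sol: "tensile_solution lam (\<lambda>_. mu) l u" and U: "U \<in> W l"
  shows "l * force lam mu u \<le> energy lam mu (Jac U) (Jac U)"
proof -
  note m = solution_mat_L2[OF adm sol] mat_L2_Jac[OF W_H1[OF U]]
  have "0 \<le> energy lam mu (\<lambda>x. 1 *\<^sub>R Jac U x + (-1) *\<^sub>R Jac u x) (\<lambda>x. 1 *\<^sub>R Jac U x + (-1) *\<^sub>R Jac u x)"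
    by (rule order_trans[OF _ energy_ge[OF adm mat_L2_lincomb[OF m(2,1)] mu]])
       (use mu in \<open>auto intro!: mult_nonneg_nonneg add_nonneg_nonneg\<close>)
  also have "\<dots> = energy lam mu (Jac U) (Jac U) - 2 * energy lam mu (Jac u) (Jac U) + energy lam mu (Jac u) (Jac u)"
    unfolding energy_quadratic[OF adm m(2,1)] by (simp add: energy_commute)
  also have "\<dots> = energy lam mu (Jac U) (Jac U) - l * force lam mu u"
    using solution_energy[OF adm sol U] solution_energy[OF adm sol solution_W[OF adm sol]] by simp
  finally show ?thesis by simp
qed

text \<open>The force is, up to the factor \<open>l\<close>, the minimal energy, and the energy increases with the parameter.\<close>

lemma tensile_force_mono:
  assumes "admissible lam" "admissible lam'" "mu > 0" "l > 0" and le: "\<And>x. x \<in> Omega \<Longrightarrow> lam x \<le> lam' x"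
  shows "tensile_force lam (\<lambda>_. mu) l \<le> tensile_force lam' (\<lambda>_. mu) l"
proof -
  obtain u where u: "tensile_solution lam (\<lambda>_. mu) l u" using tensile_solution_exists assms by blast
  obtain u' where u': "tensile_solution lam' (\<lambda>_. mu) l u'" using tensile_solution_exists assms by blast
  note W' = solution_W[OF assms(2) u'] and m' = solution_mat_L2[OF assms(2) u']
  have "l * force lam mu u \<le> energy lam mu (Jac u') (Jac u')"
    by (rule solution_minimises[OF assms(1,3) u W'])
  also have "\<dots> \<le> energy lam' mu (Jac u') (Jac u')"
  proof -
    have "(LINT x|LO. (lam x * mtr (Jac u' x)) * mtr (Jac u' x)) \<le> (LINT x|LO. (lam' x * mtr (Jac u' x)) * mtr (Jac u' x))"
      by (intro integral_mono_AE AE_LO_I L2_mult_integrable admissible_mult_L2 assms mat_L2_parts m')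
         (use le in \<open>auto simp: mult.assoc intro!: mult_right_mono\<close>)
    then show ?thesis by (simp add: energy_def)
  qed
  also have "\<dots> = l * force lam' mu u'" by (rule solution_energy[OF assms(2) u' W'])
  finally have "force lam mu u \<le> force lam' mu u'" using assms(4) by simp
  then show ?thesis
    using tensile_force_eq[OF assms(1) u assms(4)] tensile_force_eq[OF assms(2) u' assms(4)] by simp
qed

subsection \<open>Homogeneous material\<close>

lemma admissible_const: "c \<ge> 0 \<Longrightarrow> admissible (\<lambda>_. c)"
  by (auto simp: admissible_def)

text \<open>The force of a homogeneous material with first Lame parameter \<open>c\<close>.\<close>

definition const_force :: "real \<Rightarrow> real \<Rightarrow> real \<Rightarrow> real" where
  "const_force mu l c = 4 * mu * l * (c + mu) / (c + 2 * mu)"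

text \<open>The update rule of the embedded cell algorithm. It inverts \<open>const_force\<close>: its value is the parameter
  of the homogeneous material with the given force.\<close>

definition force_to_lame :: "real \<Rightarrow> real \<Rightarrow> real \<Rightarrow> real" where
  "force_to_lame mu l F = (F - 2 * mu * l) / (2 * l - F / (2 * mu))"

text \<open>The lateral strain for which the normal stress in the first direction is zero.\<close>

definition lateral :: "real \<Rightarrow> real \<Rightarrow> real \<Rightarrow> real" where
  "lateral mu l c = - (c * l / (c + 2 * mu))"

lemma const_solution:
  assumes "c > 0" "mu > 0" "U \<in> W l" "weak_jacobian U (diag_field (lateral mu l c) l)"
  shows "tensile_solution (\<lambda>_. c) (\<lambda>_. mu) l U"
proof -
  have adm: "admissible (\<lambda>_. c)" using assms(1) by (simp add: admissible_const)
  have "energy (\<lambda>_. c) mu (Jac U) (Jac v) = 0" if v: "v \<in> W 0" for v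
  proof -
    note H = W_H1[OF v]
    have "energy (\<lambda>_. c) mu (Jac U) (Jac v) = energy (\<lambda>_. c) mu (diag_field (lateral mu l c) l) (Jac v)"
      by (rule energy_cong_AE[OF adm mat_L2_Jac[OF weak_jacobian_H1[OF assms(4)]] mat_L2_diag_field mat_L2_Jac[OF H] Jac_AE[OF assms(4)]])
    also have "\<dots> = energy (\<lambda>_. c) mu (Jac v) (diag_field (lateral mu l c) l)" by (rule energy_commute)
    also have "\<dots> = (lateral mu l c + l) * (c * (LINT x|LO. Jac v x $1$1)) + 2 * mu * (lateral mu l c * (LINT x|LO. Jac v x $1$1))"
      using W_mean_strain[OF v] L2_integrable[OF Jac_L2[OF H]] by (simp add: energy_diag_field distrib_left)
    also have "\<dots> = (c * (lateral mu l c + l) + 2 * mu * lateral mu l c) * (LINT x|LO. Jac v x $1$1)"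
      by (simp add: algebra_simps)
    also have "c * (lateral mu l c + l) + 2 * mu * lateral mu l c = 0"
      using assms(1,2) by (simp add: lateral_def field_simps)
    finally show ?thesis by simp
  qed
  then show ?thesis using assms(3) tensile_solution_iff[OF adm] by blast
qed

lemma tensile_force_const:
  assumes "c > 0" "mu > 0" "l > 0"
  shows "tensile_force (\<lambda>_. c) (\<lambda>_. mu) l = const_force mu l c"
proof -
  obtain U where U: "U \<in> W l" "weak_jacobian U (diag_field (lateral mu l c) l)" using affine_field by blast
  have adm: "admissible (\<lambda>_. c)" using assms(1) by (simp add: admissible_const)
  have AE: "AE x in LO. Jac U x $1$1 = lateral mu l c" using Jac_AE[OF U(2)] by eventually_elim simp
  have "(LINT x|LO. Jac U x $1$1) = (LINT x|LO. lateral mu l c)"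
    by (rule integral_cong_AE) (use AE L2_measurable[OF Jac_L2[OF W_H1[OF U(1)]]] in auto)
  then have "force (\<lambda>_. c) mu U = 2 * mu * (l - lateral mu l c)"
    using force_eq[OF adm const_solution[OF assms(1,2) U]] by simp
  also have "\<dots> = const_force mu l c"
    using assms by (simp add: lateral_def const_force_def field_simps)
  finally show ?thesis
    using tensile_force_eq[OF adm const_solution[OF assms(1,2) U] assms(3)] by simp
qed

lemma const_force_props:
  assumes "c > 0" "mu > 0" "l > 0"
  shows "2 * l - const_force mu l c / (2 * mu) = 2 * l * mu / (c + 2 * mu)"
    "const_force mu l c - 2 * mu * l = 2 * l * mu / (c + 2 * mu) * c"
    "force_to_lame mu l (const_force mu l c) = c"
proof -
  show 1: "2 * l - const_force mu l c / (2 * mu) = 2 * l * mu / (c + 2 * mu)"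
    using assms by (simp add: const_force_def divide_simps) (simp add: algebra_simps)
  show 2: "const_force mu l c - 2 * mu * l = 2 * l * mu / (c + 2 * mu) * c"
    using assms by (simp add: const_force_def divide_simps) (simp add: algebra_simps)
  show "force_to_lame mu l (const_force mu l c) = c"
    unfolding force_to_lame_def 1 2 using assms by simp
qed

lemma const_force_Lipschitz:
  assumes "c > 0" "c' > 0" "mu > 0" "l > 0"
  shows "\<bar>const_force mu l c - const_force mu l c'\<bar> \<le> l * \<bar>c - c'\<bar>"
proof -
  define X where "X = 4 * mu\<^sup>2 / ((c + 2 * mu) * (c' + 2 * mu))"
  have "const_force mu l c - const_force mu l c' = l * (c - c') * X"
    unfolding X_def
    using assms by (simp add: const_force_def divide_simps) (simp add: algebra_simps power2_eq_square)
  moreover have "X \<le> 1" "0 \<le> X"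
  proof -
    have "2 * mu * (2 * mu) \<le> (c + 2 * mu) * (c' + 2 * mu)" using assms by (intro mult_mono) auto
    then show "X \<le> 1"
      using assms by (simp add: X_def power2_eq_square)
    show "0 \<le> X" using assms by (simp add: X_def)
  qed
  ultimately show ?thesis
    using assms by (simp add: abs_mult mult_left_le)
qed

lemma force_to_lame_mono:
  assumes "F \<le> F'" "2 * l - F' / (2 * mu) > 0" "2 * mu * l \<le> F" "mu > 0"
  shows "force_to_lame mu l F \<le> force_to_lame mu l F'"
  unfolding force_to_lame_def
  using assms by (intro frac_le) (auto simp: divide_right_mono)

subsection \<open>Expansion about a homogeneous material\<close>

lemma tensile_force_range:
  assumes "admissible lam" "0 < L" "mu > 0" "l > 0" and r: "\<And>x. x \<in> Omega \<Longrightarrow> L \<le> lam x \<and> lam x \<le> R"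
  shows "const_force mu l L \<le> tensile_force lam (\<lambda>_. mu) l" "tensile_force lam (\<lambda>_. mu) l \<le> const_force mu l R"
    "L \<le> R"
proof -
  have "(\<chi> i. 1/2) \<in> Omega" by (simp add: Omega_def)
  from r[OF this] show LR: "L \<le> R" by simp
  show "const_force mu l L \<le> tensile_force lam (\<lambda>_. mu) l"
    using tensile_force_mono[OF admissible_const[of L] assms(1,3,4)] r assms by (simp add: tensile_force_const)
  show "tensile_force lam (\<lambda>_. mu) l \<le> const_force mu l R"
    using tensile_force_mono[OF assms(1) admissible_const[of R] assms(3,4)] r assms LR by (simp add: tensile_force_const)
qed

lemma lame_range:
  assumes "0 < L" "mu > 0" "l > 0" "const_force mu l L \<le> F" "F \<le> const_force mu l R" "L \<le> R"
  shows "2 * l * mu / (R + 2 * mu) \<le> 2 * l - F / (2 * mu)" "0 < 2 * l - F / (2 * mu)"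
    "L \<le> force_to_lame mu l F" "force_to_lame mu l F \<le> R"
proof -
  have R: "R > 0" using assms by simp
  have "F / (2 * mu) \<le> const_force mu l R / (2 * mu)" using assms by (intro divide_right_mono) auto
  then show 1: "2 * l * mu / (R + 2 * mu) \<le> 2 * l - F / (2 * mu)"
    using const_force_props(1)[OF R assms(2,3)] by linarith
  show 2: "0 < 2 * l - F / (2 * mu)"
    by (rule less_le_trans[OF _ 1]) (use assms R in simp)
  have "0 \<le> 2 * l * mu / (L + 2 * mu) * L" using assms by simp
  then have 3: "2 * mu * l \<le> const_force mu l L" using const_force_props(2)[OF assms(1-3)] by linarith
  show "L \<le> force_to_lame mu l F"
    using force_to_lame_mono[OF assms(4) 2 3 assms(2)] const_force_props(3)[OF assms(1-3)] by simp
  have "0 < 2 * l - const_force mu l R / (2 * mu)"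
    using const_force_props(1)[OF R assms(2,3)] assms R by simp
  from force_to_lame_mono[OF assms(5) this _ assms(2)] 3 assms(4)
  show "force_to_lame mu l F \<le> R" using const_force_props(3)[OF R assms(2,3)] by simp
qed

text \<open>The first order term of the force is an exact integral against the perturbed strain, which differs
  from the homogeneous strain by a term of first order in \<open>L\<^sup>2\<close>. The factor \<open>l \<tau>\<^sup>2\<close> is the derivative of
  \<^const>\<open>const_force\<close> at \<open>L\<close>.\<close>

lemma tensile_force_expansion:
  assumes adm: "admissible lam" and L: "0 < L" and mu: "mu > 0" and l: "l > 0" and d: "\<delta> \<ge> 0"
    and r: "\<And>x. x \<in> Omega \<Longrightarrow> L \<le> lam x \<and> lam x \<le> L + \<delta>"
  defines "\<tau> \<equiv> 2 * mu / (L + 2 * mu)"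
  obtains s where "tensile_force lam (\<lambda>_. mu) l = const_force mu l L + l * \<tau>\<^sup>2 * s"
    "\<bar>s - (LINT x|LO. lam x - L)\<bar> \<le> \<delta>\<^sup>2 / L"
proof -
  obtain u where u: "tensile_solution lam (\<lambda>_. mu) l u" using tensile_solution_exists[OF adm mu] by blast
  define a where "a = lateral mu l L"
  obtain U where U: "U \<in> W l" "weak_jacobian U (diag_field a l)" using affine_field by blast
  have admL: "admissible (\<lambda>_. L)" using L by (simp add: admissible_const)
  have solU: "tensile_solution (\<lambda>_. L) (\<lambda>_. mu) l U" using const_solution[OF L mu] U unfolding a_def by blast
  have \<tau>: "\<tau> > 0" using L mu by (simp add: \<tau>_def)
  have al: "a + l = l * \<tau>" unfolding a_def lateral_def \<tau>_def using L mu by (simp add: field_simps)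
  define F where "F = force lam mu u"
  define F0 where "F0 = force (\<lambda>_. L) mu U"
  have F: "tensile_force lam (\<lambda>_. mu) l = F" unfolding F_def by (rule tensile_force_eq[OF adm u l])
  have F0: "F0 = const_force mu l L"
    using tensile_force_eq[OF admL solU l] tensile_force_const[OF L mu l] by (simp add: F0_def)
  note uW = solution_W[OF adm u] and um = solution_mat_L2[OF adm u]
  define T where "T x = mtr (Jac u x)" for x
  define t where "t x = T x - l * \<tau>" for x
  have TL2: "T \<in> L2" unfolding T_def by (rule mat_L2_parts(1)[OF um])
  have tL2: "t \<in> L2" unfolding t_def[abs_def] by (intro L2_diff TL2 L2_const)
  define h where "h x = lam x - L" for x
  obtain hm: "lam \<in> borel_measurable LO" using adm by (simp add: admissible_def)
  have hb: "0 \<le> h x \<and> h x \<le> \<delta>" if "x \<in> Omega" for x using r[OF that] by (simp add: h_def)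
  have hL2: "h \<in> L2"
    by (rule L2_bounded[where B=\<delta>]) (use hm hb in \<open>auto simp: h_def[abs_def]\<close>)
  have hT: "integrable LO (\<lambda>x. h x * T x)" "integrable LO (\<lambda>x. h x * t x)"
    by (intro L2_mult_integrable hL2 TL2 tL2)+
  have ht_bound: "\<bar>LINT x|LO. h x * t x\<bar> \<le> \<delta> * L2_norm t"
  proof -
    have "\<bar>LINT x|LO. h x * t x\<bar> \<le> (LINT x|LO. \<bar>h x * t x\<bar>)" by (rule integral_abs_bound)
    also have "\<dots> \<le> (LINT x|LO. \<delta> * \<bar>t x\<bar>)"
    proof (intro integral_mono_AE AE_LO_I)
      show "integrable LO (\<lambda>x. \<bar>h x * t x\<bar>)" using hT(2) by (rule integrable_abs)
      show "integrable LO (\<lambda>x. \<delta> * \<bar>t x\<bar>)" using L2_integrable[OF tL2] by simp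
      show "\<bar>h x * t x\<bar> \<le> \<delta> * \<bar>t x\<bar>" if "x \<in> Omega" for x
        using hb[OF that] by (simp add: abs_mult mult_right_mono)
    qed
    also have "\<dots> \<le> \<delta> * L2_norm t" using L1_le_L2[OF tL2] d by (simp add: mult_left_mono)
    finally show ?thesis .
  qed
  (* Both forces are energy products of the same two solutions, but for different parameters.
     So their difference is an integral of lam - L against the traces of the two strains, one of which
     is known. *)
  have e1: "l * F = energy lam mu (Jac u) (diag_field a l)"
    unfolding F_def using solution_energy[OF adm u U(1)] energy_Jac_affine[OF adm u U(2)] by simp
  have e2: "l * F0 = energy (\<lambda>_. L) mu (Jac u) (diag_field a l)"
  proof -
    have "l * F0 = energy (\<lambda>_. L) mu (Jac U) (Jac u)"
      unfolding F0_def using solution_energy[OF admL solU uW] by simp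
    also have "\<dots> = energy (\<lambda>_. L) mu (diag_field a l) (Jac u)"
      by (rule energy_cong_AE[OF admL mat_L2_Jac[OF W_H1[OF U(1)]] mat_L2_diag_field um Jac_AE[OF U(2)]])
    finally show ?thesis by (simp add: energy_commute)
  qed
  have lamT: "integrable LO (\<lambda>x. lam x * T x)"
    using L2_integrable[OF admissible_mult_L2[OF adm TL2]] .
  have "l * F - l * F0 = (a + l) * ((LINT x|LO. lam x * T x) - (LINT x|LO. L * T x))"
    unfolding e1 e2 energy_diag_field T_def by (simp add: algebra_simps)
  also have "(LINT x|LO. lam x * T x) - (LINT x|LO. L * T x) = (LINT x|LO. h x * T x)"
    using lamT L2_integrable[OF TL2] by (simp add: h_def left_diff_distrib)
  finally have FF: "F - F0 = \<tau> * (LINT x|LO. h x * T x)"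
    using l al by (simp add: right_diff_distrib[symmetric])
  have hTt: "(LINT x|LO. h x * T x) = l * \<tau> * (LINT x|LO. h x) + (LINT x|LO. h x * t x)"
  proof -
    have "(LINT x|LO. h x * T x) = (LINT x|LO. l * \<tau> * h x + h x * t x)"
      by (rule Bochner_Integration.integral_cong) (auto simp: t_def algebra_simps)
    then show ?thesis using hT L2_integrable[OF hL2] by simp
  qed
  (* The energy of the difference of the two strains is linear in t, but bounds its square. *)
  have "L * (L2_norm t)\<^sup>2 \<le> energy lam mu (\<lambda>x. 1 *\<^sub>R Jac u x + (-1) *\<^sub>R diag_field a l x) (\<lambda>x. 1 *\<^sub>R Jac u x + (-1) *\<^sub>R diag_field a l x)"
  proof -
    have m: "mat_L2 (\<lambda>x. 1 *\<^sub>R Jac u x + (-1) *\<^sub>R diag_field a l x)" by (rule mat_L2_lincomb[OF um mat_L2_diag_field])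
    have tt: "mtr (1 *\<^sub>R Jac u x + (-1) *\<^sub>R diag_field a l x) = t x" for x
      using al by (simp add: t_def T_def)
    have "L * (L2_norm t)\<^sup>2 = (LINT x|LO. L * (t x)\<^sup>2)" by (simp add: L2_norm_sq)
    also have "\<dots> \<le> (LINT x|LO. (lam x * t x) * t x)"
    proof (intro integral_mono_AE AE_LO_I)
      show "integrable LO (\<lambda>x. L * (t x)\<^sup>2)" using L2_square_integrable[OF tL2] by simp
      show "integrable LO (\<lambda>x. lam x * t x * t x)" by (intro L2_mult_integrable admissible_mult_L2 adm tL2)
      show "L * (t x)\<^sup>2 \<le> lam x * t x * t x" if "x \<in> Omega" for x
        using r[OF that] by (simp add: power2_eq_square mult.assoc mult_right_mono)
    qed
    also have "\<dots> \<le> energy lam mu (\<lambda>x. 1 *\<^sub>R Jac u x + (-1) *\<^sub>R diag_field a l x) (\<lambda>x. 1 *\<^sub>R Jac u x + (-1) *\<^sub>R diag_field a l x)"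
      unfolding energy_def tt using mu by (simp flip: power2_eq_square)
    finally show ?thesis .
  qed
  also have "\<dots> = energy lam mu (Jac u) (Jac u) - 2 * energy lam mu (Jac u) (diag_field a l) + energy lam mu (diag_field a l) (diag_field a l)"
    unfolding energy_quadratic[OF adm um mat_L2_diag_field] by simp
  also have "\<dots> = energy lam mu (diag_field a l) (diag_field a l) - l * F"
    using e1 solution_energy[OF adm u uW] by (simp add: F_def)
  also have "energy lam mu (diag_field a l) (diag_field a l) = l * F0 + (l * \<tau>)\<^sup>2 * (LINT x|LO. h x)"
  proof -
    have "integrable LO lam" using Bochner_Integration.integrable_add[OF L2_integrable[OF hL2], of "\<lambda>_. L"] by (simp add: h_def)
    then have 1: "(LINT x|LO. lam x) = L + (LINT x|LO. h x)" by (simp add: h_def)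
    have "l * F0 = energy (\<lambda>_. L) mu (Jac U) (Jac U)"
      unfolding F0_def using solution_energy[OF admL solU U(1)] by simp
    also have "\<dots> = energy (\<lambda>_. L) mu (Jac U) (diag_field a l)" by (rule energy_Jac_affine[OF admL solU U(2)])
    also have "\<dots> = energy (\<lambda>_. L) mu (diag_field a l) (diag_field a l)"
      by (rule energy_cong_AE[OF admL mat_L2_Jac[OF W_H1[OF U(1)]] mat_L2_diag_field mat_L2_diag_field Jac_AE[OF U(2)]])
    finally have "l * F0 = energy (\<lambda>_. L) mu (diag_field a l) (diag_field a l)" .
    moreover have "energy lam mu (diag_field a l) (diag_field a l) - energy (\<lambda>_. L) mu (diag_field a l) (diag_field a l) = (l * \<tau>) * ((l * \<tau>) * (LINT x|LO. h x))"
      unfolding energy_diag_field by (simp add: al 1 algebra_simps)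
    ultimately show ?thesis by (simp add: power2_eq_square)
  qed
  also have "l * F0 + (l * \<tau>)\<^sup>2 * (LINT x|LO. h x) - l * F = - (l * \<tau> * (LINT x|LO. h x * t x))"
    using FF unfolding hTt by (simp add: power2_eq_square algebra_simps)
  also have "\<dots> \<le> l * \<tau> * (\<delta> * L2_norm t)"
  proof -
    from ht_bound
    have "l * \<tau> * \<bar>LINT x|LO. h x * t x\<bar> \<le> l * \<tau> * (\<delta> * L2_norm t)" using l \<tau> by (intro mult_left_mono) auto
    moreover have "- (l * \<tau> * (LINT x|LO. h x * t x)) \<le> l * \<tau> * \<bar>LINT x|LO. h x * t x\<bar>"
      using mult_left_mono[of "- (LINT x|LO. h x * t x)" "\<bar>LINT x|LO. h x * t x\<bar>" "l * \<tau>"] l \<tau> by simp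
    ultimately show ?thesis by linarith
  qed
  finally have "L * (L2_norm t)\<^sup>2 \<le> l * \<tau> * (\<delta> * L2_norm t)" .
  then have "L2_norm t * (L * L2_norm t) \<le> L2_norm t * (l * \<tau> * \<delta>)" by (simp add: power2_eq_square mult_ac)
  then have tn: "L2_norm t \<le> l * \<tau> * \<delta> / L"
  proof (cases "L2_norm t = 0")
    case True then show ?thesis using l \<tau> d L by simp
  next
    case False
    then have "L2_norm t > 0" using L2_norm_nonneg[of t] by linarith
    then have "L * L2_norm t \<le> l * \<tau> * \<delta>"
      using \<open>L2_norm t * (L * L2_norm t) \<le> L2_norm t * (l * \<tau> * \<delta>)\<close> by simp
    then show ?thesis using L by (simp add: field_simps)
  qed
  define s where "s = (LINT x|LO. h x * T x) / (l * \<tau>)"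
  have lt: "l * \<tau> > 0" using l \<tau> by simp
  show ?thesis
  proof
    show "tensile_force lam (\<lambda>_. mu) l = const_force mu l L + l * \<tau>\<^sup>2 * s"
      using FF lt l \<tau> by (simp add: F F0 s_def power2_eq_square field_simps)
    have "s - (LINT x|LO. lam x - L) = (LINT x|LO. h x * t x) / (l * \<tau>)"
      unfolding s_def hTt using l \<tau> by (simp add: h_def[symmetric] add_divide_distrib)
    then have "\<bar>s - (LINT x|LO. lam x - L)\<bar> = \<bar>LINT x|LO. h x * t x\<bar> / (l * \<tau>)"
      using lt by (simp add: abs_divide)
    also have "\<dots> \<le> (\<delta> * (l * \<tau> * \<delta> / L)) / (l * \<tau>)"
    proof (rule divide_right_mono)
      have "\<bar>LINT x|LO. h x * t x\<bar> \<le> \<delta> * L2_norm t" by (rule ht_bound)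
      also have "\<dots> \<le> \<delta> * (l * \<tau> * \<delta> / L)" using tn d by (rule mult_left_mono)
      finally show "\<bar>LINT x|LO. h x * t x\<bar> \<le> \<delta> * (l * \<tau> * \<delta> / L)" .
    qed (use lt in simp)
    also have "\<dots> = \<delta>\<^sup>2 / L" using lt l \<tau> by (simp add: power2_eq_square)
    finally show "\<bar>s - (LINT x|LO. lam x - L)\<bar> \<le> \<delta>\<^sup>2 / L" .
  qed
qed

text \<open>In the variable \<open>s\<close> the update rule is a Moebius transformation with derivative \<open>1\<close> at the origin. Its
  pole stays away because the force is at most that of the homogeneous material \<open>R\<close>.\<close>

lemma force_to_lame_expansion:
  fixes mu l L R s :: real
  assumes L: "0 < L" and mu: "mu > 0" and l: "l > 0"
  defines "\<tau> \<equiv> 2 * mu / (L + 2 * mu)"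
  defines "F \<equiv> const_force mu l L + l * \<tau>\<^sup>2 * s"
  assumes F: "F \<le> const_force mu l R" and R: "L \<le> R"
  shows "\<bar>force_to_lame mu l F - (L + s)\<bar> \<le> s\<^sup>2 * ((R + 2 * mu) / (L + 2 * mu)\<^sup>2)"
proof -
  define P where "P = L + 2 * mu"
  have P: "P > 0" "P > 2 * mu" using L mu by (simp_all add: P_def)
  have \<tau>P: "\<tau> * P = 2 * mu" using P by (simp add: \<tau>_def P_def)
  have \<tau>: "\<tau> > 0" using P mu by (simp add: \<tau>_def flip: P_def)
  have c1: "2 * l - const_force mu l L / (2 * mu) = l * \<tau>" and c2: "const_force mu l L - 2 * mu * l = l * \<tau> * L"
    using const_force_props(1,2)[OF L mu l] by (simp_all add: \<tau>_def mult_ac)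
  have den: "2 * l - F / (2 * mu) = l * \<tau> * (1 - s / P)"
  proof -
    have "2 * l - F / (2 * mu) = l * \<tau> - l * \<tau>\<^sup>2 * s / (2 * mu)"
      unfolding F_def c1[symmetric] by (simp add: add_divide_distrib)
    also have "\<tau>\<^sup>2 * s / (2 * mu) = \<tau> * (s / P)"
      unfolding \<tau>P[symmetric] using P \<tau> by (simp add: power2_eq_square)
    then have "l * \<tau>\<^sup>2 * s / (2 * mu) = l * \<tau> * (s / P)" by (metis mult.assoc times_divide_eq_right)
    finally show ?thesis by (simp add: right_diff_distrib)
  qed
  have num: "F - 2 * mu * l = l * \<tau> * (L + \<tau> * s)"
    unfolding F_def using c2 by (simp add: power2_eq_square algebra_simps)
  have lb: "l * \<tau> * (P / (R + 2 * mu)) \<le> l * \<tau> * (1 - s / P)"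
  proof -
    have "F / (2 * mu) \<le> const_force mu l R / (2 * mu)" using F mu by (intro divide_right_mono) auto
    moreover have "2 * l - const_force mu l R / (2 * mu) = 2 * l * mu / (R + 2 * mu)"
      by (rule const_force_props(1)) (use L R mu l in auto)
    moreover have "2 * l * mu / (R + 2 * mu) = l * \<tau> * (P / (R + 2 * mu))" using \<tau>P by simp
    ultimately show ?thesis using den by linarith
  qed
  then have q: "P / (R + 2 * mu) \<le> 1 - s / P"
    by (rule mult_left_le_imp_le) (use l \<tau> in simp)
  have R2: "R + 2 * mu > 0" using L R mu by simp
  then have q0: "0 < P / (R + 2 * mu)" using P by simp
  then have pos: "1 - s / P > 0" using q by linarith
  have "force_to_lame mu l F = (L + \<tau> * s) / (1 - s / P)"
    unfolding force_to_lame_def den num using l \<tau> by simp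
  also have "\<dots> - (L + s) = ((L + \<tau> * s) - (L + s) * (1 - s / P)) / (1 - s / P)"
    by (rule divide_diff_eq_iff[OF less_imp_neq[OF pos, THEN not_sym]])
  also have "(L + \<tau> * s) - (L + s) * (1 - s / P) = s\<^sup>2 / P"
  proof -
    have "\<tau> = 1 - L / P" using P \<tau>P unfolding P_def by (simp add: field_simps)
    then have "\<tau> * s = s - L * s / P" by (simp add: left_diff_distrib)
    then show ?thesis by (simp add: power2_eq_square algebra_simps add_divide_distrib)
  qed
  finally have eq: "force_to_lame mu l F - (L + s) = s\<^sup>2 / P / (1 - s / P)" .
  have "\<bar>force_to_lame mu l F - (L + s)\<bar> = s\<^sup>2 / P / (1 - s / P)"
    unfolding eq using pos P by simp
  also have "\<dots> \<le> s\<^sup>2 / P / (P / (R + 2 * mu))"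
    by (rule divide_left_mono[OF q _ mult_pos_pos[OF pos q0]]) (use P in simp)
  also have "\<dots> = s\<^sup>2 * ((R + 2 * mu) / P\<^sup>2)" by (simp add: power2_eq_square)
  finally show ?thesis by (simp add: P_def)
qed

text \<open>The key estimate: up to second order, the homogeneous material with the same force has the averaged
  parameter, uniformly in the distribution of the material.\<close>

lemma lame_expansion:
  assumes L: "0 < L" and mu: "mu > 0" and l: "l > 0" and D: "D \<ge> 0"
  obtains K where "K \<ge> 0" "\<And>lam \<delta>. admissible lam \<Longrightarrow> 0 \<le> \<delta> \<Longrightarrow> \<delta> \<le> D \<Longrightarrow> (\<And>x. x \<in> Omega \<Longrightarrow> L \<le> lam x \<and> lam x \<le> L + \<delta>) \<Longrightarrow>
     \<bar>force_to_lame mu l (tensile_force lam (\<lambda>_. mu) l) - (L + (LINT x|LO. lam x - L))\<bar> \<le> K * \<delta>\<^sup>2"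
proof
  define Q where "Q = (L + D + 2 * mu) / (L + 2 * mu)\<^sup>2"
  define K where "K = (1 + D / L)\<^sup>2 * Q + 1 / L"
  have Q: "Q \<ge> 0" using L mu D by (simp add: Q_def)
  show "K \<ge> 0" using L D Q by (simp add: K_def)
  fix lam \<delta>
  assume adm: "admissible lam" and d: "0 \<le> \<delta>" "\<delta> \<le> D" and r: "\<And>x. x \<in> Omega \<Longrightarrow> L \<le> lam x \<and> lam x \<le> L + \<delta>"
  define I where "I = (LINT x|LO. lam x - L)"
  obtain s where s: "tensile_force lam (\<lambda>_. mu) l = const_force mu l L + l * (2 * mu / (L + 2 * mu))\<^sup>2 * s"
    "\<bar>s - I\<bar> \<le> \<delta>\<^sup>2 / L"
    using tensile_force_expansion[OF adm L mu l d(1) r] unfolding I_def by blast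
  have I: "\<bar>I\<bar> \<le> \<delta>"
  proof -
    have m: "(\<lambda>x. lam x - L) \<in> borel_measurable LO" using adm by (auto simp: admissible_def)
    have "integrable LO (\<lambda>x. lam x - L)"
      by (rule bounded_integrable_LO[OF m, where B=\<delta>]) (use r in \<open>auto simp: abs_le_iff algebra_simps\<close>)
    then have "I \<le> (LINT x|LO. \<delta>)"
      unfolding I_def by (intro integral_mono_AE AE_LO_I) (use r in \<open>auto simp: algebra_simps\<close>)
    moreover have "0 \<le> I" unfolding I_def by (intro integral_nonneg_AE AE_LO_I) (use r in simp)
    ultimately show ?thesis by simp
  qed
  have r': "\<And>x. x \<in> Omega \<Longrightarrow> L \<le> lam x \<and> lam x \<le> L + D" using r d by fastforce
  have F: "tensile_force lam (\<lambda>_. mu) l \<le> const_force mu l (L + D)"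
    by (rule tensile_force_range(2)[OF adm L mu l r'])
  have 1: "\<bar>force_to_lame mu l (tensile_force lam (\<lambda>_. mu) l) - (L + s)\<bar> \<le> s\<^sup>2 * Q"
    using force_to_lame_expansion[OF L mu l, of s "L + D"] F D unfolding s(1) Q_def by simp
  have "\<delta>\<^sup>2 / L \<le> \<delta> * (D / L)"
    using d L by (simp add: power2_eq_square divide_right_mono mult_left_mono)
  then have "\<bar>s\<bar> \<le> \<delta> * (1 + D / L)" using s(2) I by (simp add: distrib_left)
  then have "s\<^sup>2 \<le> (\<delta> * (1 + D / L))\<^sup>2"
    using abs_le_square_iff[of s "\<delta> * (1 + D / L)"] by linarith
  then have "s\<^sup>2 * Q \<le> (\<delta> * (1 + D / L))\<^sup>2 * Q" using Q by (rule mult_right_mono)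
  then have "\<bar>force_to_lame mu l (tensile_force lam (\<lambda>_. mu) l) - (L + I)\<bar> \<le> (\<delta> * (1 + D / L))\<^sup>2 * Q + \<delta>\<^sup>2 / L"
    using 1 s(2) by linarith
  also have "\<dots> = K * \<delta>\<^sup>2"
    unfolding K_def power_mult_distrib by (simp add: distrib_left mult_ac)
  finally show "\<bar>force_to_lame mu l (tensile_force lam (\<lambda>_. mu) l) - (L + (LINT x|LO. lam x - L))\<bar> \<le> K * \<delta>\<^sup>2"
    unfolding I_def .
qed

section \<open>The embedded cell algorithm\<close>

lemma LINT_indicator:
  assumes "A \<in> sets lebesgue" "A \<subseteq> Omega"
  shows "(LINT x|LO. indicator A x) = measure lebesgue A" "indicat_real A \<in> borel_measurable LO"
proof -
  have "A \<in> sets LO" using assms by (auto simp: sets_restrict_space_iff)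
  then show "(LINT x|LO. indicator A x) = measure lebesgue A"
    using assms by (simp add: measure_restrict_space Int_absorb2)
  show "indicat_real A \<in> borel_measurable LO"
    using \<open>A \<in> sets LO\<close> by (rule borel_measurable_indicator)
qed

lemma cball_center_subset: "r \<le> 1/10 \<Longrightarrow> cball center r \<subseteq> Omega"
proof
  fix x assume r: "r \<le> 1/10" and "x \<in> cball center r"
  then have "norm (x - center) \<le> r" by (simp add: dist_norm norm_minus_commute)
  then have "\<bar>(x - center) $ i\<bar> \<le> 1/10" for i
    using component_le_norm_cart[of "x - center" i] r by linarith
  from this[of 1] this[of 2] have "\<bar>x$1 - 1/2\<bar> \<le> 1/10" "\<bar>x$2 - 1/2\<bar> \<le> 1/10" by (simp_all add: center_def)
  then show "x \<in> Omega" unfolding Omega_def mem_Collect_eq by (intro conjI; linarith)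
qed

lemma Omega_lmeasurable: "Omega \<in> lmeasurable"
  unfolding Omega_box by (rule lmeasurable_box)

text \<open>If the metal region is a null set, both ratios are infinite and the radii coincide.\<close>

lemma admissible_radii_areas:
  assumes Oc: "Oc \<in> sets lebesgue" "Om \<in> sets lebesgue" "Oc \<union> Om = Omega" "Oc \<inter> Om = {}"
    and rad: "admissible_radii Oc Om r1 r2"
  shows "measure lebesgue Oc + measure lebesgue Om = 1" "0 < measure lebesgue (cball center r2)"
    "measure lebesgue (cball center r2) \<le> 1"
    "measure lebesgue (cball center r1) = measure lebesgue Oc * measure lebesgue (cball center r2)"
proof -
  have r: "0 < r1" "r1 \<le> r2" "r2 \<le> 1/10" using rad by (auto simp: admissible_radii_def)
  have sub: "Oc \<subseteq> Omega" "Om \<subseteq> Omega" using Oc(3) by auto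
  have fm: "Oc \<in> lmeasurable" "Om \<in> lmeasurable"
    using fmeasurableI2[OF Omega_lmeasurable sub(1) Oc(1)] fmeasurableI2[OF Omega_lmeasurable sub(2) Oc(2)] by auto
  define c where "c = measure lebesgue Oc"
  define m1 where "m1 = measure lebesgue (cball center r1)"
  define m2 where "m2 = measure lebesgue (cball center r2)"
  have "measure lebesgue (Oc \<union> Om) = c + measure lebesgue Om"
    unfolding c_def using Oc fm by (intro measure_Un2[THEN trans]) (auto simp: Diff_triv Int_commute Un_Diff Int_absorb1)
  then show sum1: "measure lebesgue Oc + measure lebesgue Om = 1"
    using Oc(3) measure_Omega by (simp add: c_def)
  show m2: "0 < measure lebesgue (cball center r2)" using r by simp
  have m1: "0 < m1" using r by (simp add: m1_def)
  have "measure lebesgue (cball center r2) \<le> measure lebesgue Omega"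
    by (rule measure_mono_fmeasurable) (use cball_center_subset[OF r(3)] Omega_lmeasurable in auto)
  then show "measure lebesgue (cball center r2) \<le> 1" by (simp add: measure_Omega)
  have sub12: "cball center r1 \<subseteq> cball center r2" using r by (simp add: subset_cball)
  have md: "measure lebesgue (cell_m r1 r2) = m2 - m1"
    unfolding cell_m_def m1_def m2_def by (rule measurable_measure_Diff) (use sub12 in auto)
  have "m1 \<le> m2" unfolding m1_def m2_def by (rule measure_mono_fmeasurable[OF sub12]) auto
  have em: "emeasure lebesgue Oc = ennreal c" "emeasure lebesgue Om = ennreal (1 - c)"
    "emeasure lebesgue (cell_c r1) = ennreal m1" "emeasure lebesgue (cell_m r1 r2) = ennreal (m2 - m1)"
  proof -
    have "measure lebesgue Om = 1 - c" using sum1 unfolding c_def by linarith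
    then show "emeasure lebesgue Oc = ennreal c" "emeasure lebesgue Om = ennreal (1 - c)"
      using emeasure_eq_measure2[OF fm(1)] emeasure_eq_measure2[OF fm(2)] by (simp_all add: c_def)
    have "cell_c r1 \<in> lmeasurable" "cell_m r1 r2 \<in> lmeasurable"
      unfolding cell_c_def cell_m_def by (auto intro: fmeasurable.Diff)
    from this[THEN emeasure_eq_measure2]
    show "emeasure lebesgue (cell_c r1) = ennreal m1" "emeasure lebesgue (cell_m r1 r2) = ennreal (m2 - m1)"
      unfolding md by (simp_all add: m1_def cell_c_def)
  qed
  have c: "0 \<le> c" "c \<le> 1" using sum1 measure_nonneg[of lebesgue Om] measure_nonneg[of lebesgue Oc] unfolding c_def by linarith+
  have eq: "ennreal c / ennreal (1 - c) = ennreal m1 / ennreal (m2 - m1)"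
    using rad unfolding admissible_radii_def em by simp
  have fin: "ennreal x / ennreal y \<noteq> top" if "0 \<le> x" "0 < y" for x y
    using that by (simp add: divide_ennreal)
  have inf: "ennreal x / 0 = top" if "0 < x" for x
    using that by (simp add: divide_ennreal_def ennreal_mult_top)
  have "m1 = c * m2"
  proof (cases "c = 1")
    case True
    then have "ennreal m1 / ennreal (m2 - m1) = top" using eq inf[of 1] by simp
    then have "\<not> 0 < m2 - m1" using fin[of m1 "m2 - m1"] m1 by auto
    then show ?thesis using True \<open>m1 \<le> m2\<close> by simp
  next
    case False
    then have c1: "0 < 1 - c" using c by simp
    have "m2 - m1 \<noteq> 0"
    proof
      assume "m2 - m1 = 0"
      then have "ennreal m1 / ennreal (m2 - m1) = top" using inf[OF m1] by simp
      then show False using fin[OF c(1) c1] eq by simp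
    qed
    then have m21: "0 < m2 - m1" using \<open>m1 \<le> m2\<close> by simp
    have "ennreal (c / (1 - c)) = ennreal (m1 / (m2 - m1))"
      using eq c c1 m1 m21 by (simp add: divide_ennreal)
    then have "c / (1 - c) = m1 / (m2 - m1)" using c c1 m1 m21 by (simp add: ennreal_inj)
    then have "c * (m2 - m1) = m1 * (1 - c)" using c1 m21 by (simp add: frac_eq_eq)
    then show ?thesis by (simp add: algebra_simps)
  qed
  then show "measure lebesgue (cball center r1) = measure lebesgue Oc * measure lebesgue (cball center r2)"
    by (simp add: m1_def m2_def c_def)
qed

lemma cell_lam_eq:
  assumes "r1 \<le> r2" "r2 \<le> 1/10" "x \<in> Omega"
  shows "cell_lam R L r1 r2 d x = L + indicator (cball center r1) x * (R - L) + (1 - indicator (cball center r2) x) * (d - L)"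
proof -
  have "cball center r1 \<subseteq> cball center r2" using assms by (simp add: subset_cball)
  then show ?thesis using assms(3)
    by (auto simp: cell_lam_def cell_c_def cell_m_def cell_dummy_def indicator_def)
qed

lemma cell_lam_props:
  assumes r: "0 < r1" "r1 \<le> r2" "r2 \<le> 1/10" and L: "0 < L" and d: "L \<le> d" "d \<le> R"
  shows "admissible (cell_lam R L r1 r2 d)" "\<And>x. x \<in> Omega \<Longrightarrow> L \<le> cell_lam R L r1 r2 d x \<and> cell_lam R L r1 r2 d x \<le> R"
    "(LINT x|LO. cell_lam R L r1 r2 d x - L) =
      measure lebesgue (cball center r1) * (R - L) + (1 - measure lebesgue (cball center r2)) * (d - L)"
proof -
  show b: "L \<le> cell_lam R L r1 r2 d x \<and> cell_lam R L r1 r2 d x \<le> R" if "x \<in> Omega" for x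
    using cell_lam_eq[OF r(2,3) that, of R L d] d r by (auto simp: indicator_def)
  have sub: "cball center r1 \<subseteq> Omega" "cball center r2 \<subseteq> Omega" using cball_center_subset r by auto
  have cball_lebesgue: "cball center r \<in> sets lebesgue" for r by simp
  note m = LINT_indicator(2)[OF cball_lebesgue sub(1)] LINT_indicator(2)[OF cball_lebesgue sub(2)]
  let ?f = "\<lambda>x. indicat_real (cball center r1) x * (R - L) + (1 - indicat_real (cball center r2) x) * (d - L)"
  have fm: "?f \<in> borel_measurable LO" using m by measurable
  have "(\<lambda>x. L + ?f x) \<in> borel_measurable LO" using fm by measurable
  then have "cell_lam R L r1 r2 d \<in> borel_measurable LO"
    by (rule measurable_cong[THEN iffD1, rotated]) (simp add: cell_lam_eq[OF r(2,3)])
  then show "admissible (cell_lam R L r1 r2 d)" unfolding admissible_def using b L by force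
  have i: "integrable LO (indicat_real (cball center r1))" "integrable LO (indicat_real (cball center r2))"
    using m by (auto intro!: bounded_integrable_LO[where B=1])
  have "(LINT x|LO. cell_lam R L r1 r2 d x - L) = (LINT x|LO. ?f x)"
    by (rule Bochner_Integration.integral_cong) (auto simp: cell_lam_eq[OF r(2,3)])
  also have "\<dots> = (LINT x|LO. indicat_real (cball center r1) x) * (R - L) + (1 - (LINT x|LO. indicat_real (cball center r2) x)) * (d - L)"
    using i by simp
  finally show "(LINT x|LO. cell_lam R L r1 r2 d x - L) =
      measure lebesgue (cball center r1) * (R - L) + (1 - measure lebesgue (cball center r2)) * (d - L)"
    by (simp only: LINT_indicator(1)[OF cball_lebesgue sub(1)] LINT_indicator(1)[OF cball_lebesgue sub(2)])
qed

text \<open>The first step decides whether the sequence increases or decreases.\<close>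

lemma monotone_iteration:
  fixes f :: "real \<Rightarrow> real"
  assumes step: "\<And>n. d (Suc n) = f (d n)" and d0: "d 0 \<in> {L..R}"
    and maps: "\<And>x. x \<in> {L..R} \<Longrightarrow> f x \<in> {L..R}" and mono: "\<And>x y. x \<in> {L..R} \<Longrightarrow> y \<in> {L..R} \<Longrightarrow> x \<le> y \<Longrightarrow> f x \<le> f y"
  shows "\<And>n. d n \<in> {L..R}" "convergent d"
proof -
  show r: "d n \<in> {L..R}" for n by (induction n) (use d0 maps step in auto)
  have "incseq d \<or> decseq d"
  proof (cases "d 0 \<le> d 1")
    case True
    have "d n \<le> d (Suc n)" for n
    proof (induction n)
      case (Suc n) show ?case using mono[OF r r Suc.IH] by (simp only: step[symmetric])
    qed (use True in simp)
    then show ?thesis by (simp add: incseq_SucI)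
  next
    case False
    have "d (Suc n) \<le> d n" for n
    proof (induction n)
      case (Suc n) show ?case using mono[OF r r Suc.IH] by (simp only: step[symmetric])
    qed (use False in simp)
    then show ?thesis by (simp add: decseq_SucI)
  qed
  then have "monoseq d" by (simp add: monoseq_iff)
  moreover have "Bseq d"
  proof (rule BseqI')
    show "norm (d n) \<le> \<bar>L\<bar> + \<bar>R\<bar>" for n
      using r[of n] unfolding atLeastAtMost_iff real_norm_def by linarith
  qed
  ultimately show "convergent d" by (rule Bseq_monoseq_convergent[rotated])
qed

text \<open>One step of the algorithm is monotone and maps \<open>[L, L + \<delta>]\<close> into itself. Up to an error \<open>K\<close> it is the
  affine map with slope \<open>1 - |B\<^sub>r\<^sub>2|\<close> and fixed point \<open>L + |\<Omega>\<^sub>c| \<delta>\<close>. The iteration starts at this fixed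
  point, so the errors accumulate to at most the sum \<open>K / |B\<^sub>r\<^sub>2|\<close> of a geometric series.\<close>

lemma embedded_cell_converges:
  fixes L \<delta> mu l r1 r2 K :: real and Oc Om :: "(real^2) set"
  assumes pos: "0 < L" "0 < mu" "0 < l" "0 \<le> \<delta>"
    and dec: "Oc \<in> sets lebesgue" "Om \<in> sets lebesgue" "Oc \<union> Om = Omega" "Oc \<inter> Om = {}"
    and rad: "admissible_radii Oc Om r1 r2"
    and K: "\<And>lam. admissible lam \<Longrightarrow> (\<And>x. x \<in> Omega \<Longrightarrow> L \<le> lam x \<and> lam x \<le> L + \<delta>) \<Longrightarrow>
     \<bar>force_to_lame mu l (tensile_force lam (\<lambda>_. mu) l) - (L + (LINT x|LO. lam x - L))\<bar> \<le> K"
  defines "d \<equiv> embedded_cell (L + \<delta>) L mu l Oc Om r1 r2"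
  shows "2 * l - cell_force (L + \<delta>) L mu l r1 r2 (d n) / (2 * mu) \<noteq> 0" "convergent d"
    "lim d \<in> {L..L + \<delta>}" "\<bar>lim d - (L + measure lebesgue Oc * \<delta>)\<bar> \<le> K / measure lebesgue (cball center r2)"
proof -
  define R where "R = L + \<delta>"
  define c where "c = measure lebesgue Oc"
  define m where "m = measure lebesgue (cball center r2)"
  define T where "T = L + c * \<delta>"
  have r: "0 < r1" "r1 \<le> r2" "r2 \<le> 1/10" using rad by (auto simp: admissible_radii_def)
  note areas = admissible_radii_areas[OF dec rad, folded c_def m_def]
  have c: "0 \<le> c" "c \<le> 1"
    using areas(1) measure_nonneg[of lebesgue Om] measure_nonneg[of lebesgue Oc] unfolding c_def by linarith+
  note cl = cell_lam_props[OF r pos(1), where R = R]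
  define F where "F x = cell_force R L mu l r1 r2 x" for x
  have F: "const_force mu l L \<le> F x" "F x \<le> const_force mu l R" if "x \<in> {L..R}" for x
    using tensile_force_range(1,2)[OF cl(1) pos(1-3) cl(2), of x] that
    by (auto simp: F_def cell_force_def)
  have LR: "L \<le> R" using pos by (simp add: R_def)
  note range = lame_range[OF pos(1-3) F LR]
  have step: "d (Suc n) = force_to_lame mu l (F (d n))" for n
    unfolding d_def F_def R_def by (simp add: force_to_lame_def Let_def)
  have "d 0 = c * (L + \<delta>) + measure lebesgue Om * L" by (simp add: d_def c_def)
  also have "measure lebesgue Om = 1 - c" using areas(1) by linarith
  also have "c * (L + \<delta>) + (1 - c) * L = T" by (simp add: T_def algebra_simps)
  finally have d0: "d 0 = T" .
  have T: "T \<in> {L..R}" using c pos(4) by (simp add: T_def R_def mult_left_le_one_le)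
  have maps: "force_to_lame mu l (F x) \<in> {L..R}" if "x \<in> {L..R}" for x
    using range(3,4)[OF that that] by simp
  have mono: "force_to_lame mu l (F x) \<le> force_to_lame mu l (F y)" if "x \<in> {L..R}" "y \<in> {L..R}" "x \<le> y" for x y
  proof (rule force_to_lame_mono)
    show "F x \<le> F y" unfolding F_def cell_force_def
    proof (rule tensile_force_mono)
      show "cell_lam R L r1 r2 x z \<le> cell_lam R L r1 r2 y z" if "z \<in> Omega" for z
        using \<open>x \<le> y\<close> unfolding cell_lam_def by (intro add_left_mono mult_left_mono) auto
    qed (use cl(1) that pos in auto)
    show "0 < 2 * l - F y / (2 * mu)" using range(2)[OF that(2) that(2)] .
    have "0 \<le> 2 * l * mu / (L + 2 * mu) * L" using pos by simp
    then show "2 * mu * l \<le> F x" using const_force_props(2)[OF pos(1-3)] F(1)[OF that(1)] by linarith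
  qed (rule pos)
  have dn: "d n \<in> {L..R}" for n
    by (rule monotone_iteration(1)[of d "\<lambda>x. force_to_lame mu l (F x)", OF step _ maps mono]) (use d0 T in auto)
  show conv: "convergent d"
    by (rule monotone_iteration(2)[of d "\<lambda>x. force_to_lame mu l (F x)", OF step _ maps mono]) (use d0 T in auto)
  show "2 * l - cell_force (L + \<delta>) L mu l r1 r2 (d n) / (2 * mu) \<noteq> 0"
    using range(2)[OF dn dn, of n] by (simp add: F_def R_def)
  have lim: "d \<longlonglongrightarrow> lim d" using conv by (simp add: convergent_LIMSEQ_iff)
  show "lim d \<in> {L..L + \<delta>}"
    using LIMSEQ_le_const[OF lim, of L] LIMSEQ_le_const2[OF lim, of R] dn by (auto simp: R_def)
  have est: "\<bar>d (Suc n) - T\<bar> \<le> (1 - m) * \<bar>d n - T\<bar> + K" for n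
  proof -
    have dl: "L \<le> d n" "d n \<le> R" using dn[of n] by auto
    have "\<bar>d (Suc n) - (L + (LINT x|LO. cell_lam R L r1 r2 (d n) x - L))\<bar> \<le> K"
      unfolding step F_def cell_force_def by (rule K) (use cl(1,2)[OF dl] in \<open>auto simp: R_def\<close>)
    moreover have "L + (LINT x|LO. cell_lam R L r1 r2 (d n) x - L) = T + (1 - m) * (d n - T)"
      unfolding cl(3)[OF dl] areas(4) m_def[symmetric] by (simp add: T_def R_def algebra_simps)
    ultimately have "\<bar>d (Suc n) - T\<bar> \<le> \<bar>(1 - m) * (d n - T)\<bar> + K" by linarith
    also have "\<bar>(1 - m) * (d n - T)\<bar> = (1 - m) * \<bar>d n - T\<bar>" using areas(3) by (simp add: abs_mult)
    finally show ?thesis .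
  qed
  have "\<bar>d n - T\<bar> \<le> K / m" for n
  proof (induction n)
    case 0
    have "0 \<le> K" using est[of 0] d0 by (simp add: order_trans[OF abs_ge_zero])
    then show ?case using d0 areas(2) by simp
  next
    case (Suc n)
    have "\<bar>d (Suc n) - T\<bar> \<le> (1 - m) * (K / m) + K"
      using est[of n] mult_left_mono[OF Suc, of "1 - m"] areas(3) by simp
    also have "\<dots> = K / m" using areas(2) by (simp add: field_simps)
    finally show ?case .
  qed
  moreover have "(\<lambda>n. \<bar>d n - T\<bar>) \<longlonglongrightarrow> \<bar>lim d - T\<bar>" by (intro tendsto_intros lim)
  ultimately show "\<bar>lim d - (L + measure lebesgue Oc * \<delta>)\<bar> \<le> K / measure lebesgue (cball center r2)"
    using LIMSEQ_le_const2 by (fastforce simp: T_def c_def m_def)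
qed

section \<open>The periodic composite\<close>

text \<open>The ceramic region of the composite with period \<open>1/N\<close>.\<close>

definition scaled_cells :: "(real^2) set \<Rightarrow> nat \<Rightarrow> (real^2) set" where
  "scaled_cells A N = (\<Union>z\<in>{..<N}\<times>{..<N}. (\<lambda>y. (1 / real N) *\<^sub>R y + (1 / real N) *\<^sub>R pt (real (fst z)) (real (snd z))) ` A)"

lemma frac_add_nat: "0 < y \<Longrightarrow> y < 1 \<Longrightarrow> frac (y + real k) = y"
  by (simp add: frac_unique_iff)

lemma scaled_cells_iff:
  assumes A: "A \<subseteq> Omega" and N: "N > 0"
  shows "x \<in> scaled_cells A N \<longleftrightarrow> x \<in> Omega \<and> (\<chi> i. frac (real N * x $ i)) \<in> A"
proof
  assume "x \<in> scaled_cells A N"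
  then obtain j k y where jk: "j < N" "k < N" and y: "y \<in> A"
    and x: "x = (1 / real N) *\<^sub>R y + (1 / real N) *\<^sub>R pt (real j) (real k)"
    by (auto simp: scaled_cells_def)
  have yO: "0 < y$1" "y$1 < 1" "0 < y$2" "y$2 < 1" using y A by (auto simp: Omega_def)
  have x12: "real N * x$1 = y$1 + real j" "real N * x$2 = y$2 + real k"
    using N by (simp_all add: x field_simps)
  have "(\<chi> i. frac (real N * x $ i)) = y"
    unfolding vec_eq_iff forall_2 by (simp add: x12 frac_add_nat yO)
  moreover have "x \<in> Omega"
  proof -
    have "real j + 1 \<le> real N" "real k + 1 \<le> real N" using jk by simp_all
    then have "0 < real N * x$1" "real N * x$1 < real N" "0 < real N * x$2" "real N * x$2 < real N"
      unfolding x12 using yO by linarith+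
    then show ?thesis using N by (simp add: Omega_def zero_less_mult_iff)
  qed
  ultimately show "x \<in> Omega \<and> (\<chi> i. frac (real N * x $ i)) \<in> A" using y by simp
next
  assume x: "x \<in> Omega \<and> (\<chi> i. frac (real N * x $ i)) \<in> A"
  define y :: "real^2" where "y = (\<chi> i. frac (real N * x $ i))"
  define f where "f i = nat \<lfloor>real N * x $ i\<rfloor>" for i
  have xi: "0 < x$i" "x$i < 1" for i using x exhaust_2[of i] by (auto simp: Omega_def)
  have fl: "real (f i) = real_of_int \<lfloor>real N * x$i\<rfloor>" "f i < N" for i
  proof -
    have "0 \<le> real N * x$i" "real N * x$i < real N" using xi[of i] N by simp_all
    then show "real (f i) = real_of_int \<lfloor>real N * x$i\<rfloor>" "f i < N" unfolding f_def by (simp, linarith)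
  qed
  have "real N * x$i = y$i + real (f i)" for i by (simp add: y_def fl frac_def)
  then have "x$i = (1 / real N) * y$i + (1 / real N) * real (f i)" for i using N by (simp add: field_simps)
  then have "x = (1 / real N) *\<^sub>R y + (1 / real N) *\<^sub>R pt (real (f 1)) (real (f 2))"
    unfolding vec_eq_iff forall_2 by simp
  moreover have "y \<in> A" using x by (simp add: y_def)
  ultimately show "x \<in> scaled_cells A N"
    unfolding scaled_cells_def using fl(2) by (auto intro!: bexI[of _ "(f 1, f 2)"])
qed

lemma scaled_cells_measure:
  assumes A: "A \<subseteq> Omega" "A \<in> sets lebesgue" and N: "N > 0"
  shows "scaled_cells A N \<in> sets lebesgue" "measure lebesgue (scaled_cells A N) = measure lebesgue A"
proof -
  define S where "S z = (\<lambda>y. (1 / real N) *\<^sub>R y + (1 / real N) *\<^sub>R pt (real (fst z)) (real (snd z))) ` A" for z :: "nat \<times> nat"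
  have Afm: "A \<in> lmeasurable" by (rule fmeasurableI2[OF Omega_lmeasurable A])
  have Sm: "S z \<in> lmeasurable" for z
  proof -
    have "(*\<^sub>R) (1 / real N) ` A \<in> lmeasurable" by (rule measurable_linear_image[OF _ Afm]) simp
    from measurable_translation[OF this, of "(1 / real N) *\<^sub>R pt (real (fst z)) (real (snd z))"]
    show ?thesis by (simp add: S_def image_image add.commute)
  qed
  have Smeas: "measure lebesgue (S z) = (1 / real N)\<^sup>2 * measure lebesgue A" for z
    unfolding S_def using measure_lebesgue_affine[of "1 / real N" _ A] N by simp
  have eq: "scaled_cells A N = (\<Union>z\<in>{..<N}\<times>{..<N}. S z)" by (simp add: scaled_cells_def S_def)
  show "scaled_cells A N \<in> sets lebesgue" unfolding eq using Sm by (intro sets.finite_UN) auto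
  have disj: "disjoint_family_on S ({..<N}\<times>{..<N})"
    unfolding disjoint_family_on_def
  proof (intro ballI impI)
    fix z z' :: "nat \<times> nat" assume "z \<noteq> z'"
    show "S z \<inter> S z' = {}"
    proof (rule ccontr)
      assume "S z \<inter> S z' \<noteq> {}"
      then obtain y y' where y: "y \<in> A" "y' \<in> A" and e: "(1 / real N) *\<^sub>R y + (1 / real N) *\<^sub>R pt (real (fst z)) (real (snd z)) =
        (1 / real N) *\<^sub>R y' + (1 / real N) *\<^sub>R pt (real (fst z')) (real (snd z'))" by (auto simp: S_def)
      have "(1 / real N) *\<^sub>R (y + pt (real (fst z)) (real (snd z))) = (1 / real N) *\<^sub>R (y' + pt (real (fst z')) (real (snd z')))"
        using e by (simp add: scaleR_add_right)
      then have "y + pt (real (fst z)) (real (snd z)) = y' + pt (real (fst z')) (real (snd z'))" using N by simp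
      then have "y$1 + real (fst z) = y'$1 + real (fst z')" "y$2 + real (snd z) = y'$2 + real (snd z')"
        by (simp_all add: vec_eq_iff forall_2)
      moreover have "0 < y$1 \<and> y$1 < 1 \<and> 0 < y$2 \<and> y$2 < 1" "0 < y'$1 \<and> y'$1 < 1 \<and> 0 < y'$2 \<and> y'$2 < 1"
        using y A(1) by (auto simp: Omega_def)
      moreover have nat_shift: "i = i'" if "a + real i = a' + real i'" "0 < a \<and> a < 1" "0 < a' \<and> a' < 1" for a a' i i'
        using frac_add_nat[of a i] frac_add_nat[of a' i'] that by simp
      ultimately have "fst z = fst z'" "snd z = snd z'" by (blast intro: nat_shift)+
      with \<open>z \<noteq> z'\<close> show False by (simp add: prod_eq_iff)
    qed
  qed
  have "measure lebesgue (scaled_cells A N) = (\<Sum>z\<in>{..<N}\<times>{..<N}. measure lebesgue (S z))"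
    unfolding eq
    by (rule measure_finite_Union[OF _ _ disj]) (use fmeasurableD[OF Sm] fmeasurableD2[OF Sm] in \<open>auto simp del: emeasure_completion\<close>)
  also have "\<dots> = measure lebesgue A" using N by (simp add: Smeas power2_eq_square)
  finally show "measure lebesgue (scaled_cells A N) = measure lebesgue A" .
qed

text \<open>For the period \<open>1/N\<close> the square consists of whole cells, so the area fraction of the ceramic is exact.\<close>

lemma composite_lam_props:
  assumes Oc: "Oc \<subseteq> Omega" "Oc \<in> sets lebesgue" and N: "N > 0" and pos: "L > 0" "e \<ge> 0" "Dc \<ge> 0"
  shows "admissible (composite_lam L Dc e Oc (1 / real N))"
    "\<And>x. x \<in> Omega \<Longrightarrow> L \<le> composite_lam L Dc e Oc (1 / real N) x \<and> composite_lam L Dc e Oc (1 / real N) x \<le> L + e * Dc"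
    "(LINT x|LO. composite_lam L Dc e Oc (1 / real N) x - L) = measure lebesgue Oc * (e * Dc)"
proof -
  define S where "S = scaled_cells Oc N"
  have S: "S \<in> sets lebesgue" "measure lebesgue S = measure lebesgue Oc" "S \<subseteq> Omega"
    unfolding S_def using scaled_cells_measure[OF Oc N] scaled_cells_iff[OF Oc(1) N] by auto
  have eq: "composite_lam L Dc e Oc (1 / real N) x = L + e * Dc * indicator S x" if "x \<in> Omega" for x
    using that scaled_cells_iff[OF Oc(1) N, of x] Oc(1)
    by (auto simp: composite_lam_def periodic_indicator_def indicator_def S_def)
  note I = LINT_indicator[OF S(1,3)]
  show b: "L \<le> composite_lam L Dc e Oc (1 / real N) x \<and> composite_lam L Dc e Oc (1 / real N) x \<le> L + e * Dc" if "x \<in> Omega" for x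
    using eq[OF that] pos by (auto simp: indicator_def)
  have "(\<lambda>x. L + e * Dc * indicat_real S x) \<in> borel_measurable LO" using I(2) by measurable
  then have "composite_lam L Dc e Oc (1 / real N) \<in> borel_measurable LO"
    by (rule measurable_cong[THEN iffD1, rotated]) (simp add: eq)
  then show "admissible (composite_lam L Dc e Oc (1 / real N))" unfolding admissible_def using b pos by force
  have "(LINT x|LO. composite_lam L Dc e Oc (1 / real N) x - L) = (LINT x|LO. e * Dc * indicator S x)"
    by (rule Bochner_Integration.integral_cong) (auto simp: eq)
  then show "(LINT x|LO. composite_lam L Dc e Oc (1 / real N) x - L) = measure lebesgue Oc * (e * Dc)"
    using I(1) S(2) by simp
qed

subsection \<open>Effective parameters\<close>

lemma mat_L2_iff: "(G :: real^2 \<Rightarrow> real^2^2) \<in> L2 \<longleftrightarrow> mat_L2 G"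
  by (simp add: L2_vec2 mat_L2_def)

lemma LINT_entry_le:
  fixes G :: "real^2 \<Rightarrow> real^2^2"
  assumes "G \<in> L2" shows "\<bar>LINT x|LO. G x $ i $ j\<bar> \<le> L2_norm G"
proof -
  have 1: "(\<lambda>x. G x $ i) \<in> L2" using assms L2_vec2 by blast
  then have 2: "(\<lambda>x. G x $ i $ j) \<in> L2" using L2_vec2[of "\<lambda>x. G x $ i"] by simp
  have "\<bar>LINT x|LO. G x $ i $ j\<bar> \<le> (LINT x|LO. \<bar>G x $ i $ j\<bar>)" by (rule integral_abs_bound)
  also have "\<dots> \<le> L2_norm (\<lambda>x. G x $ i $ j)" by (rule L1_le_L2[OF 2])
  also have "\<dots> \<le> L2_norm (\<lambda>x. G x $ i)" by (rule L2_norm_component_le[OF 1])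
  also have "\<dots> \<le> L2_norm G" by (rule L2_norm_component_le[OF assms])
  finally show ?thesis .
qed

lemma bounded_functional_entry:
  "bounded_functional L2 L2_norm (\<lambda>G :: real^2 \<Rightarrow> real^2^2. LINT x|LO. G x $ i $ j)"
  unfolding bounded_functional_def
proof (intro conjI ballI allI exI)
  fix f g :: "real^2 \<Rightarrow> real^2^2" and a b :: real
  assume "f \<in> L2" "g \<in> L2"
  then have "(\<lambda>x. f x $ i $ j) \<in> L2" "(\<lambda>x. g x $ i $ j) \<in> L2" by (auto simp: mat_L2_iff mat_L2_def)
  then show "(LINT x|LO. (a *\<^sub>R f x + b *\<^sub>R g x) $ i $ j) = a * (LINT x|LO. f x $ i $ j) + b * (LINT x|LO. g x $ i $ j)"
    by (simp add: L2_integrable)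
next
  fix f :: "real^2 \<Rightarrow> real^2^2" assume "f \<in> L2"
  then show "\<bar>LINT x|LO. f x $ i $ j\<bar> \<le> 1 * L2_norm f" using LINT_entry_le by simp
qed

lemma bounded_functional_Jac:
  "bounded_functional H1 H1_norm (\<lambda>u. LINT x|LO. Jac u x $ i $ j)"
  unfolding bounded_functional_def
proof (intro conjI ballI allI exI)
  fix u v :: "real^2 \<Rightarrow> real^2" and a b :: real
  assume uv: "u \<in> H1" "v \<in> H1"
  have "(LINT x|LO. Jac (\<lambda>x. a *\<^sub>R u x + b *\<^sub>R v x) x $ i $ j) = (LINT x|LO. a * Jac u x $ i $ j + b * Jac v x $ i $ j)"
  proof (rule integral_cong_AE)
    show "AE x in LO. Jac (\<lambda>x. a *\<^sub>R u x + b *\<^sub>R v x) x $ i $ j = a * Jac u x $ i $ j + b * Jac v x $ i $ j"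
      using Jac_lincomb(2)[OF uv, of a b] by eventually_elim simp
  qed (use uv Jac_lincomb(1)[OF uv] in \<open>auto intro!: L2_measurable Jac_L2 L2_add L2_cmult\<close>)
  then show "(LINT x|LO. Jac (\<lambda>x. a *\<^sub>R u x + b *\<^sub>R v x) x $ i $ j) = a * (LINT x|LO. Jac u x $ i $ j) + b * (LINT x|LO. Jac v x $ i $ j)"
    using uv by (simp add: L2_integrable Jac_L2)
next
  fix u :: "real^2 \<Rightarrow> real^2" assume "u \<in> H1"
  then have "Jac u \<in> L2" by (simp add: mat_L2_iff mat_L2_Jac)
  then have "\<bar>LINT x|LO. Jac u x $ i $ j\<bar> \<le> L2_norm (Jac u)" by (rule LINT_entry_le)
  also have "\<dots> \<le> H1_norm u" unfolding H1_norm_def by (rule real_le_rsqrt) simp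
  finally show "\<bar>LINT x|LO. Jac u x $ i $ j\<bar> \<le> 1 * H1_norm u" by simp
qed

lemma stress_nth: "stress lam mu u x $ i $ i = lam x * mtr (Jac u x) + 2 * mu x * Jac u x $ i $ i"
  unfolding stress_def trace_sym_grad by (simp add: sym_grad_def transpose_def mat_def)

lemma LINT_stress:
  assumes "admissible lam" "u \<in> H1"
  shows "(LINT x|LO. stress lam (\<lambda>_. mu) u x $ i $ i) = (LINT x|LO. lam x * mtr (Jac u x)) + 2 * mu * (LINT x|LO. Jac u x $ i $ i)"
  unfolding stress_nth
  using L2_integrable[OF admissible_mult_L2[OF assms(1) mat_L2_parts(1)[OF mat_L2_Jac[OF assms(2)]]]]
    L2_integrable[OF Jac_L2[OF assms(2)]]
  by (simp add: mult.assoc)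

lemma LINT_stress_const:
  assumes "u \<in> H1"
  shows "(LINT x|LO. stress (\<lambda>_. c) (\<lambda>_. mu) u x $ i $ i) = c * ((LINT x|LO. Jac u x $1$1) + (LINT x|LO. Jac u x $2$2)) + 2 * mu * (LINT x|LO. Jac u x $ i $ i)"
  unfolding stress_nth using L2_integrable[OF Jac_L2[OF assms]] by (simp add: mult.assoc)

text \<open>The averaged normal stresses and the averaged lateral strain pass to the weak limit. Since the
  averaged stress in the first direction is zero, they determine both effective parameters: \<open>mh = \<mu>\<close>,
  and \<open>lh\<close> is the parameter of the homogeneous material whose force is the limit of the forces. As the
  limit exists, it may be computed along the periods \<open>1/N\<close>.\<close>

lemma effective_parameters_estimate:
  assumes pos: "0 < L" "0 < mu" "0 < l" "0 \<le> e" "0 \<le> Dc"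
    and Oc: "Oc \<subseteq> Omega" "Oc \<in> sets lebesgue"
    and K: "\<And>lam. admissible lam \<Longrightarrow> (\<And>x. x \<in> Omega \<Longrightarrow> L \<le> lam x \<and> lam x \<le> L + e * Dc) \<Longrightarrow>
     \<bar>force_to_lame mu l (tensile_force lam (\<lambda>_. mu) l) - (L + (LINT x|LO. lam x - L))\<bar> \<le> K"
    and eff: "effective_parameters L Dc e mu l Oc lh mh"
  shows "lh \<in> {L..L + e * Dc}" "\<bar>lh - (L + measure lebesgue Oc * (e * Dc))\<bar> \<le> K"
proof -
  define R where "R = L + e * Dc"
  have LR: "L \<le> R" using pos by (simp add: R_def)
  obtain u uh where sol: "\<And>d. d > 0 \<Longrightarrow> tensile_solution (composite_lam L Dc e Oc d) (\<lambda>_. mu) l (u d)"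
    and wu: "weakly_tendsto H1 H1_norm u uh (at_right 0)"
    and ws: "weakly_tendsto L2 L2_norm (\<lambda>d. stress (composite_lam L Dc e Oc d) (\<lambda>_. mu) (u d)) (stress (\<lambda>_. lh) (\<lambda>_. mh) uh) (at_right 0)"
    and solh: "tensile_solution (\<lambda>_. lh) (\<lambda>_. mh) l uh"
    using eff unfolding effective_parameters_def by blast
  define lam where "lam n = composite_lam L Dc e Oc (1 / real (Suc n))" for n
  define v where "v n = u (1 / real (Suc n))" for n
  note comp = composite_lam_props[OF Oc zero_less_Suc pos(1,4,5), folded lam_def R_def]
  have vs: "tensile_solution (lam n) (\<lambda>_. mu) l (v n)" for n
    unfolding lam_def v_def by (rule sol) simp
  have seq: "filterlim (\<lambda>n. 1 / real (Suc n)) (at_right 0) sequentially"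
    unfolding filterlim_at
    using LIMSEQ_inverse_real_of_nat by (auto simp: inverse_eq_divide)
  have uhW: "uh \<in> W l" using solh by (simp add: tensile_solution_def)
  have limJ: "(\<lambda>n. LINT x|LO. Jac (v n) x $ 1 $ 1) \<longlonglongrightarrow> (LINT x|LO. Jac uh x $ 1 $ 1)"
    unfolding v_def using wu bounded_functional_Jac[of 1 1] filterlim_compose[OF _ seq]
    unfolding weakly_tendsto_def by blast
  have limS: "(\<lambda>n. LINT x|LO. stress (lam n) (\<lambda>_. mu) (v n) x $ i $ j) \<longlonglongrightarrow> (LINT x|LO. stress (\<lambda>_. lh) (\<lambda>_. mh) uh x $ i $ j)" for i j
    unfolding v_def lam_def using ws bounded_functional_entry[of i j] filterlim_compose[OF _ seq]
    unfolding weakly_tendsto_def by blast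
  define E where "E = (LINT x|LO. Jac uh x $ 1 $ 1)"
  define F where "F n = tensile_force (lam n) (\<lambda>_. mu) l" for n
  define G where "G = 2 * mu * (l - E)"
  have Ff: "F n = force (lam n) mu (v n)" for n
    unfolding F_def by (rule tensile_force_eq[OF comp(1) vs pos(3)])
  have "(\<lambda>n. 2 * mu * (l - (LINT x|LO. Jac (v n) x $ 1 $ 1))) \<longlonglongrightarrow> G"
    unfolding G_def E_def by (intro tendsto_intros limJ)
  then have FG: "F \<longlonglongrightarrow> G"
    using force_eq[OF comp(1) vs] Ff by (simp add: F_def[abs_def])
  have vW: "v n \<in> W l" for n by (rule solution_W[OF comp(1) vs])
  have "(LINT x|LO. stress (lam n) (\<lambda>_. mu) (v n) x $ 1 $ 1) = 0" for n
    unfolding LINT_stress[OF comp(1) W_H1[OF vW]] by (rule solution_lateral[OF comp(1) vs])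
  with limS[of 1 1] have s1: "lh * (E + l) + 2 * mh * E = 0"
    unfolding LINT_stress_const[OF W_H1[OF uhW]] W_mean_strain[OF uhW] E_def[symmetric]
    by (simp add: LIMSEQ_const_iff)
  have "(LINT x|LO. stress (lam n) (\<lambda>_. mu) (v n) x $ 2 $ 2) = F n" for n
    unfolding LINT_stress[OF comp(1) W_H1[OF vW]] Ff force_def ..
  with limS[of 2 2] have "F \<longlonglongrightarrow> lh * (E + l) + 2 * mh * l"
    unfolding LINT_stress_const[OF W_H1[OF uhW]] W_mean_strain[OF uhW] E_def[symmetric] by simp
  with FG have s2: "lh * (E + l) + 2 * mh * l = G" using LIMSEQ_unique by blast
  have Fr: "const_force mu l L \<le> F n" "F n \<le> const_force mu l R" for n
    unfolding F_def using tensile_force_range(1,2)[OF comp(1) pos(1-3) comp(2)] by auto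
  have Gr: "const_force mu l L \<le> G" "G \<le> const_force mu l R"
    using LIMSEQ_le_const[OF FG] LIMSEQ_le_const2[OF FG] Fr by blast+
  note range = lame_range[OF pos(1-3) Gr LR]
  have "0 < const_force mu l L" using pos by (simp add: const_force_def)
  then have "l - E \<noteq> 0" using Gr(1) by (auto simp: G_def)
  moreover have "2 * mh * (l - E) = 2 * mu * (l - E)" using s1 s2 by (simp add: G_def algebra_simps)
  ultimately have mh: "mh = mu" by simp
  have E: "E = l - G / (2 * mu)" using pos by (simp add: G_def)
  have "lh * (2 * l - G / (2 * mu)) = G - 2 * mu * l"
  proof -
    have "lh * (E + l) = - 2 * mu * E" using s1 mh by simp
    moreover have "E + l = 2 * l - G / (2 * mu)" "- 2 * mu * E = G - 2 * mu * l"
      using pos by (simp_all add: E algebra_simps)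
    ultimately show ?thesis by simp
  qed
  then have lh: "lh = force_to_lame mu l G"
    unfolding force_to_lame_def nonzero_eq_divide_eq[OF less_imp_neq[OF range(2), THEN not_sym]] .
  show "lh \<in> {L..L + e * Dc}" using range(3,4) by (simp add: lh R_def)
  have "(\<lambda>n. force_to_lame mu l (F n)) \<longlonglongrightarrow> force_to_lame mu l G"
    unfolding force_to_lame_def using range(2) pos by (intro tendsto_intros FG) auto
  then have "(\<lambda>n. \<bar>force_to_lame mu l (F n) - (L + measure lebesgue Oc * (e * Dc))\<bar>) \<longlonglongrightarrow> \<bar>lh - (L + measure lebesgue Oc * (e * Dc))\<bar>"
    unfolding lh by (intro tendsto_intros)
  moreover have "\<bar>force_to_lame mu l (F n) - (L + measure lebesgue Oc * (e * Dc))\<bar> \<le> K" for n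
    using K[OF comp(1) comp(2)[unfolded R_def], of n] unfolding comp(3) F_def by blast
  ultimately show "\<bar>lh - (L + measure lebesgue Oc * (e * Dc))\<bar> \<le> K"
    using LIMSEQ_le_const2 by blast
qed

theorem theorem5p11:
  fixes lam_met Dc mu l r1 r2 :: real and Omega_c Omega_m :: "(real^2) set"
  assumes "lam_met > 0" and "mu > 0" and "Dc \<ge> 0" and "l > 0"
    and "Omega_c \<in> sets lebesgue" and "Omega_m \<in> sets lebesgue"
    and "Omega_c \<union> Omega_m = Omega" and "Omega_c \<inter> Omega_m = {}"
    and "admissible_radii Omega_c Omega_m r1 r2"
  shows "let lam_cer = (\<lambda>\<epsilon>. lam_met + \<epsilon> * Dc);
             dummy = (\<lambda>\<epsilon>. embedded_cell (lam_cer \<epsilon>) lam_met mu l Omega_c Omega_m r1 r2);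
             lam_dummy = (\<lambda>\<epsilon>. lim (dummy \<epsilon>));
             F = (\<lambda>lam. tensile_force (\<lambda>_. lam) (\<lambda>_. mu) l)
         in \<exists>\<epsilon>0>0.
              (\<forall>\<epsilon>\<in>{0<..<\<epsilon>0}.
                 (\<forall>n. 2 * l - cell_force (lam_cer \<epsilon>) lam_met mu l r1 r2 (dummy \<epsilon> n) / (2 * mu) \<noteq> 0) \<and>
                 convergent (dummy \<epsilon>)) \<and>
              (\<exists>C. \<forall>\<epsilon>\<in>{0<..<\<epsilon>0}.
                 \<bar>lam_dummy \<epsilon> - (lam_met + \<epsilon> * measure lebesgue Omega_c * Dc)\<bar> \<le> C * \<epsilon>\<^sup>2) \<and>
              (\<exists>C. \<forall>\<epsilon>\<in>{0<..<\<epsilon>0}. \<forall>lam_hom mu_hom.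
                 effective_parameters lam_met Dc \<epsilon> mu l Omega_c lam_hom mu_hom \<longrightarrow>
                 \<bar>lam_hom - lam_dummy \<epsilon>\<bar> \<le> C * \<epsilon>\<^sup>2) \<and>
              (\<exists>C. \<forall>\<epsilon>\<in>{0<..<\<epsilon>0}. \<forall>lam_hom mu_hom.
                 effective_parameters lam_met Dc \<epsilon> mu l Omega_c lam_hom mu_hom \<longrightarrow>
                 \<bar>F lam_hom - F (lam_dummy \<epsilon>)\<bar> \<le> C * \<epsilon>\<^sup>2)"
proof -
  define dummy where "dummy \<epsilon> = embedded_cell (lam_met + \<epsilon> * Dc) lam_met mu l Omega_c Omega_m r1 r2" for \<epsilon>
  define T where "T \<epsilon> = lam_met + measure lebesgue Omega_c * (\<epsilon> * Dc)" for \<epsilon>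
  define m where "m = measure lebesgue (cball center r2)"
  obtain K where K0: "K \<ge> 0" and K: "\<And>lam \<delta>. admissible lam \<Longrightarrow> 0 \<le> \<delta> \<Longrightarrow> \<delta> \<le> Dc \<Longrightarrow>
     (\<And>x. x \<in> Omega \<Longrightarrow> lam_met \<le> lam x \<and> lam x \<le> lam_met + \<delta>) \<Longrightarrow>
     \<bar>force_to_lame mu l (tensile_force lam (\<lambda>_. mu) l) - (lam_met + (LINT x|LO. lam x - lam_met))\<bar> \<le> K * \<delta>\<^sup>2"
    using lame_expansion[OF assms(1,2,4,3)] by blast
  define C1 where "C1 = K * Dc\<^sup>2 / m"
  define C2 where "C2 = K * Dc\<^sup>2"
  have sub: "Omega_c \<subseteq> Omega" using assms(7) by auto
  have small: "0 \<le> \<epsilon> * Dc" "\<epsilon> * Dc \<le> Dc" if "\<epsilon> \<in> {0<..<1}" for \<epsilon>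
    using that assms(3) by (simp_all add: mult_left_le_one_le)
  have dum: "\<forall>n. 2 * l - cell_force (lam_met + \<epsilon> * Dc) lam_met mu l r1 r2 (dummy \<epsilon> n) / (2 * mu) \<noteq> 0"
    "convergent (dummy \<epsilon>)" "lim (dummy \<epsilon>) > 0" "\<bar>lim (dummy \<epsilon>) - T \<epsilon>\<bar> \<le> C1 * \<epsilon>\<^sup>2" if "\<epsilon> \<in> {0<..<1}" for \<epsilon>
    using embedded_cell_converges[OF assms(1,2,4) small(1)[OF that] assms(5-9) K[OF _ small[OF that]]] assms(1)
    by (auto simp: dummy_def T_def C1_def m_def power_mult_distrib mult_ac)
  have hom: "lh > 0 \<and> \<bar>lh - T \<epsilon>\<bar> \<le> C2 * \<epsilon>\<^sup>2"
    if "\<epsilon> \<in> {0<..<1}" "effective_parameters lam_met Dc \<epsilon> mu l Omega_c lh mh" for \<epsilon> lh mh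
    using effective_parameters_estimate[OF assms(1,2,4) _ assms(3) sub assms(5) K[OF _ small[OF that(1)]] that(2)] that(1) assms(1)
    by (auto simp: T_def C2_def power_mult_distrib mult_ac)
  have diff: "\<bar>lh - lim (dummy \<epsilon>)\<bar> \<le> (C1 + C2) * \<epsilon>\<^sup>2"
    if "\<epsilon> \<in> {0<..<1}" "effective_parameters lam_met Dc \<epsilon> mu l Omega_c lh mh" for \<epsilon> lh mh
    using dum(4)[OF that(1)] hom[OF that, THEN conjunct2] unfolding distrib_right by linarith
  have forces: "\<bar>tensile_force (\<lambda>_. lh) (\<lambda>_. mu) l - tensile_force (\<lambda>_. lim (dummy \<epsilon>)) (\<lambda>_. mu) l\<bar> \<le> l * (C1 + C2) * \<epsilon>\<^sup>2"
    if "\<epsilon> \<in> {0<..<1}" "effective_parameters lam_met Dc \<epsilon> mu l Omega_c lh mh" for \<epsilon> lh mh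
  proof -
    have p: "lh > 0" "lim (dummy \<epsilon>) > 0" using hom[OF that] dum(3)[OF that(1)] by auto
    have "\<bar>tensile_force (\<lambda>_. lh) (\<lambda>_. mu) l - tensile_force (\<lambda>_. lim (dummy \<epsilon>)) (\<lambda>_. mu) l\<bar> \<le> l * \<bar>lh - lim (dummy \<epsilon>)\<bar>"
      unfolding tensile_force_const[OF p(1) assms(2,4)] tensile_force_const[OF p(2) assms(2,4)]
      by (rule const_force_Lipschitz[OF p assms(2,4)])
    also have "\<dots> \<le> l * ((C1 + C2) * \<epsilon>\<^sup>2)" using diff[OF that] assms(4) by (intro mult_left_mono) auto
    finally show ?thesis by (simp add: mult.assoc)
  qed
  have Teq: "T \<epsilon> = lam_met + \<epsilon> * measure lebesgue Omega_c * Dc" for \<epsilon> by (simp add: T_def)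
  show ?thesis unfolding Let_def dummy_def[symmetric] Teq[symmetric]
  (* The expansions are uniform for parameters below 1. *)
  proof (rule exI[of _ 1], intro conjI)
    show "\<exists>C. \<forall>\<epsilon>\<in>{0<..<1}. \<bar>lim (dummy \<epsilon>) - T \<epsilon>\<bar> \<le> C * \<epsilon>\<^sup>2"
      using dum(4) by blast
    show "\<exists>C. \<forall>\<epsilon>\<in>{0<..<1}. \<forall>lh mh. effective_parameters lam_met Dc \<epsilon> mu l Omega_c lh mh \<longrightarrow>
        \<bar>lh - lim (dummy \<epsilon>)\<bar> \<le> C * \<epsilon>\<^sup>2"
      using diff by blast
    show "\<exists>C. \<forall>\<epsilon>\<in>{0<..<1}. \<forall>lh mh. effective_parameters lam_met Dc \<epsilon> mu l Omega_c lh mh \<longrightarrow>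
        \<bar>tensile_force (\<lambda>_. lh) (\<lambda>_. mu) l - tensile_force (\<lambda>_. lim (dummy \<epsilon>)) (\<lambda>_. mu) l\<bar> \<le> C * \<epsilon>\<^sup>2"
      using forces by blast
  qed (use dum(1,2) in simp_all)
qed

end
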